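(* (i) Let $n \geq 4$, let $G = \mathrm{S}_n$, let $k$ be an integer with $n > k > \frac{n}{2}$, and let $M = \mathrm{S}_k \times \mathrm{S}_{n-k}$ be an intransitive maximal subgroup of $G$, setwise stabilising $\{1,\ldots,k\}$. (a) If $\gcd(n,k) > 1$, then the unique maximal coclique of $\Gamma(G)$ containing $M$ is $\big(M \cup (1,k+1)^M\big) \setminus \{1\}$. (b) If $(n,k) = (4,3)$, then the unique maximal coclique of $\Gamma(G)$ containing $M$ is $\big(M \cup ((1,4)(2,3))^M\big) \setminus \{1\}$. (ii) Let $(n,k) \in \{(5,3),(6,4)\}$, let $G = \mathrm{A}_n$, and let $M = (\mathrm{S}_k \times \mathrm{S}_{n-k}) \cap G$ be the intransitive maximal subgroup of $G$ setwise stabilising $\{1,\ldots,k\}$. (a) If $(n,k) = (5,3)$, then the unique maximal coclique of $\Gamma(G)$ containing $M$ is $\big(M \cup ((1,4)(2,3))^M\big) \setminus \{1\}$. (b) If $(n,k) = (6,4)$, then the unique maximal coclique of $\Gamma(G)$ containing $M$ is $\big(M \cup ((1,5)(2,6))^M\big) \setminus \{1\}$.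
   Context: $\mathrm{S}_n$ and $\mathrm{A}_n$ are the symmetric and alternating groups acting on $\{1,\ldots,n\}$. In set expressions, $1$ denotes the identity element, and for $g \in G$ the set $g^M = \{m^{-1} g m : m \in M\}$ is the set of $M$-conjugates of $g$. The generating graph $\Gamma(G)$ of a finite group $G$ has as vertex set the non-identity elements of $G$, with two elements joined by an edge exactly when they generate $G$. A coclique in $\Gamma(G)$ is a set of vertices no two of which are adjacent; it is maximal if it is contained in no larger coclique. A coclique is said to contain the subgroup $M$ if it contains $M \setminus \{1\}$. *)

theory Defs
  imports "HOL-Algebra.Sym_Groups" "HOL-Algebra.Group_Action"
begin

definition gen_graph_verts :: "('a, 'b) monoid_scheme \<Rightarrow> 'a set"
  where "gen_graph_verts G = carrier G - {\<one>\<^bsub>G\<^esub>}"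

text \<open>Edges are unordered pairs, so the graph is simple: an element generating a cyclic
  group on its own does not give rise to a loop.\<close>

definition gen_graph_edges :: "('a, 'b) monoid_scheme \<Rightarrow> 'a set set"
  where "gen_graph_edges G =
    {{x, y} | x y. x \<in> gen_graph_verts G \<and> y \<in> gen_graph_verts G \<and> x \<noteq> y \<and>
                   generate G {x, y} = carrier G}"

definition gen_graph_coclique :: "('a, 'b) monoid_scheme \<Rightarrow> 'a set \<Rightarrow> bool"
  where "gen_graph_coclique G C \<longleftrightarrow>
    C \<subseteq> gen_graph_verts G \<and> (\<forall>x\<in>C. \<forall>y\<in>C. {x, y} \<notin> gen_graph_edges G)"

definition gen_graph_maximal_coclique :: "('a, 'b) monoid_scheme \<Rightarrow> 'a set \<Rightarrow> bool"
  where "gen_graph_maximal_coclique G C \<longleftrightarrow>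
    gen_graph_coclique G C \<and> \<not> (\<exists>D. gen_graph_coclique G D \<and> C \<subset> D)"

definition coclique_contains_subgroup ::
    "('a, 'b) monoid_scheme \<Rightarrow> 'a set \<Rightarrow> 'a set \<Rightarrow> bool"
  where "coclique_contains_subgroup G C M \<longleftrightarrow> M - {\<one>\<^bsub>G\<^esub>} \<subseteq> C"

definition unique_maximal_coclique_containing ::
    "('a, 'b) monoid_scheme \<Rightarrow> 'a set \<Rightarrow> 'a set \<Rightarrow> bool"
  where "unique_maximal_coclique_containing G M C \<longleftrightarrow>
    gen_graph_maximal_coclique G C \<and> coclique_contains_subgroup G C M \<and>
    (\<forall>D. gen_graph_maximal_coclique G D \<and> coclique_contains_subgroup G D M \<longrightarrow> D = C)"

definition conjugates_by :: "('a, 'b) monoid_scheme \<Rightarrow> 'a \<Rightarrow> 'a set \<Rightarrow> 'a set"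
  where "conjugates_by G g M = {inv\<^bsub>G\<^esub> m \<otimes>\<^bsub>G\<^esub> g \<otimes>\<^bsub>G\<^esub> m | m. m \<in> M}"

text \<open>For \<open>G = sym_group n\<close> and \<open>1 \<le> k < n\<close> this is \<open>S\<^sub>k \<times> S\<^sub>n\<^sub>-\<^sub>k\<close>, where the factors
  are the symmetric groups on \<open>{1..k}\<close> and \<open>{k+1..n}\<close>; for \<open>G = alt_group n\<close> it is the
  intersection of that group with the alternating group.\<close>

definition set_stabilizer :: "(nat \<Rightarrow> nat) monoid \<Rightarrow> nat \<Rightarrow> (nat \<Rightarrow> nat) set"
  where "set_stabilizer G k = stabilizer G (\<lambda>g X. g ` X) {1..k}"

end

theory Submission
  imports Defs
begin

text \<open>Let \<open>K = {1..k}\<close> and \<open>L = {k+1..n}\<close>. For \<open>m \<in> M\<close> the group generated by \<open>m\<close> and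
  \<open>t = (a b)\<close>, \<open>a \<in> K\<close>, \<open>b \<in> L\<close>, is intransitive unless \<open>m\<close> is a cycle on each of \<open>K\<close> and \<open>L\<close>,
  and in that case the residues modulo \<open>gcd n k\<close> form a block system.

  Conversely, for \<open>x \<notin> M\<close> which is not a transposition, one needs a single \<open>m \<in> M\<close> with
  \<open>\<langle>x, m\<rangle> = S\<^sub>n\<close>. The relation ``\<open>(a b)\<close> belongs to the group'' (or ``some 3-cycle through \<open>a\<close> and
  \<open>b\<close> belongs to the group'') is an invariant equivalence, so it suffices to produce a transposition (or
  a 3-cycle and an odd element) whose support lies in no proper block. Usually \<open>m\<close> is chosen
  through \<open>y = x \<circ> m\<close>, which can be any permutation with \<open>y ` K = x ` K\<close>: a \<open>y\<close> with one
  2-cycle and one or two further cycles of odd length has a transposition among its powers. When \<open>x\<close>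
  moves very few points, \<open>m\<close> is a product of two or three long cycles and the 3-cycle is a
  commutator. The small cases are decided by evaluating explicit words.\<close>

section \<open>Invariant equivalences and generation\<close>

text \<open>Parity shapes the constructions. A transposition appears as an odd power of
  \<open>y\<close>, so every cycle of \<open>y\<close> other than its 2-cycle needs odd length. For
  odd n one cycle on the remaining n - 2 points will do. For even n these points must be split, most
  cheaply into a fixed point of \<open>y\<close> and a cycle of length n - 3; this fixed point must
  be moved by \<open>x\<close>, or the group would be intransitive. Not every point may be fixed by
  \<open>y\<close>: a point of \<open>K\<close> outside the image of \<open>K\<close> under
  \<open>x\<close> has to be moved. These two constraints lead to the distinctions by the number of
  points that \<open>x\<close> carries across and by where \<open>x\<close> has fixed points. The
  gcd hypothesis serves both directions. It supplies the blocks for the pairs that do not generate,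
  and it gives \<open>card K\<close> a lead of at least the gcd over \<open>card L\<close>, which
  leaves room for the constructions; odd n even forces the gcd to be at least 3. Maximality and
  uniqueness come together: once every vertex outside the proposed coclique has a neighbour in
  \<open>M\<close>, each coclique containing \<open>M\<close> lies inside it.\<close>

definition perm_closed :: "('a \<Rightarrow> 'a) set \<Rightarrow> bool"
  where "perm_closed H \<longleftrightarrow> id \<in> H \<and> (\<forall>g\<in>H. \<forall>h\<in>H. g \<circ> h \<in> H) \<and> (\<forall>h\<in>H. inv' h \<in> H)"

text \<open>The sets \<open>H\<close> range over all closed sets of functions, not only over
  subgroups of the symmetric group on \<open>U\<close>. On \<open>{1..n}\<close> the notion is later
  shown to agree with \<open>generate\<close>.\<close>

definition generates_sym :: "'a set \<Rightarrow> ('a \<Rightarrow> 'a) set \<Rightarrow> bool"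
  where "generates_sym U F \<longleftrightarrow> (\<forall>H. perm_closed H \<longrightarrow> F \<subseteq> H \<longrightarrow> (\<forall>p. p permutes U \<longrightarrow> p \<in> H))"

definition generates_alt :: "'a set \<Rightarrow> ('a \<Rightarrow> 'a) set \<Rightarrow> bool"
  where "generates_alt U F \<longleftrightarrow>
    (\<forall>H. perm_closed H \<longrightarrow> F \<subseteq> H \<longrightarrow> (\<forall>p. p permutes U \<longrightarrow> evenperm p \<longrightarrow> p \<in> H))"

definition inv_equiv :: "'a set \<Rightarrow> ('a \<Rightarrow> 'a) set \<Rightarrow> ('a \<times> 'a) set \<Rightarrow> bool"
  where "inv_equiv U F R \<longleftrightarrow>
    equiv U R \<and> (\<forall>g\<in>F. \<forall>a\<in>U. \<forall>b\<in>U. (g a, g b) \<in> R \<longleftrightarrow> (a, b) \<in> R)"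

text \<open>A local substitute for primitivity: only those block systems are excluded in which
  \<open>u\<close> and \<open>v\<close> share a block. This suffices once \<open>(u v)\<close> is
  known to lie in the group.\<close>

definition glues :: "'a set \<Rightarrow> ('a \<Rightarrow> 'a) set \<Rightarrow> 'a \<Rightarrow> 'a \<Rightarrow> bool"
  where "glues U F u v \<longleftrightarrow> (\<forall>R. inv_equiv U F R \<longrightarrow> (u, v) \<in> R \<longrightarrow> R = U \<times> U)"

text \<open>Transitivity, with closure asked in the forward direction only; for permutations and
  finite \<open>D\<close> this already means invariance.\<close>

definition trans_on_set :: "'a set \<Rightarrow> ('a \<Rightarrow> 'a) set \<Rightarrow> bool"
  where "trans_on_set U F \<longleftrightarrow> (\<forall>D. D \<subseteq> U \<longrightarrow> D \<noteq> {} \<longrightarrow> (\<forall>g\<in>F. g ` D \<subseteq> D) \<longrightarrow> D = U)"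

lemma perm_closedD:
  assumes "perm_closed H"
  shows "id \<in> H" "g \<in> H \<Longrightarrow> h \<in> H \<Longrightarrow> g \<circ> h \<in> H" "h \<in> H \<Longrightarrow> inv' h \<in> H"
  using assms unfolding perm_closed_def by auto

lemma perm_closed_funpow:
  assumes "perm_closed H" "g \<in> H" shows "g ^^ i \<in> H"
proof (induction i)
  case 0 show ?case using perm_closedD(1)[OF assms(1)] by (simp add: id_def)
next
  case (Suc i) then show ?case using perm_closedD(2)[OF assms(1) assms(2)] by (metis funpow.simps(2))
qed

lemma transpose_conj:
  assumes "bij g" shows "g \<circ> transpose a b \<circ> inv' g = transpose (g a) (g b)"
proof
  fix z
  have "inv' g z = a \<longleftrightarrow> z = g a" for a
    using assms by (metis bij_inv_eq_iff)
  moreover have "g (inv' g z) = z" using assms by (simp add: bij_is_surj surj_f_inv_f)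
  ultimately show "(g \<circ> transpose a b \<circ> inv' g) z = transpose (g a) (g b) z"
    by (auto simp: transpose_def)
qed

lemma transpose_conj_mem:
  assumes H: "perm_closed H" and "g \<in> H" "bij g"
  shows "transpose (g a) (g b) \<in> H \<longleftrightarrow> transpose a b \<in> H"
proof
  assume "transpose a b \<in> H"
  then show "transpose (g a) (g b) \<in> H"
    using transpose_conj[OF \<open>bij g\<close>, of a b] perm_closedD[OF H] \<open>g \<in> H\<close> by metis
next
  assume h: "transpose (g a) (g b) \<in> H"
  have "inv' g \<circ> transpose (g a) (g b) \<circ> inv' (inv' g) = transpose a b"
    using transpose_conj[OF bij_imp_bij_inv[OF \<open>bij g\<close>], of "g a" "g b"] \<open>bij g\<close>
    by (simp add: bij_is_inj)
  then show "transpose a b \<in> H" using h perm_closedD[OF H] \<open>g \<in> H\<close> by metis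
qed

lemma generates_sym_if_transpose:
  assumes U: "finite U" and per: "\<And>g. g \<in> F \<Longrightarrow> g permutes U"
    and uv: "u \<in> U" "v \<in> U"
    and H: "\<And>H. perm_closed H \<Longrightarrow> F \<subseteq> H \<Longrightarrow> transpose u v \<in> H"
    and gl: "glues U F u v"
  shows "generates_sym U F"
  unfolding generates_sym_def
proof (intro allI impI)
  fix H p assume HH: "perm_closed H" "F \<subseteq> H" and p: "p permutes U"
  define R where "R = {(a, b). a \<in> U \<and> b \<in> U \<and> transpose a b \<in> H}"
  have tr: "transpose a c \<in> H" if "transpose a b \<in> H" "transpose b c \<in> H" for a b c
  proof (cases "a = b \<or> b = c \<or> a = c")
    case False
    then have "transpose a c = transpose a b \<circ> transpose b c \<circ> transpose a b"
      by (auto simp: transpose_def fun_eq_iff)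
    then show ?thesis using that perm_closedD[OF HH(1)] by metis
  qed (use that perm_closedD[OF HH(1)] in \<open>auto simp: transpose_same\<close>)
  have "equiv U R"
    unfolding equiv_def refl_on_def sym_def trans_def R_def
    using perm_closedD[OF HH(1)] tr by (auto simp: transpose_commute)
  then have "inv_equiv U F R"
    unfolding inv_equiv_def R_def
    using transpose_conj_mem[OF HH(1)] HH(2) per[THEN permutes_bij] per[THEN permutes_in_image] by (auto simp: subset_iff)
  then have "R = U \<times> U"
    using gl H[OF HH] uv unfolding glues_def R_def by blast
  then have all: "transpose a b \<in> H" if "a \<in> U" "b \<in> U" for a b
    using that unfolding R_def by blast
  show "p \<in> H"
    using p U
  proof (induction rule: permutes_induct)
    case id show ?case using perm_closedD(1)[OF HH(1)] by (simp add: id_def)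
  next
    case (swap a b p) then show ?case using all perm_closedD(2)[OF HH(1)] by blast
  qed
qed

section \<open>3-cycles in a closed set of permutations\<close>

definition cyc3 :: "'a \<Rightarrow> 'a \<Rightarrow> 'a \<Rightarrow> 'a \<Rightarrow> 'a"
  where "cyc3 a b c = (id(a := b, b := c, c := a))"

lemma cyc3_conj:
  assumes "bij g" "distinct [a, b, c]"
  shows "g \<circ> cyc3 a b c \<circ> inv' g = cyc3 (g a) (g b) (g c)"
proof
  fix z
  have *: "inv' g z = a \<longleftrightarrow> z = g a" for a
    using assms by (metis bij_inv_eq_iff)
  have "g (inv' g z) = z" using assms by (simp add: bij_is_surj surj_f_inv_f)
  moreover have "inj g" using assms by (simp add: bij_is_inj)
  ultimately show "(g \<circ> cyc3 a b c \<circ> inv' g) z = cyc3 (g a) (g b) (g c) z"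
    using assms(2) by (auto simp: cyc3_def * inj_eq)
qed

lemma cyc3_inv: "distinct [a, b, c] \<Longrightarrow> inv' (cyc3 a b c) = cyc3 c b a"
  by (rule inv_unique_comp) (auto simp: cyc3_def fun_eq_iff)

lemma cyc3_rot: "distinct [a, b, c] \<Longrightarrow> cyc3 a b c = cyc3 b c a"
  by (auto simp: cyc3_def fun_eq_iff)

lemma bij_cyc3: "distinct [a, b, c] \<Longrightarrow> bij (cyc3 a b c)"
  by (rule o_bij[of "cyc3 c b a"]) (auto simp: cyc3_def fun_eq_iff)

context
  fixes H :: "('a \<Rightarrow> 'a) set"
  assumes H: "perm_closed H"
begin

lemma cyc3_mem_rev: "cyc3 a b c \<in> H \<Longrightarrow> distinct [a, b, c] \<Longrightarrow> cyc3 c b a \<in> H"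
  using perm_closedD(3)[OF H] cyc3_inv by metis

lemma cyc3_mem_rot: "cyc3 a b c \<in> H \<Longrightarrow> distinct [a, b, c] \<Longrightarrow> cyc3 b c a \<in> H"
  using cyc3_rot by metis

lemma cyc3_mem_conj:
  "cyc3 a b c \<in> H \<Longrightarrow> g \<in> H \<Longrightarrow> bij g \<Longrightarrow> distinct [a, b, c] \<Longrightarrow> cyc3 (g a) (g b) (g c) \<in> H"
  using perm_closedD[OF H] cyc3_conj by metis

definition in_cyc3 :: "'a \<Rightarrow> 'a \<Rightarrow> bool"
  where "in_cyc3 a b \<longleftrightarrow> a = b \<or> (\<exists>c. distinct [a, b, c] \<and> cyc3 a b c \<in> H)"

lemma in_cyc3_sym:
  assumes "in_cyc3 a b" shows "in_cyc3 b a"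
proof (cases "a = b")
  case False
  then obtain c where "distinct [a, b, c]" "cyc3 a b c \<in> H" using assms unfolding in_cyc3_def by blast
  then have "cyc3 b a c \<in> H" "distinct [b, a, c]" 
    using cyc3_mem_rev[of a b c] cyc3_mem_rot[of c b a] by auto
  then show ?thesis unfolding in_cyc3_def by blast
qed (simp add: in_cyc3_def)

text \<open>Given \<open>(a b c)\<close> and \<open>(b d e)\<close> with e different from a,
  conjugating the first by the second keeps a and moves b to d. If e is a, the inverse of the second
  cycle already links a and d.\<close>

lemma in_cyc3_trans:
  assumes "in_cyc3 a b" "in_cyc3 b d" shows "in_cyc3 a d"
proof (cases "a = b \<or> b = d \<or> a = d")
  case False
  with assms obtain c e where c: "distinct [a, b, c]" "cyc3 a b c \<in> H"
    and e: "distinct [b, d, e]" "cyc3 b d e \<in> H" unfolding in_cyc3_def by blast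
  show ?thesis
  proof (cases "e = a")
    case True
    then have "cyc3 a d b \<in> H" using e cyc3_mem_rev by blast
    then show ?thesis using True e False unfolding in_cyc3_def by auto
  next
    case ne: False
    define g where "g = cyc3 b d e"
    have g: "bij g" "g \<in> H" unfolding g_def using e bij_cyc3[of b d e] by blast+
    have "cyc3 (g a) (g b) (g c) \<in> H" using cyc3_mem_conj c g by blast
    moreover have "g a = a" "g b = d" using ne False e by (auto simp: g_def cyc3_def)
    moreover have "distinct [g a, g b, g c]"
      using c bij_is_inj[OF g(1)] by (auto simp: inj_eq)
    ultimately show ?thesis unfolding in_cyc3_def by auto
  qed
qed (use assms in \<open>auto simp: in_cyc3_def\<close>)

lemma in_cyc3_conj:
  assumes "in_cyc3 a b" "g \<in> H" "bij g" shows "in_cyc3 (g a) (g b)"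
proof (cases "a = b")
  case False
  then obtain c where c: "distinct [a, b, c]" "cyc3 a b c \<in> H" using assms unfolding in_cyc3_def by blast
  then have "distinct [g a, g b, g c]" using bij_is_inj[OF assms(3)] by (auto simp: inj_eq)
  then show ?thesis unfolding in_cyc3_def using cyc3_mem_conj[OF c(2) assms(2,3) c(1)] by blast
qed (simp add: in_cyc3_def)

text \<open>Some \<open>(a b e)\<close> lies in \<open>H\<close>, and conjugation by a 3-cycle
  \<open>(e c f)\<close> replaces e by c. If f is a or b this disturbs the other points, and the
  inverse cycle is used instead; it yields \<open>(a b c)\<close> up to inversion and
  rotation.\<close>

lemma cyc3_mem_if_in_cyc3:
  assumes all: "\<And>a b. a \<in> U \<Longrightarrow> b \<in> U \<Longrightarrow> in_cyc3 a b"
    and U: "a \<in> U" "b \<in> U" "c \<in> U" and d: "distinct [a, b, c]"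
    and per: "\<And>g. g \<in> H \<Longrightarrow> g permutes U"
  shows "cyc3 a b c \<in> H"
proof -
  obtain e where e: "distinct [a, b, e]" "cyc3 a b e \<in> H"
    using all[of a b] U d unfolding in_cyc3_def by auto
  show ?thesis
  proof (cases "e = c")
    case False
    have "e \<in> U"
    proof (rule ccontr)
      assume "e \<notin> U"
      then have "cyc3 a b e e = e" using per[OF e(2)] permutes_not_in by metis
      then show False using e by (simp add: cyc3_def)
    qed
    then obtain f where f: "distinct [e, c, f]" "cyc3 e c f \<in> H"
      using all[of e c] U False unfolding in_cyc3_def by auto
    define g where "g = cyc3 e c f"
    have g: "bij g" "g \<in> H" unfolding g_def using f bij_cyc3[of e c f] by blast+
    show ?thesis
    proof (cases "f \<in> {a, b}")
      case False
      have "cyc3 (g a) (g b) (g e) \<in> H" using cyc3_mem_conj e g by blast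
      moreover have "g a = a" "g b = b" "g e = c" using False f e d by (auto simp: g_def cyc3_def)
      ultimately show ?thesis by simp
    next
      case True
      define h where "h = cyc3 f c e"
      have h: "bij h" "h \<in> H" unfolding h_def using f bij_cyc3[of f c e] cyc3_mem_rev[of e c f] by auto
      have *: "cyc3 (h a) (h b) (h e) \<in> H" using cyc3_mem_conj e h by blast
      show ?thesis
      proof (cases "f = a")
        case True
        then have "h a = c" "h b = b" "h e = a" using f e d by (auto simp: h_def cyc3_def)
        then have "cyc3 c b a \<in> H" using * by simp
        then show ?thesis using cyc3_mem_rev d by auto
      next
        case False
        then have "h a = a" "h b = c" "h e = b" using True f e d by (auto simp: h_def cyc3_def)
        then have "cyc3 a c b \<in> H" using * by simp
        then have "cyc3 b c a \<in> H" using cyc3_mem_rev d by auto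
        then show ?thesis using cyc3_mem_rot d by auto
      qed
    qed
  qed (use e in auto)
qed

end

text \<open>Two transpositions sharing a point multiply to a 3-cycle or the identity. In the general
  case the factor \<open>(b c)\<close> is inserted twice in the middle, which splits the product
  into two of this kind.\<close>

lemma transpose_comp_mem_if_cyc3:
  assumes H: "perm_closed H"
    and all: "\<And>a b c. a \<in> U \<Longrightarrow> b \<in> U \<Longrightarrow> c \<in> U \<Longrightarrow> distinct [a, b, c] \<Longrightarrow> cyc3 a b c \<in> H"
    and U: "a \<in> U" "b \<in> U" "c \<in> U" "d \<in> U" and "a \<noteq> b" "c \<noteq> d"
  shows "transpose a b \<circ> transpose c d \<in> H"
proof -
  have share: "transpose a b \<circ> transpose b c \<in> H"
    if "a \<in> U" "b \<in> U" "c \<in> U" "a \<noteq> b" "b \<noteq> c" for a b c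
  proof (cases "a = c")
    case True
    then have "transpose a b \<circ> transpose b c = id" by (simp add: transpose_commute)
    then show ?thesis using perm_closedD[OF H] by simp
  next
    case False
    then have "transpose a b \<circ> transpose b c = cyc3 a b c"
      using that by (auto simp: transpose_def cyc3_def fun_eq_iff)
    then show ?thesis using all that False by auto
  qed
  show ?thesis
  proof (cases "b = c")
    case False
    have "transpose a b \<circ> transpose c d = (transpose a b \<circ> transpose b c) \<circ> (transpose b c \<circ> transpose c d)"
      by (auto simp: fun_eq_iff)
    then show ?thesis using share[of a b c] share[of b c d] assms False perm_closedD[OF H] by metis
  qed (use share assms in auto)
qed

lemma even_mem_if_cyc3:
  assumes H: "perm_closed H" and U: "finite U"
    and all: "\<And>a b c. a \<in> U \<Longrightarrow> b \<in> U \<Longrightarrow> c \<in> U \<Longrightarrow> distinct [a, b, c] \<Longrightarrow> cyc3 a b c \<in> H"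
    and "p permutes U" "evenperm p"
  shows "p \<in> H"
proof -
  \<comment> \<open>The induction adds one transposition at a time and so passes through odd
    permutations; for these the claim is made after multiplication by an arbitrary
    transposition.\<close>
  have "(evenperm p \<longrightarrow> p \<in> H) \<and>
    (\<not> evenperm p \<longrightarrow> (\<forall>a\<in>U. \<forall>b\<in>U. a \<noteq> b \<longrightarrow> transpose a b \<circ> p \<in> H))"
    using \<open>p permutes U\<close> U
  proof (induction rule: permutes_induct)
    case id show ?case using perm_closedD(1)[OF H] by (simp add: id_def)
  next
    case (swap a b p)
    have "permutation p" using swap U permutes_imp_permutation by metis
    then have ev: "evenperm (transpose a b \<circ> p) \<longleftrightarrow> (a = b \<longleftrightarrow> evenperm p)"
      by (simp add: evenperm_comp permutation_swap_id evenperm_swap)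
    show ?case
    proof (cases "a = b")
      case True
      then have "transpose a b \<circ> p = p" by simp
      then show ?thesis using swap by simp
    next
      case False
      have "transpose c d \<circ> (transpose a b \<circ> p) \<in> H"
        if "evenperm p" "c \<in> U" "d \<in> U" "c \<noteq> d" for c d
        using transpose_comp_mem_if_cyc3[OF H all, of U c d a b] that swap False perm_closedD[OF H]
        by (simp add: o_assoc)
      then show ?thesis using swap False ev by blast
    qed
  qed
  then show ?thesis using assms by blast
qed

lemma generates_alt_if_cyc3:
  assumes U: "finite U" and per: "\<And>g. g \<in> F \<Longrightarrow> g permutes U"
    and uv: "u \<in> U" "v \<in> U" "w \<in> U" "distinct [u, v, w]"
    and H: "\<And>H. perm_closed H \<Longrightarrow> F \<subseteq> H \<Longrightarrow> cyc3 u v w \<in> H"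
    and gl: "\<And>R. inv_equiv U F R \<Longrightarrow> (u, v) \<in> R \<Longrightarrow> (u, w) \<in> R \<Longrightarrow> R = U \<times> U"
  shows "generates_alt U F"
  unfolding generates_alt_def
proof (intro allI impI)
  fix H p assume HH: "perm_closed H" "F \<subseteq> H" and p: "p permutes U" "evenperm p"
  \<comment> \<open>\<open>H\<close> may contain functions that do not permute \<open>U\<close>.
    Cutting it down ensures that the third point of every 3-cycle used lies in
    \<open>U\<close>.\<close>
  define H' where "H' = H \<inter> {p. p permutes U}"
  have H': "perm_closed H'" "F \<subseteq> H'"
    using HH per permutes_compose permutes_inv permutes_id[of U]
    unfolding H'_def perm_closed_def by (auto simp: id_def)
  define R where "R = {(a, b). a \<in> U \<and> b \<in> U \<and> in_cyc3 H' a b}"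
  have "equiv U R"
    unfolding equiv_def refl_on_def sym_def trans_def R_def
    using in_cyc3_sym[OF H'(1)] in_cyc3_trans[OF H'(1)] in_cyc3_def[OF H'(1)] by blast
  moreover have "in_cyc3 H' (g a) (g b) \<longleftrightarrow> in_cyc3 H' a b" if "g \<in> F" for g a b
  proof -
    have g: "g \<in> H'" "bij g" using that H' per permutes_bij by blast+
    then have "inv' g \<in> H'" "bij (inv' g)" "inv' g (g a) = a" "inv' g (g b) = b"
      using perm_closedD[OF H'(1)] bij_imp_bij_inv by (auto simp: bij_is_inj)
    then show ?thesis using in_cyc3_conj[OF H'(1)] g by metis
  qed
  ultimately have "inv_equiv U F R"
    unfolding inv_equiv_def R_def using per[THEN permutes_in_image] by auto
  moreover have "in_cyc3 H' u v"
    using H[OF H'] uv unfolding in_cyc3_def[OF H'(1)] by blast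
  \<comment> \<open>The inverse of \<open>(u v w)\<close>, needed because the relation reads off
    only the first two entries of a 3-cycle.\<close>
  moreover have "cyc3 u w v \<in> H'"
    using cyc3_mem_rot[OF H'(1) cyc3_mem_rot[OF H'(1) cyc3_mem_rev[OF H'(1) H[OF H'] uv(4)]]] uv(4) by force
  then have "in_cyc3 H' u w"
    using uv unfolding in_cyc3_def[OF H'(1)] by auto
  ultimately have "R = U \<times> U" using gl uv unfolding R_def by blast
  then have "\<And>a b. a \<in> U \<Longrightarrow> b \<in> U \<Longrightarrow> in_cyc3 H' a b" unfolding R_def by blast
  then have "p \<in> H'"
    using cyc3_mem_if_in_cyc3[OF H'(1), of U] even_mem_if_cyc3[OF H'(1) U] p
    unfolding H'_def by blast
  then show "p \<in> H" unfolding H'_def by blast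
qed

lemma generates_sym_if_alt_odd:
  assumes U: "finite U" and "generates_alt U F" and z: "z \<in> F" "z permutes U" "\<not> evenperm z"
  shows "generates_sym U F"
  unfolding generates_sym_def
proof (intro allI impI)
  fix H p assume H: "perm_closed H" "F \<subseteq> H" and p: "p permutes U"
  show "p \<in> H"
  proof (cases "evenperm p")
    case True then show ?thesis using assms H p unfolding generates_alt_def by blast
  next
    case False
    have "permutation p" "permutation z" using p z U permutes_imp_permutation by blast+
    then have "evenperm (p \<circ> inv' z)"
      using False z by (simp add: evenperm_comp permutation_inverse evenperm_inv)
    moreover have "p \<circ> inv' z permutes U" using p z permutes_compose permutes_inv by blast
    ultimately have "p \<circ> inv' z \<in> H" using assms H unfolding generates_alt_def by blast
    then have "p \<circ> inv' z \<circ> z \<in> H" using perm_closedD[OF H(1)] H z by blast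
    moreover have "p \<circ> inv' z \<circ> z = p"
      using permutes_inv_o(2)[OF z(2)] by (simp add: comp_assoc)
    ultimately show ?thesis by simp
  qed
qed

section \<open>Permutations with a single cycle on a set\<close>

text \<open>A single cycle as a minimal closed set, so that orbit arguments become closure arguments
  without any enumeration. A fixed point is a cycle of length one.\<close>

definition cyc_on :: "('a \<Rightarrow> 'a) \<Rightarrow> 'a set \<Rightarrow> bool"
  where "cyc_on f W \<longleftrightarrow> f ` W \<subseteq> W \<and> (\<forall>D. D \<subseteq> W \<longrightarrow> D \<noteq> {} \<longrightarrow> f ` D \<subseteq> D \<longrightarrow> D = W)"

lemma cyc_on_subset:
  assumes "cyc_on f W" "f ` D \<subseteq> D" "a \<in> D" "a \<in> W" shows "W \<subseteq> D"
proof -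
  have "f ` (D \<inter> W) \<subseteq> D \<inter> W" using assms unfolding cyc_on_def by blast
  then have "D \<inter> W = W" using assms unfolding cyc_on_def by blast
  then show ?thesis by blast
qed

lemma cyc_on_closed: "cyc_on f W \<Longrightarrow> a \<in> W \<Longrightarrow> f a \<in> W"
  unfolding cyc_on_def by blast

lemma cyc_on_cong: "(\<And>z. z \<in> W \<Longrightarrow> f z = g z) \<Longrightarrow> cyc_on f W \<longleftrightarrow> cyc_on g W"
  unfolding cyc_on_def by (smt (verit, ccfv_threshold) image_cong subset_iff)

lemma cyc_on_singleton: "f z = z \<Longrightarrow> cyc_on f {z}"
  unfolding cyc_on_def by auto

lemma cyc_on_pair: "f u = v \<Longrightarrow> f v = u \<Longrightarrow> cyc_on f {u, v}"
  unfolding cyc_on_def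
proof (intro conjI allI impI)
  fix D assume f: "f u = v" "f v = u" and D: "D \<subseteq> {u, v}" "D \<noteq> {}" "f ` D \<subseteq> D"
  have "f z \<in> D" if "z \<in> D" for z using D that by blast
  then have "u \<in> D \<longleftrightarrow> v \<in> D" using f by metis
  then show "D = {u, v}" using D by blast
qed auto

text \<open>The new permutation sends e to p and p to the old image of e: the point p is inserted
  into the cycle directly after e.\<close>

lemma cyc_on_insert:
  assumes f: "cyc_on f W" and e: "e \<in> W" and p: "p \<notin> W" "f p = p"
  shows "cyc_on (f \<circ> transpose e p) (insert p W)"
proof -
  define g where "g = f \<circ> transpose e p"
  have g: "g e = p" "g p = f e" "\<And>z. z \<noteq> e \<Longrightarrow> z \<noteq> p \<Longrightarrow> g z = f z"
    using e p by (auto simp: g_def transpose_def)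
  have "g ` insert p W \<subseteq> insert p W"
    using g cyc_on_closed[OF f] e p by (metis image_subsetI insertCI insertE)
  moreover have "D = insert p W" if D: "D \<subseteq> insert p W" "D \<noteq> {}" "g ` D \<subseteq> D" for D
  proof -
    have cl: "g z \<in> D" if "z \<in> D" for z using D that by blast
    have ep: "e \<in> D \<Longrightarrow> p \<in> D" using cl[of e] g by simp
    have "f ` (D \<inter> W) \<subseteq> D \<inter> W"
    proof
      fix y assume "y \<in> f ` (D \<inter> W)"
      then obtain z where z: "z \<in> D" "z \<in> W" "y = f z" by blast
      have "f z \<in> D"
      proof (cases "z = e")
        case True then show ?thesis using cl[of p] ep z g by auto
      next
        case False then show ?thesis using cl[of z] z g p by metis
      qed
      then show "y \<in> D \<inter> W" using z cyc_on_closed[OF f] by auto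
    qed
    moreover have "D \<inter> W \<noteq> {}"
    proof (cases "p \<in> D")
      case True then show ?thesis using cl[of p] g cyc_on_closed[OF f e] by auto
    qed (use D in blast)
    ultimately have "D \<inter> W = W" using f unfolding cyc_on_def by blast
    then show ?thesis using ep e D by blast
  qed
  ultimately show ?thesis unfolding cyc_on_def g_def by blast
qed

text \<open>Take the least positive return time p of a. The first p iterates are distinct and form a
  closed subset of \<open>W\<close>, hence all of it, so p is \<open>card W\<close>.\<close>

lemma cyc_on_funpow_eq_iff:
  assumes f: "cyc_on f W" and U: "f permutes U" "finite U" and W: "finite W" and a: "a \<in> W"
  shows "(f ^^ i) a = a \<longleftrightarrow> card W dvd i"
proof -
  have "permutation f" using U permutes_imp_permutation by blast
  then obtain n where "(f ^^ n) a = a" "n > 0" using permutation_self by metis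
  then have ex: "\<exists>p. p > 0 \<and> (f ^^ p) a = a" by blast
  define p where "p = (LEAST p. p > 0 \<and> (f ^^ p) a = a)"
  have p: "p > 0" "(f ^^ p) a = a"
    using LeastI_ex[OF ex] unfolding p_def by auto
  have min: "p \<le> q" if "q > 0" "(f ^^ q) a = a" for q
    using that unfolding p_def by (simp add: Least_le)
  have md: "(f ^^ i) a = (f ^^ (i mod p)) a" for i
    using funpow_mod_eq[OF p(2)] by metis
  define D where "D = (\<lambda>i. (f ^^ i) a) ` {..<p}"
  have mem: "(f ^^ i) a \<in> D" for i
    using md[of i] p(1) unfolding D_def by auto
  have DW: "(f ^^ i) a \<in> W" for i
    by (induction i) (use a cyc_on_closed[OF f] in auto)
  have "f ` D \<subseteq> D"
  proof
    fix y assume "y \<in> f ` D"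
    then obtain i where "y = (f ^^ Suc i) a" unfolding D_def by auto
    then show "y \<in> D" using mem by metis
  qed
  moreover have "a \<in> D" using mem[of 0] by simp
  ultimately have "W \<subseteq> D" using cyc_on_subset[OF f] a by blast
  then have WD: "W = D" using DW unfolding D_def by blast
  have "inj_on (\<lambda>i. (f ^^ i) a) {..<p}"
  proof (rule linorder_inj_onI)
    fix i j assume ij: "i < j" "i \<in> {..<p}" "j \<in> {..<p}"
    have inj: "inj (f ^^ i)" using U permutes_inj by (metis inj_fn)
    show "(f ^^ i) a \<noteq> (f ^^ j) a"
    proof
      assume "(f ^^ i) a = (f ^^ j) a"
      also have "\<dots> = (f ^^ i) ((f ^^ (j - i)) a)"
        using ij by (metis funpow_add less_imp_le_nat o_apply ordered_cancel_comm_monoid_diff_class.add_diff_inverse)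
      finally have "(f ^^ (j - i)) a = a" using inj by (simp add: inj_eq)
      then show False using min[of "j - i"] ij by auto
    qed
  qed auto
  then have "card W = p" unfolding WD D_def by (simp add: card_image)
  moreover have "(f ^^ i) a = a \<longleftrightarrow> p dvd i"
  proof
    assume "(f ^^ i) a = a"
    then have "(f ^^ (i mod p)) a = a" using md by metis
    then have "i mod p = 0" using min[of "i mod p"] p(1) by (meson bot_nat_0.not_eq_extremum mod_less_divisor not_le)
    then show "p dvd i" by auto
  next
    assume "p dvd i"
    then show "(f ^^ i) a = a" using md[of i] by simp
  qed
  ultimately show ?thesis by simp
qed

lemma ex_cyc_on:
  assumes "finite W" "W \<noteq> {}"
  obtains f where "f permutes W" "cyc_on f W" "evenperm f \<longleftrightarrow> odd (card W)"
proof -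
  have "\<exists>f. f permutes W \<and> cyc_on f W \<and> (evenperm f \<longleftrightarrow> odd (card W))"
    using assms
  proof (induction W rule: finite_ne_induct)
    case (singleton z)
    have "cyc_on id {z}" by (rule cyc_on_singleton) simp
    then show ?case using permutes_id[of "{z}"] by (intro exI[of _ id]) (auto simp: id_def)
  next
    case (insert p W)
    then obtain f e where f: "f permutes W" "cyc_on f W" "evenperm f \<longleftrightarrow> odd (card W)" and e: "e \<in> W"
      by blast
    have "f p = p" using f insert permutes_not_in by metis
    then have "cyc_on (f \<circ> transpose e p) (insert p W)" using cyc_on_insert f e insert by metis
    moreover have "f \<circ> transpose e p permutes insert p W"
      using permutes_compose[OF permutes_swap_id[of e "insert p W" p] permutes_subset[OF f(1), of "insert p W"]] e
      by blast
    moreover have "permutation f" using f insert permutes_imp_permutation by blast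
    then have "evenperm (f \<circ> transpose e p) \<longleftrightarrow> \<not> evenperm f"
      using e insert by (auto simp: evenperm_comp permutation_swap_id evenperm_swap)
    moreover have "card (insert p W) = Suc (card W)" using insert by simp
    ultimately show ?case using f(3) by (metis even_Suc)
  qed
  then show ?thesis using that by blast
qed

lemma permutes_comp_disjoint:
  assumes "f permutes A" "g permutes B" "A \<inter> B = {}"
  shows "f \<circ> g permutes A \<union> B" "\<And>z. z \<in> A \<Longrightarrow> (f \<circ> g) z = f z" "\<And>z. z \<in> B \<Longrightarrow> (f \<circ> g) z = g z"
proof -
  show "f \<circ> g permutes A \<union> B"
    using assms by (intro permutes_compose) (auto intro: permutes_subset)
  show "(f \<circ> g) z = f z" if "z \<in> A" for z
    using that assms permutes_not_in[OF assms(2), of z] by (metis comp_apply disjoint_iff)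
  show "(f \<circ> g) z = g z" if "z \<in> B" for z
    using that assms permutes_not_in[OF assms(1), of "g z"] permutes_in_image[OF assms(2), of z] by auto
qed

lemma evenperm_comp_permutes:
  assumes "f permutes A" "g permutes B" "finite A" "finite B"
  shows "evenperm (f \<circ> g) \<longleftrightarrow> (evenperm f \<longleftrightarrow> evenperm g)"
  using assms by (intro evenperm_comp permutes_imp_permutation)

lemma cyc_on_comp_disjoint:
  assumes "f permutes A" "g permutes B" "A \<inter> B = {}"
  shows "W \<subseteq> A \<Longrightarrow> cyc_on f W \<Longrightarrow> cyc_on (f \<circ> g) W" "W \<subseteq> B \<Longrightarrow> cyc_on g W \<Longrightarrow> cyc_on (f \<circ> g) W"
  using cyc_on_cong[of W "f \<circ> g"] permutes_comp_disjoint(2,3)[OF assms] by (metis subset_iff)+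

lemma closed_mem_iff:
  assumes "g permutes U" "finite D" "g ` D \<subseteq> D" shows "g a \<in> D \<longleftrightarrow> a \<in> D"
proof
  assume "g a \<in> D"
  have "inj g" using assms permutes_inj by blast
  then have "card (g ` D) = card D" by (simp add: card_image inj_on_subset)
  then have "g ` D = D" using assms by (simp add: card_subset_eq)
  then obtain b where "b \<in> D" "g a = g b" using \<open>g a \<in> D\<close> by blast
  then show "a \<in> D" using \<open>inj g\<close> by (simp add: inj_eq)
qed (use assms in blast)

lemma trans_on_setI:
  assumes U: "finite U" and per: "\<And>g. g \<in> F \<Longrightarrow> g permutes U"
    and *: "\<And>D a. D \<subseteq> U \<Longrightarrow> a \<in> D \<Longrightarrow> (\<And>g a. g \<in> F \<Longrightarrow> g a \<in> D \<longleftrightarrow> a \<in> D)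
      \<Longrightarrow> (\<And>g W a. g \<in> F \<Longrightarrow> cyc_on g W \<Longrightarrow> a \<in> W \<Longrightarrow> a \<in> D \<Longrightarrow> W \<subseteq> D) \<Longrightarrow> U \<subseteq> D"
  shows "trans_on_set U F"
  unfolding trans_on_set_def
proof (intro allI impI)
  fix D assume D: "D \<subseteq> U" "D \<noteq> {}" and cl: "\<forall>g\<in>F. g ` D \<subseteq> D"
  obtain a where a: "a \<in> D" using D by blast
  have "g b \<in> D \<longleftrightarrow> b \<in> D" if "g \<in> F" for g b
    by (rule closed_mem_iff[OF per[OF that] finite_subset[OF D(1) U] bspec[OF cl that]])
  moreover have "W \<subseteq> D" if "g \<in> F" "cyc_on g W" "b \<in> W" "b \<in> D" for g W b
    by (rule cyc_on_subset[OF that(2) bspec[OF cl that(1)] that(4,3)])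
  ultimately have "U \<subseteq> D" by (rule *[OF D(1) a])
  then show "D = U" using D by blast
qed

section \<open>Blocks under a transitive set of generators\<close>

locale inv_relation =
  fixes U :: "'a set" and F :: "('a \<Rightarrow> 'a) set" and R :: "('a \<times> 'a) set"
  assumes fin: "finite U" and per: "g \<in> F \<Longrightarrow> g permutes U"
    and tr: "trans_on_set U F" and R: "inv_equiv U F R"
begin

definition rel (infix "~~" 50) where "a ~~ b \<longleftrightarrow> (a, b) \<in> R"

lemma rel_refl: "a \<in> U \<Longrightarrow> a ~~ a"
  using R unfolding rel_def inv_equiv_def equiv_def refl_on_def by blast
lemma rel_sym: "a ~~ b \<Longrightarrow> b ~~ a"
  using R unfolding rel_def inv_equiv_def equiv_def sym_def by blast
lemma rel_trans: "a ~~ b \<Longrightarrow> b ~~ c \<Longrightarrow> a ~~ c"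
  using R unfolding rel_def inv_equiv_def equiv_def trans_def by blast
lemma rel_mem: "a ~~ b \<Longrightarrow> a \<in> U \<and> b \<in> U"
  using R unfolding rel_def inv_equiv_def equiv_def refl_on_def by blast
lemma rel_app: "g \<in> F \<Longrightarrow> a \<in> U \<Longrightarrow> b \<in> U \<Longrightarrow> g a ~~ g b \<longleftrightarrow> a ~~ b"
  using R unfolding rel_def inv_equiv_def by blast

definition cls where "cls a = {b. a ~~ b}"

text \<open>A block that meets its image under g is mapped into itself; d and its image are the
  witnesses.\<close>

lemma cls_closed:
  assumes g: "g \<in> F" and d: "a ~~ d" "a ~~ g d"
  shows "g ` cls a \<subseteq> cls a"
proof
  fix y assume "y \<in> g ` cls a"
  then obtain b where b: "a ~~ b" "y = g b" unfolding cls_def by blast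
  then have "d ~~ b" using d rel_sym rel_trans by blast
  then have "g d ~~ g b" using rel_app[OF g] rel_mem by blast
  then show "y \<in> cls a" using d b rel_trans unfolding cls_def by blast
qed

lemma rel_cyc:
  assumes "g \<in> F" "a ~~ d" "a ~~ g d" "cyc_on g W" "b \<in> W" "a ~~ b" "c \<in> W"
  shows "a ~~ c"
  using cyc_on_subset[OF assms(4) cls_closed[OF assms(1-3)], of b] assms(5-) unfolding cls_def by blast

text \<open>If the block of a meets its image under each generator, it is invariant, and
  transitivity makes it all of \<open>U\<close>.\<close>

lemma full_if_closed:
  assumes "a \<in> U" "\<And>g. g \<in> F \<Longrightarrow> \<exists>d. a ~~ d \<and> a ~~ g d"
  shows "R = U \<times> U"
proof -
  have "cls a \<subseteq> U" using rel_mem unfolding cls_def by blast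
  moreover have "a \<in> cls a" using rel_refl assms unfolding cls_def by blast
  moreover have "\<forall>g\<in>F. g ` cls a \<subseteq> cls a" using assms cls_closed by blast
  ultimately have "cls a = U" using tr unfolding trans_on_set_def by blast
  then have "b ~~ c" if "b \<in> U" "c \<in> U" for b c
    using that rel_sym rel_trans unfolding cls_def by blast
  moreover have "R \<subseteq> U \<times> U" using R unfolding inv_equiv_def equiv_def refl_on_def by blast
  ultimately show ?thesis unfolding rel_def by blast
qed

text \<open>The points with a singleton class form an invariant set, so by transitivity one such
  point forces the relation to be equality.\<close>

lemma cls_trivial_if:
  assumes a: "a \<in> U" "\<And>b. a ~~ b \<Longrightarrow> b = a" and "b ~~ c"
  shows "b = c"
proof -
  define D where "D = {b \<in> U. \<forall>c. b ~~ c \<longrightarrow> c = b}"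
  have "g ` D \<subseteq> D" if g: "g \<in> F" for g
  proof
    fix y assume "y \<in> g ` D"
    then obtain b where b: "b \<in> D" "y = g b" by blast
    have "c = y" if yc: "y ~~ c" for c
    proof -
      obtain c' where c': "c = g c'" "c' \<in> U"
        using rel_mem[OF yc] permutes_image[OF per[OF g]] by blast
      then have "b ~~ c'" using rel_app[OF g] b yc unfolding D_def by blast
      then show ?thesis using b c' unfolding D_def by blast
    qed
    then show "y \<in> D" using b permutes_in_image[OF per[OF g]] unfolding D_def by blast
  qed
  moreover have "D \<subseteq> U" "D \<noteq> {}" using a unfolding D_def by blast+
  ultimately have "D = U" using tr unfolding trans_on_set_def by blast
  then show ?thesis using assms rel_mem unfolding D_def by blast
qed

lemma rel_funpow: "g \<in> F \<Longrightarrow> a ~~ b \<Longrightarrow> (g ^^ i) a ~~ (g ^^ i) b"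
proof (induction i)
  case (Suc i) then show ?case using rel_app[OF Suc(2)] rel_mem[OF Suc.IH] by auto
qed simp

end

section \<open>Permutations mapping the two parts in a prescribed way\<close>

lemma gluesI:
  assumes "finite U" "\<And>g. g \<in> F \<Longrightarrow> g permutes U" "trans_on_set U F"
    and "\<And>R. inv_relation U F R \<Longrightarrow> (u, v) \<in> R \<Longrightarrow> R = U \<times> U"
  shows "glues U F u v"
  using assms unfolding glues_def inv_relation_def by blast

lemma trans_on_set_two:
  assumes "finite U" "x permutes U" "y permutes U" and U: "U \<subseteq> A \<union> B"
    and cyc: "cyc_on y A" "cyc_on y B"
    and "a \<in> U" "(a \<in> A) \<noteq> (x a \<in> A)"
  shows "trans_on_set U {x, y}"
proof (rule trans_on_setI)
  fix D b
  assume D: "D \<subseteq> U" "b \<in> D" and x: "\<And>g a. g \<in> {x, y} \<Longrightarrow> g a \<in> D \<longleftrightarrow> a \<in> D"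
    and y: "\<And>g W a. g \<in> {x, y} \<Longrightarrow> cyc_on g W \<Longrightarrow> a \<in> W \<Longrightarrow> a \<in> D \<Longrightarrow> W \<subseteq> D"
  have "c \<in> D \<Longrightarrow> c \<in> A \<Longrightarrow> A \<subseteq> D" "c \<in> D \<Longrightarrow> c \<in> B \<Longrightarrow> B \<subseteq> D" for c
    using y[of y] cyc by blast+
  moreover have "x a \<in> U" using assms permutes_in_image by metis
  ultimately show "U \<subseteq> D" using assms D x[of x a] by blast
qed (use assms in auto)

text \<open>View the three \<open>y\<close>-cycles as vertices, joined when \<open>x\<close> carries
  a point from one to another. The points a, b, c show that no vertex is isolated, and a graph on
  three vertices without isolated vertices is connected.\<close>

lemma trans_on_set_three:
  assumes "finite U" "x permutes U" "y permutes U" and U: "U \<subseteq> A \<union> B \<union> C"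
    and cyc: "cyc_on y A" "cyc_on y B" "cyc_on y C"
    and a: "a \<in> U" "(a \<in> A) \<noteq> (x a \<in> A)"
    and b: "b \<in> U" "(b \<in> B) \<noteq> (x b \<in> B)"
    and c: "c \<in> U" "(c \<in> C) \<noteq> (x c \<in> C)"
  shows "trans_on_set U {x, y}"
proof (rule trans_on_setI)
  fix D d
  assume D: "D \<subseteq> U" "d \<in> D" and x: "\<And>g a. g \<in> {x, y} \<Longrightarrow> g a \<in> D \<longleftrightarrow> a \<in> D"
    and y: "\<And>g W a. g \<in> {x, y} \<Longrightarrow> cyc_on g W \<Longrightarrow> a \<in> W \<Longrightarrow> a \<in> D \<Longrightarrow> W \<subseteq> D"
  have *: "e \<in> D \<Longrightarrow> e \<in> A \<Longrightarrow> A \<subseteq> D" "e \<in> D \<Longrightarrow> e \<in> B \<Longrightarrow> B \<subseteq> D" "e \<in> D \<Longrightarrow> e \<in> C \<Longrightarrow> C \<subseteq> D" for e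
    using y[of y] cyc by blast+
  have "x a \<in> U" "x b \<in> U" "x c \<in> U" using assms permutes_in_image by metis+
  then have mem: "a \<in> A \<or> a \<in> B \<or> a \<in> C" "b \<in> A \<or> b \<in> B \<or> b \<in> C" "c \<in> A \<or> c \<in> B \<or> c \<in> C"
    "x a \<in> A \<or> x a \<in> B \<or> x a \<in> C" "x b \<in> A \<or> x b \<in> B \<or> x b \<in> C" "x c \<in> A \<or> x c \<in> B \<or> x c \<in> C"
    using U a(1) b(1) c(1) by auto
  have sw: "a \<in> D \<longleftrightarrow> x a \<in> D" "b \<in> D \<longleftrightarrow> x b \<in> D" "c \<in> D \<longleftrightarrow> x c \<in> D" using x[of x] by auto
  have iff: "\<And>e. e \<in> A \<Longrightarrow> e \<in> D \<longleftrightarrow> A \<subseteq> D" "\<And>e. e \<in> B \<Longrightarrow> e \<in> D \<longleftrightarrow> B \<subseteq> D" "\<And>e. e \<in> C \<Longrightarrow> e \<in> D \<longleftrightarrow> C \<subseteq> D"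
    using * by blast+
  have "A \<subseteq> D \<or> B \<subseteq> D \<or> C \<subseteq> D" using D U * by blast
  moreover have "(A \<subseteq> D) = (B \<subseteq> D) \<or> (A \<subseteq> D) = (C \<subseteq> D)"
    using a(2) mem(1,4) sw(1) iff[of a] iff[of "x a"] by argo
  moreover have "(B \<subseteq> D) = (A \<subseteq> D) \<or> (B \<subseteq> D) = (C \<subseteq> D)"
    using b(2) mem(2,5) sw(2) iff[of b] iff[of "x b"] by argo
  moreover have "(C \<subseteq> D) = (A \<subseteq> D) \<or> (C \<subseteq> D) = (B \<subseteq> D)"
    using c(2) mem(3,6) sw(3) iff[of c] iff[of "x c"] by argo
  ultimately have "A \<subseteq> D \<and> B \<subseteq> D \<and> C \<subseteq> D" by argo
  then show "U \<subseteq> D" using U by blast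
qed (use assms in auto)

lemma funpow_eq_transpose:
  assumes "y u = v" "y v = u" "u \<noteq> v" "odd N" "\<And>z. z \<noteq> u \<Longrightarrow> z \<noteq> v \<Longrightarrow> (y ^^ N) z = z"
  shows "y ^^ N = transpose u v"
proof -
  have *: "(y ^^ (2 * i)) u = u" "(y ^^ (2 * i)) v = v" for i
    by (induction i) (use assms in auto)
  obtain i where "N = Suc (2 * i)" using assms(4) by (metis oddE Suc_eq_plus1)
  then have "(y ^^ N) u = v" "(y ^^ N) v = u" using * assms by auto
  then show ?thesis using assms(5) by (auto simp: transpose_def fun_eq_iff)
qed

lemma generates_sym_if_glues:
  assumes U: "finite U" "x permutes U" "y permutes U" and uv: "u \<in> U" "v \<in> U" "u \<noteq> v"
    and y: "y u = v" "y v = u" and N: "odd N" "\<And>z. z \<in> U \<Longrightarrow> z \<noteq> u \<Longrightarrow> z \<noteq> v \<Longrightarrow> (y ^^ N) z = z"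
    and tr: "trans_on_set U {x, y}"
    and gl: "\<And>R. inv_relation U {x, y} R \<Longrightarrow> (u, v) \<in> R \<Longrightarrow> R = U \<times> U"
  shows "generates_sym U {x, y}"
proof (rule generates_sym_if_transpose[OF U(1) _ uv(1,2)])
  have "(y ^^ N) z = z" if "z \<notin> U" for z
    by (induction N) (use that U permutes_not_in in auto)
  then have "y ^^ N = transpose u v" using funpow_eq_transpose[OF y uv(3) N(1)] N(2) by blast
  then show "transpose u v \<in> H" if "perm_closed H" "{x, y} \<subseteq> H" for H
    using perm_closed_funpow[OF that(1), of y N] that by simp
  show "glues U {x, y} u v"
    using U by (intro gluesI tr gl) auto
qed (use U in auto)

lemma (in inv_relation) full_if_swap_meets:
  assumes F: "F = {x, y}" and uv: "u ~~ v" and y: "y u = v" and x: "x u \<in> {u, v} \<or> x v \<in> {u, v}"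
  shows "R = U \<times> U"
proof (rule full_if_closed)
  show u: "u \<in> U" using uv rel_mem by blast
  show "\<exists>d. u ~~ d \<and> u ~~ g d" if "g \<in> F" for g
  proof (cases "g = x")
    case True
    have "u ~~ x u \<or> u ~~ x v" using x uv rel_refl[OF u] by auto
    then show ?thesis using True uv rel_refl[OF u] by blast
  next
    case False
    then have "g u = v" using that F y by simp
    then show ?thesis using uv rel_refl[OF u] by metis
  qed
qed

text \<open>If the class of \<open>u\<close> is just \<open>{u, v}\<close>, its image under \<open>x\<close> pairs a point of the
  \<open>y\<close>-orbit \<open>A\<close> with a point of the longer orbit \<open>B\<close>, which a power of \<open>y\<close> separates.\<close>

lemma (in inv_relation) full_if_swap_separated:
  assumes F: "F = {x, y}" and uv: "u ~~ v" and y: "y u = v" "y v = u"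
    and U: "U = {u, v} \<union> A \<union> B" and dis: "A \<inter> B = {}" "u \<notin> B" "v \<notin> B" "u \<notin> A" "v \<notin> A"
    and cyc: "cyc_on y A" "cyc_on y B"
    and card: "card A < card B" and x: "x v \<in> A" "x u \<notin> A"
  shows "R = U \<times> U"
proof (cases "x u \<in> {u, v}")
  case True
  then show ?thesis by (intro full_if_swap_meets[OF F uv y(1)]) auto
next
  case False
  have xy: "x \<in> F" "y \<in> F" "x permutes U" "y permutes U" using F per by auto
  have uU: "u \<in> U" "v \<in> U" using uv rel_mem by auto
  have xuB: "x u \<in> B"
    using permutes_in_image[OF xy(3), of u] uU U False x by auto
  have yc: "\<And>W b c. cyc_on y W \<Longrightarrow> b \<in> W \<Longrightarrow> u ~~ b \<Longrightarrow> c \<in> W \<Longrightarrow> u ~~ c"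
    using rel_cyc[OF xy(2) rel_refl[OF uU(1)]] y(1) uv by metis
  have full: ?thesis if "u ~~ d" "u ~~ x d" for d
  proof (rule full_if_closed[OF uU(1)])
    show "\<exists>d. u ~~ d \<and> u ~~ g d" if "g \<in> F" for g
      using that F y(1) uv \<open>u ~~ d\<close> \<open>u ~~ x d\<close> rel_refl[OF uU(1)] by (metis insertE singletonD)
  qed
  show ?thesis
  proof (cases "\<exists>b\<in>A \<union> B. u ~~ b")
    case True
    then show ?thesis using full[of v] full[of u] yc cyc x xuB uv rel_refl[OF uU(1)] by blast
  next
    case no: False
    define i where "i = card A"
    have "finite A" "finite B" using fin U by auto
    have 1: "(y ^^ i) (x v) = x v"
      using cyc_on_funpow_eq_iff[OF cyc(1) xy(4) fin \<open>finite A\<close> x(1)] unfolding i_def by simp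
    have "A \<noteq> {}" using x by blast
    then have "\<not> card B dvd i" using card \<open>finite A\<close> unfolding i_def
      by (meson card_gt_0_iff dvd_imp_le leD)
    then have 2: "(y ^^ i) (x u) \<noteq> x u"
      using cyc_on_funpow_eq_iff[OF cyc(2) xy(4) fin \<open>finite B\<close> xuB] by simp
    have "x u ~~ x v" using rel_app[OF xy(1) uU] uv by simp
    then have "(y ^^ i) (x u) ~~ x v" using rel_funpow[OF xy(2), of "x u" "x v" i] 1 by simp
    then have 3: "x u ~~ (y ^^ i) (x u)" using \<open>x u ~~ x v\<close> rel_sym rel_trans by blast
    then obtain c where c: "c \<in> U" "(y ^^ i) (x u) = x c"
      using rel_mem permutes_image[OF xy(3)] by blast
    \<comment> \<open>The block of \<open>x u\<close> pulls back to the block of u, which here is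
      \<open>{u, v}\<close>. So the power of \<open>y\<close> would carry \<open>x u\<close> to
      \<open>x v\<close>, a point it fixes, against injectivity.\<close>
    then have "u ~~ c" using 3 rel_app[OF xy(1) uU(1) c(1)] by simp
    then have "c = u \<or> c = v" using no c U by blast
    then have "(y ^^ i) (x u) = x v" using c 2 by auto
    then have "(y ^^ i) (x u) = (y ^^ i) (x v)" using 1 by simp
    moreover have "inj (y ^^ i)" using xy permutes_inj inj_fn by blast
    ultimately have "x u = x v" by (simp add: inj_eq)
    then show ?thesis using x by simp
  qed
qed

section \<open>One neighbour in the stabiliser, and the cells cut out by \<open>K\<close> and its
  image\<close>

definition good :: "'a set \<Rightarrow> 'a set \<Rightarrow> ('a \<Rightarrow> 'a) \<Rightarrow> bool"
  where "good K L x \<longleftrightarrow> (\<exists>m. m permutes (K \<union> L) \<and> m ` K = K \<and> generates_sym (K \<union> L) {x, m})"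

lemma permutes_image_compl:
  assumes "m permutes (K \<union> L)" "K \<inter> L = {}" "m ` K = K" shows "m ` L = L"
proof -
  have "L = (K \<union> L) - K" using assms by blast
  moreover have "m ` ((K \<union> L) - K) = m ` (K \<union> L) - m ` K"
    using permutes_inj[OF assms(1)] by (simp add: image_set_diff)
  ultimately show ?thesis using assms(3) permutes_image[OF assms(1)] by simp
qed

text \<open>A permutation of the union stabilises \<open>K\<close> exactly if it stabilises
  \<open>L\<close>, so the two parts may exchange roles.\<close>

lemma good_commute:
  assumes "K \<inter> L = {}" "good L K x" shows "good K L x"
  using assms permutes_image_compl[of _ L K] unfolding good_def by (metis Int_commute Un_commute)

lemma generates_sym_two_cong:
  assumes "y = x \<circ> m" "generates_sym U {x, y}" shows "generates_sym U {x, m}"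
  using assms perm_closedD(2) unfolding generates_sym_def by (metis insert_subset)

locale two_parts =
  fixes K L :: "'a set" and x :: "'a \<Rightarrow> 'a"
  assumes fin: "finite K" "finite L" and disj: "K \<inter> L = {}" and xper: "x permutes K \<union> L"
begin

abbreviation "U \<equiv> K \<union> L"

lemma two_parts_commute: "two_parts L K x"
  using fin disj xper by unfold_locales (auto simp: Un_commute)

lemma x_inj: "x a = x b \<longleftrightarrow> a = b" using permutes_inj[OF xper] by (simp add: inj_eq)
lemma x_mem: "x a \<in> U \<longleftrightarrow> a \<in> U" using permutes_in_image[OF xper] .
lemma x_mem_K: "x a \<in> x ` K \<longleftrightarrow> a \<in> K" using permutes_inj[OF xper] by (simp add: inj_image_mem_iff)
lemma image_K: "x ` K \<subseteq> U" using x_mem by blast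
lemma image_L: "x ` L = U - x ` K"
proof -
  have "x ` (U - K) = x ` U - x ` K" using permutes_inj[OF xper] by (simp add: image_set_diff)
  moreover have "U - K = L" using disj by blast
  ultimately show ?thesis using permutes_image[OF xper] by simp
qed

text \<open>An admissible \<open>y\<close> must send points of \<open>K\<close> into the image of
  \<open>K\<close> under \<open>x\<close>, which is the union of \<open>P\<close> and
  \<open>R\<close>, and points of \<open>L\<close> into the union of \<open>Q\<close> and
  \<open>S\<close>. Thus points of \<open>P\<close> and \<open>S\<close> may be fixed by
  \<open>y\<close>, while those of \<open>Q\<close> and \<open>R\<close> must be moved.
  \<open>Q\<close> and \<open>R\<close> have the same size, the number of points that
  \<open>x\<close> carries out of \<open>K\<close>.\<close>

definition P where "P = K \<inter> x ` K"
definition Q where "Q = K - x ` K"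
definition R where "R = x ` K - K"
definition S where "S = L - x ` K"

lemmas PQRS_def = P_def Q_def R_def S_def

lemma K_eq: "K = P \<union> Q" and L_eq: "L = R \<union> S"
  unfolding PQRS_def using image_K disj by blast+

lemma finPQRS: "finite P" "finite Q" "finite R" "finite S"
  using fin finite_subset[OF image_K] unfolding PQRS_def by auto

lemma disjPQRS: "P \<inter> Q = {}" "P \<inter> R = {}" "P \<inter> S = {}" "Q \<inter> R = {}" "Q \<inter> S = {}" "R \<inter> S = {}"
  unfolding PQRS_def using disj by blast+

lemma card_R: "card R = card Q"
proof -
  have "card (x ` K) = card K" using permutes_inj[OF xper] by (simp add: card_image inj_on_subset)
  moreover have "x ` K = P \<union> R" unfolding PQRS_def by blast
  moreover have "card K = card P + card Q" using arg_cong[OF K_eq, of card] disjPQRS finPQRS by (simp add: card_Un_disjoint)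
  ultimately show ?thesis
    using disjPQRS finPQRS by (simp add: card_Un_disjoint)
qed

lemma card_K: "card K = card P + card Q" and card_L: "card L = card Q + card S"
  using arg_cong[OF K_eq, of card] arg_cong[OF L_eq, of card] disjPQRS finPQRS card_R
  by (simp_all add: card_Un_disjoint)

lemma x_P: "a \<in> P \<Longrightarrow> x a \<in> P \<or> x a \<in> R" and x_Q: "a \<in> Q \<Longrightarrow> x a \<in> P \<or> x a \<in> R"
  using x_mem_K[of a] unfolding PQRS_def by blast+
lemma x_R: "a \<in> R \<Longrightarrow> x a \<in> Q \<or> x a \<in> S" and x_S: "a \<in> S \<Longrightarrow> x a \<in> Q \<or> x a \<in> S"
  using x_mem_K[of a] x_mem[of a] image_K disj unfolding PQRS_def by blast+

text \<open>Legal permutations \<open>y\<close> of \<open>U\<close> are those for which \<open>inv x \<circ> y\<close> stabilises \<open>K\<close>.\<close>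

definition legal where "legal y W \<longleftrightarrow> (\<forall>z\<in>W. y z \<in> x ` K \<longleftrightarrow> z \<in> K)"

definition lcyc where "lcyc W \<longleftrightarrow> (\<exists>y. y permutes W \<and> cyc_on y W \<and> legal y W)"

lemma lcyc_single:
  assumes "f \<in> P \<union> S" shows "lcyc {f}"
proof -
  have "legal id {f}" using assms disj unfolding legal_def PQRS_def by auto
  moreover have "cyc_on id {f}" by (rule cyc_on_singleton) simp
  moreover have "id permutes {f}" by (rule permutes_id)
  ultimately show ?thesis unfolding lcyc_def by blast
qed

lemma permutes_insert_cycle:
  assumes y: "y permutes W" "cyc_on y W" and e: "e \<in> W" and z: "z \<notin> W"
  shows "y \<circ> transpose e z permutes insert z W" "cyc_on (y \<circ> transpose e z) (insert z W)"
    "(y \<circ> transpose e z) e = z" "(y \<circ> transpose e z) z = y e"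
    "\<And>w. w \<in> W \<Longrightarrow> w \<noteq> e \<Longrightarrow> (y \<circ> transpose e z) w = y w"
proof -
  show "y \<circ> transpose e z permutes insert z W"
    using permutes_compose[OF permutes_swap_id[of e "insert z W" z] permutes_subset[OF y(1), of "insert z W"]] e
    by blast
  have "y z = z" using y z permutes_not_in by metis
  then show "cyc_on (y \<circ> transpose e z) (insert z W)" "(y \<circ> transpose e z) e = z"
    using cyc_on_insert[OF y(2) e z] by auto
  show "(y \<circ> transpose e z) z = y e" by simp
  show "(y \<circ> transpose e z) w = y w" if "w \<in> W" "w \<noteq> e" for w
    using that z by (auto simp: transpose_def)
qed

text \<open>Start from a swap of one point of \<open>Q\<close> with one of \<open>R\<close>. A point
  of \<open>P\<close> or \<open>S\<close> can be inserted after any point on its own side, and a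
  further pair from \<open>Q\<close> and \<open>R\<close> can be inserted together. The non-empty
  intersection with \<open>Q\<close>, hence with \<open>R\<close>, provides points on both sides to
  insert after.\<close>

lemma lcyc_ex:
  assumes "W \<subseteq> U" "card (W \<inter> Q) = card (W \<inter> R)" "W \<inter> Q \<noteq> {}"
  shows "lcyc W"
  using assms
proof (induction "card W" arbitrary: W rule: less_induct)
  case less
  have W: "finite W" using less fin finite_subset by blast
  have fQR: "finite (W \<inter> Q)" "finite (W \<inter> R)" using W by auto
  have R_ne: "W \<inter> R \<noteq> {}" using less fQR by (metis card_0_eq)
  show ?case
  proof (cases "W \<inter> (P \<union> S) = {}")
    case False
    then obtain z where z: "z \<in> W" "z \<in> P \<union> S" by blast
    define W' where "W' = W - {z}"
    have z': "z \<notin> Q" "z \<notin> R" using z disjPQRS by auto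
    have same: "W' \<inter> Q = W \<inter> Q" "W' \<inter> R = W \<inter> R" using z' unfolding W'_def by auto
    have "card W' < card W" using z W card_Diff1_less[of W z] unfolding W'_def by simp
    moreover have "W' \<subseteq> U" using less unfolding W'_def by blast
    ultimately have "lcyc W'" using less same by simp
    then obtain y where y: "y permutes W'" "cyc_on y W'" "legal y W'" unfolding lcyc_def by blast
    obtain e where e: "e \<in> W'" "e \<in> K \<longleftrightarrow> z \<in> K"
    proof (cases "z \<in> K")
      case True
      obtain e where "e \<in> W \<inter> Q" using less by blast
      then show ?thesis using that[of e] True same unfolding Q_def by blast
    next
      case False
      obtain e where "e \<in> W \<inter> R" using R_ne by blast
      then show ?thesis using that[of e] False same unfolding R_def by blast
    qed
    have zW: "z \<notin> W'" "insert z W' = W" using z unfolding W'_def by auto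
    note ins = permutes_insert_cycle[OF y(1,2) e(1) zW(1)]
    have "legal (y \<circ> transpose e z) W"
      unfolding legal_def
    proof
      fix w assume w: "w \<in> W"
      have zz: "z \<in> x ` K \<longleftrightarrow> z \<in> K" using z disj unfolding PQRS_def by auto
      show "(y \<circ> transpose e z) w \<in> x ` K \<longleftrightarrow> w \<in> K"
      proof (cases "w = z \<or> w = e")
        case True
        then show ?thesis using ins(3,4) e y(3) zz unfolding legal_def by auto
      next
        case False
        then show ?thesis using ins(5)[of w] w zW(2) y(3) unfolding legal_def by auto
      qed
    qed
    then show ?thesis using ins(1,2) zW(2) unfolding lcyc_def by metis
  next
    case True
    then have WQR: "W \<subseteq> Q \<union> R" using less(2) K_eq L_eq by blast
    obtain q r where q: "q \<in> W" "q \<in> Q" and r: "r \<in> W" "r \<in> R" using less R_ne by blast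
    have qr: "q \<in> K" "q \<notin> x ` K" "r \<notin> K" "r \<in> x ` K" "q \<noteq> r" using q r unfolding Q_def R_def by auto
    define W' where "W' = W - {q, r}"
    have W'Q: "W' \<inter> Q = (W \<inter> Q) - {q}" and W'R: "W' \<inter> R = (W \<inter> R) - {r}"
      using q r disjPQRS unfolding W'_def by blast+
    have ins_eq: "insert r (insert q W') = W" using q r unfolding W'_def by auto
    show ?thesis
    proof (cases "W' \<inter> Q = {}")
      case True
      then have "W \<inter> Q = {q}" using q W'Q by blast
      then have "card (W \<inter> R) = 1" using less by simp
      then have "W \<inter> R = {r}" using r by (metis IntI card_1_singletonE singletonD)
      then have "W = {q, r}" using \<open>W \<inter> Q = {q}\<close> WQR by blast
      moreover have "cyc_on (transpose q r) {q, r}" by (rule cyc_on_pair) auto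
      moreover have "transpose q r permutes {q, r}" by (simp add: permutes_swap_id)
      moreover have "legal (transpose q r) {q, r}" using qr unfolding legal_def by auto
      ultimately show ?thesis unfolding lcyc_def by blast
    next
      case False
      have "card (W' \<inter> Q) = card (W' \<inter> R)" unfolding W'Q W'R using less q r fQR by simp
      moreover have "card W' < card W" using W q unfolding W'_def
        by (metis Diff_subset card_mono card_subset_eq Diff_iff insertI1 linorder_le_less_linear nle_le)
      moreover have "W' \<subseteq> U" using less unfolding W'_def by blast
      ultimately have "lcyc W'" using less False by simp
      then obtain y where y: "y permutes W'" "cyc_on y W'" "legal y W'" unfolding lcyc_def by blast
      obtain e where e: "e \<in> W'" "e \<in> K" using False unfolding Q_def by blast
      have nq: "q \<notin> W'" and nr: "r \<notin> insert q W'" using qr unfolding W'_def by auto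
      note ins = permutes_insert_cycle[OF y(1,2) e(1) nq]
      note ins2 = permutes_insert_cycle[OF ins(1,2) insertI2[OF e(1)] nr]
      \<comment> \<open>The two insertions give the order e, r, q, \<open>y e\<close>: e in
        \<open>K\<close> goes to r in the image, r in \<open>L\<close> goes to q outside it, and q
        in \<open>K\<close> takes over the old image of e.\<close>
      have "legal (y \<circ> transpose e q \<circ> transpose e r) W"
        unfolding legal_def
      proof
        fix w assume w: "w \<in> W"
        have eq: "e \<noteq> q" "e \<noteq> r" using e nq nr by auto
        consider "w = e" | "w = r" | "w = q" | "w \<in> W'" "w \<noteq> e" using w ins_eq by blast
        then show "(y \<circ> transpose e q \<circ> transpose e r) w \<in> x ` K \<longleftrightarrow> w \<in> K"
        proof cases
          case 1 then show ?thesis using ins2(3) qr e by simp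
        next
          case 2 then show ?thesis using ins2(4) ins(3) qr e by simp
        next
          case 3 then show ?thesis using ins2(5)[of q] ins(4) qr e eq y(3) unfolding legal_def by auto
        next
          case 4 then show ?thesis using ins2(5)[of w] ins(5)[of w] y(3) unfolding legal_def by auto
        qed
      qed
      then show ?thesis using ins2(1,2) ins_eq unfolding lcyc_def by metis
    qed
  qed
qed

definition legal_pair where
  "legal_pair u v \<longleftrightarrow> u \<noteq> v \<and> u \<in> U \<and> v \<in> U \<and> (u \<in> x ` K \<longleftrightarrow> v \<in> K) \<and> (v \<in> x ` K \<longleftrightarrow> u \<in> K)"

lemma legal_pairI:
  "u \<in> P \<Longrightarrow> v \<in> P \<Longrightarrow> u \<noteq> v \<Longrightarrow> legal_pair u v"
  "u \<in> S \<Longrightarrow> v \<in> S \<Longrightarrow> u \<noteq> v \<Longrightarrow> legal_pair u v"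
  "u \<in> Q \<Longrightarrow> v \<in> R \<Longrightarrow> legal_pair u v"
  "u \<in> R \<Longrightarrow> v \<in> Q \<Longrightarrow> legal_pair u v"
  using disj image_K unfolding legal_pair_def PQRS_def by blast+

lemma good_if_legal:
  assumes y: "y permutes U" "legal y U" and gen: "generates_sym U {x, y}"
  shows "good K L x"
proof -
  define m where "m = inv' x \<circ> y"
  have "m permutes U" unfolding m_def using xper y permutes_compose permutes_inv by blast
  moreover have xm: "x (m z) = y z" for z unfolding m_def using permutes_inverses[OF xper] by simp
  then have mK: "m z \<in> K \<longleftrightarrow> z \<in> K" if "z \<in> U" for z using that y(2) x_mem_K unfolding legal_def by metis
  have "m ` K = K"
  proof (rule card_subset_eq)
    show "card (m ` K) = card K"
      using permutes_inj[OF \<open>m permutes U\<close>] by (simp add: card_image inj_on_subset)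
  qed (use mK fin in auto)
  moreover have "y = x \<circ> m" using xm by auto
  then have "generates_sym U {x, m}" using generates_sym_two_cong gen by blast
  ultimately show ?thesis unfolding good_def by blast
qed

lemma legal_perm_ex:
  assumes uv: "legal_pair u v" and AB: "lcyc A" "lcyc B"
    and U: "U = {u, v} \<union> A \<union> B" and dis: "A \<inter> B = {}" "u \<notin> B" "v \<notin> B" "u \<notin> A" "v \<notin> A"
  obtains y where "y permutes U" "legal y U" "y u = v" "y v = u" "cyc_on y A" "cyc_on y B"
proof -
  obtain f g where f: "f permutes A" "cyc_on f A" "legal f A" and g: "g permutes B" "cyc_on g B" "legal g B"
    using AB unfolding lcyc_def by blast
  have t: "transpose u v permutes {u, v}" by (simp add: permutes_swap_id)
  note fg = permutes_comp_disjoint[OF f(1) g(1) dis(1)]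
  have dis': "{u, v} \<inter> (A \<union> B) = {}" using dis by blast
  define y where "y = transpose u v \<circ> (f \<circ> g)"
  note y = permutes_comp_disjoint[OF t fg(1) dis', folded y_def]
  have yA: "y z = f z" if "z \<in> A" for z using that y(3) fg(2) by simp
  have yB: "y z = g z" if "z \<in> B" for z using that y(3) fg(3) by simp
  have yuv: "y u = v" "y v = u" using y(2) by auto
  show ?thesis
  proof
    show "y permutes U" using y(1) U by (simp add: Un_assoc)
    show "legal y U"
      using f(3) g(3) uv yA yB yuv unfolding legal_def legal_pair_def U by auto
    show "cyc_on y A" "cyc_on y B" using f g yA yB cyc_on_cong[of A y f] cyc_on_cong[of B y g] by auto
  qed (rule yuv)+
qed

lemma odd_power_id:
  assumes "y permutes U" "cyc_on y A" "cyc_on y B" "A \<subseteq> U" "B \<subseteq> U" "z \<in> A \<union> B"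
  shows "(y ^^ (card A * card B)) z = z"
proof -
  have "finite A" "finite B" "finite U" using assms fin finite_subset[of _ U] by auto
  then show ?thesis using assms cyc_on_funpow_eq_iff[of y A U z "card A * card B"]
      cyc_on_funpow_eq_iff[of y B U z "card A * card B"] by auto
qed

text \<open>The power \<open>card A * card B\<close> is odd and trivial on both cycles, so it leaves
  exactly \<open>(u v)\<close>. The points a, b, c give transitivity; the last hypothesis offers the
  two ways to exclude a proper block containing u and v: the pair meets its \<open>x\<close>-image,
  or its image is split between cycles of different length.\<close>

lemma good_three_orbits:
  assumes uv: "legal_pair u v" and AB: "lcyc A" "lcyc B"
    and U: "U = {u, v} \<union> A \<union> B" and dis: "A \<inter> B = {}" "u \<notin> B" "v \<notin> B" "u \<notin> A" "v \<notin> A"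
    and odd: "odd (card A)" "odd (card B)"
    and a: "a \<in> U" "(a \<in> {u, v}) \<noteq> (x a \<in> {u, v})"
    and b: "b \<in> U" "(b \<in> A) \<noteq> (x b \<in> A)"
    and c: "c \<in> U" "(c \<in> B) \<noteq> (x c \<in> B)"
    and x: "x u \<in> {u, v} \<or> x v \<in> {u, v} \<or> (card A < card B \<and> x v \<in> A \<and> x u \<notin> A)"
  shows "good K L x"
proof -
  obtain y where y: "y permutes U" "legal y U" "y u = v" "y v = u" "cyc_on y A" "cyc_on y B"
    using legal_perm_ex[OF uv AB U dis] by blast
  have fU: "finite U" using fin by blast
  have tr: "trans_on_set U {x, y}"
    by (rule trans_on_set_three[OF fU xper y(1) _ cyc_on_pair[OF y(3,4)] y(5,6) a b c]) (use U in blast)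
  have "generates_sym U {x, y}"
  proof (rule generates_sym_if_glues[OF fU xper y(1) _ _ _ y(3,4) _ _ tr])
    show "u \<in> U" "v \<in> U" "u \<noteq> v" using uv unfolding legal_pair_def by auto
    show "odd (card A * card B)" using odd by simp
    show "(y ^^ (card A * card B)) z = z" if "z \<in> U" "z \<noteq> u" "z \<noteq> v" for z
      using odd_power_id[OF y(1,5,6)] that U by auto
    fix R assume "inv_relation U {x, y} R" and uvR: "(u, v) \<in> R"
    then interpret inv_relation U "{x, y}" R by simp
    have "rel u v" using uvR unfolding rel_def .
    then show "R = U \<times> U"
      using x full_if_swap_meets[of x y u v] full_if_swap_separated[of x y u v A B] y U dis by blast
  qed
  then show ?thesis using good_if_legal y by blast
qed

end

section \<open>Even degree: a transposition among the powers of \<open>y\<close>\<close>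

context two_parts
begin

text \<open>Removing u, v, f keeps \<open>Q\<close> and \<open>R\<close> balanced: either neither is
  touched, or each loses one point, and then two points in \<open>Q\<close> are needed for something
  to remain.\<close>

lemma lcyc_rest:
  assumes f: "f \<in> P \<union> S" and kind: "(u \<in> P \<and> v \<in> P \<or> u \<in> S \<and> v \<in> S) \<and> Q \<noteq> {} \<or>
     (u \<in> Q \<and> v \<in> R \<or> u \<in> R \<and> v \<in> Q) \<and> 2 \<le> card Q"
  shows "lcyc (U - {u, v, f})"
proof (rule lcyc_ex)
  have sub: "Q \<subseteq> U" "R \<subseteq> U" using K_eq L_eq by auto
  have "card ((U - {u, v, f}) \<inter> Q) = card ((U - {u, v, f}) \<inter> R) \<and> (U - {u, v, f}) \<inter> Q \<noteq> {}"
    using kind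
  proof (elim disjE)
    assume "(u \<in> P \<and> v \<in> P \<or> u \<in> S \<and> v \<in> S) \<and> Q \<noteq> {}"
    then have "(U - {u, v, f}) \<inter> Q = Q" "(U - {u, v, f}) \<inter> R = R" "Q \<noteq> {}" using f sub disjPQRS by auto
    then show ?thesis using card_R by simp
  next
    have *: "card ((U - {u, v, f}) \<inter> Q) = card ((U - {u, v, f}) \<inter> R) \<and> (U - {u, v, f}) \<inter> Q \<noteq> {}"
      if qr: "q \<in> Q" "r \<in> R" "{u, v} = {q, r}" "2 \<le> card Q" for q r
    proof -
      have nin: "r \<notin> Q" "q \<notin> R" "f \<notin> Q" "f \<notin> R" using qr(1,2) f disjPQRS by auto
      have "(U - {u, v, f}) \<inter> Q = U \<inter> Q - {u, v} - {f}" "(U - {u, v, f}) \<inter> R = U \<inter> R - {u, v} - {f}"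
        by auto
      moreover have "U \<inter> Q = Q" "U \<inter> R = R" using sub by auto
      moreover have "Q - {q, r} - {f} = Q - {q}" "R - {q, r} - {f} = R - {r}" using nin by auto
      ultimately have e: "(U - {u, v, f}) \<inter> Q = Q - {q}" "(U - {u, v, f}) \<inter> R = R - {r}"
        unfolding qr(3) by (simp_all only:)
      have "card (Q - {q}) = card Q - 1" "card (R - {r}) = card Q - 1"
        using qr card_R finPQRS by simp_all
      moreover from this have "Q - {q} \<noteq> {}" using qr(4) by force
      ultimately show ?thesis using e by simp
    qed
    assume "(u \<in> Q \<and> v \<in> R \<or> u \<in> R \<and> v \<in> Q) \<and> 2 \<le> card Q"
    then show ?thesis using *[of u v] *[of v u] by (auto simp: insert_commute)
  qed
  then show "card ((U - {u, v, f}) \<inter> Q) = card ((U - {u, v, f}) \<inter> R)" "(U - {u, v, f}) \<inter> Q \<noteq> {}"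
    by auto
qed blast

text \<open>Here \<open>A\<close> is the fixed point f of \<open>y\<close>, and the remaining cycle
  has length n - 3, odd because n is even. The bound \<open>4 < card U\<close> makes it longer than
  1, as the separation of the pair requires.\<close>

lemma good_single:
  assumes ev: "even (card U)" and f: "f \<in> P \<union> S" "x f \<noteq> f" and ne: "u \<noteq> v" "f \<noteq> u" "f \<noteq> v"
    and kind: "(u \<in> P \<and> v \<in> P \<or> u \<in> S \<and> v \<in> S) \<and> Q \<noteq> {} \<or>
     (u \<in> Q \<and> v \<in> R \<or> u \<in> R \<and> v \<in> Q) \<and> 2 \<le> card Q"
    and a: "a \<in> {u, v}" "x a \<notin> {u, v}" and c: "c \<in> {u, v, f}" "x c \<notin> {u, v, f}"
    and x: "x u \<in> {u, v} \<or> x v \<in> {u, v} \<or> 4 < card U \<and> x v = f"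
  shows "good K L x"
proof -
  define B where "B = U - {u, v, f}"
  have lp: "legal_pair u v" using kind legal_pairI ne by blast
  then have uv: "u \<in> U" "v \<in> U" unfolding legal_pair_def by auto
  have fU: "f \<in> U" using f K_eq L_eq by auto
  have "card {u, v, f} = 3" using ne by auto
  moreover have "card U = card B + card {u, v, f}"
    unfolding B_def using uv fU fin card_Un_disjoint[of "U - {u, v, f}" "{u, v, f}"]
    by (metis Diff_disjoint Diff_partition Int_commute Un_commute finite_Diff finite_Un finite.emptyI finite.insertI insert_subset empty_subsetI)
  ultimately have card: "card U = card B + 3" by simp
  have cU: "c \<in> U" "a \<in> U" using c a uv fU by auto
  show ?thesis
  proof (rule good_three_orbits[OF lp lcyc_single[OF f(1)] lcyc_rest[OF f(1) kind], folded B_def])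
    show "U = {u, v} \<union> {f} \<union> B" unfolding B_def using uv fU by blast
    show "odd (card {f})" by simp
    show "odd (card B)" using card ev by simp
    show "a \<in> U" "(a \<in> {u, v}) \<noteq> (x a \<in> {u, v})" using a cU by auto
    show "f \<in> U" "(f \<in> {f}) \<noteq> (x f \<in> {f})" using f fU by auto
    show "c \<in> U" using cU by simp
    have "x c \<in> U" using cU x_mem by blast
    then show "(c \<in> B) \<noteq> (x c \<in> B)" using c cU unfolding B_def by auto
    show "x u \<in> {u, v} \<or> x v \<in> {u, v} \<or> (card {f} < card B \<and> x v \<in> {f} \<and> x u \<notin> {f})"
      using x card x_inj[of u v] ne by auto
  qed (use ne in \<open>auto simp: B_def\<close>)
qed

text \<open>The pair is \<open>{z, f}\<close>: since \<open>x\<close> fixes z it meets its own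
  image, which settles the blocks. The fixed point of \<open>y\<close> is g in \<open>S\<close>,
  which \<open>x f\<close> cannot reach, so the third cycle is joined as well.\<close>

lemma good_fixed_point:
  assumes "even (card U)" "Q \<noteq> {}" "z \<in> P" "x z = z" "f \<in> P" "x f \<noteq> f" "g \<in> S" "x g \<noteq> g"
  shows "good K L x"
proof (rule good_single[of g z f f f])
  have zf: "z \<noteq> f" using assms by auto
  have fg: "f \<noteq> g" "z \<noteq> g" using assms disjPQRS by auto
  show "z \<noteq> f" "g \<noteq> z" "g \<noteq> f" using zf fg by auto
  have "x f \<noteq> z" using x_inj[of f z] assms zf by auto
  then show "x f \<notin> {z, f}" using assms by auto
  have "x f \<noteq> g" using x_P[of f] assms disjPQRS by auto
  then show "x f \<notin> {z, f, g}" using assms \<open>x f \<noteq> z\<close> by auto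
qed (use assms in auto)

text \<open>As \<open>P\<close> is larger than \<open>R\<close>, some v in \<open>P\<close> has its
  image f in \<open>P\<close>. Taking f as fixed point of \<open>y\<close>, the pair needs a partner
  u for v in \<open>P\<close> avoiding v, f and \<open>x f\<close>; this is where four points in
  \<open>P\<close> are required.\<close>

lemma good_all_moved:
  assumes "even (card U)" "4 < card U" "Q \<noteq> {}" "3 < card P" "card Q < card P"
    and mv: "\<And>z. z \<in> P \<Longrightarrow> x z \<noteq> z"
  shows "good K L x"
proof -
  have "\<exists>v\<in>P. x v \<in> P"
  proof (rule ccontr)
    assume "\<not> ?thesis"
    then have "x ` P \<subseteq> R" using x_P by blast
    then have "card P \<le> card R"
      using card_inj_on_le[of x P R] finPQRS permutes_inj[OF xper] inj_on_subset by blast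
    then show False using assms card_R by simp
  qed
  then obtain v where v: "v \<in> P" "x v \<in> P" by blast
  define f where "f = x v"
  have "card {v, f, x f} \<le> 3" by (simp add: card_insert_if)
  then have "\<not> P \<subseteq> {v, f, x f}" using assms(4) card_mono[of "{v, f, x f}" P] by fastforce
  then obtain u where u: "u \<in> P" "u \<noteq> v" "u \<noteq> f" "u \<noteq> x f" by blast
  have f: "f \<in> P" "x f \<noteq> f" "x v = f" "f \<noteq> v" using v mv unfolding f_def by auto
  obtain c where c: "c \<in> {u, v, f}" "x c \<notin> {u, v, f}"
  proof (cases "x f = v")
    case True
    then show ?thesis using that[of u] mv[OF u(1)] x_inj[of u v] x_inj[of u f] u f by auto
  next
    case False
    then show ?thesis using that[of f] u f by auto
  qed
  show ?thesis
    by (rule good_single[of f u v v c]) (use assms f u v c in auto)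
qed

text \<open>The image f of v lies in \<open>P\<close> or \<open>S\<close> and may therefore be the
  fixed point of \<open>y\<close>. The partner of v comes from the opposite cell and avoids
  \<open>x f\<close>, so that \<open>x\<close> carries f into the long cycle.\<close>

lemma good_cross:
  assumes "even (card U)" "4 < card U" "2 \<le> card Q"
    and v: "v \<in> Q \<and> x v \<in> P \<or> v \<in> R \<and> x v \<in> S"
  shows "good K L x"
proof -
  define f where "f = x v"
  have "finite (Q - {x f})" "finite (R - {x f})" using finPQRS by auto
  moreover have "card (Q - {x f}) > 0" "card (R - {x f}) > 0"
    using assms(3) card_R finPQRS by (auto simp: card_Diff_singleton_if)
  ultimately have "Q - {x f} \<noteq> {}" "R - {x f} \<noteq> {}" by force+
  then obtain q r where qr: "q \<in> Q" "q \<noteq> x f" "r \<in> R" "r \<noteq> x f" by blast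
  from v show ?thesis
  proof
    assume v: "v \<in> Q \<and> x v \<in> P"
    then have "x f \<noteq> f" using x_inj[of f v] disjPQRS unfolding f_def by auto
    moreover have "x f \<noteq> v" using x_P[of f] v disjPQRS unfolding f_def by auto
    ultimately show ?thesis
      by (intro good_single[of f r v v f]) (use assms qr v disjPQRS in \<open>auto simp: f_def\<close>)
  next
    assume v: "v \<in> R \<and> x v \<in> S"
    then have "x f \<noteq> f" using x_inj[of f v] disjPQRS unfolding f_def by auto
    moreover have "x f \<noteq> v" using x_S[of f] v disjPQRS unfolding f_def by auto
    ultimately show ?thesis
      by (intro good_single[of f q v v f]) (use assms qr v disjPQRS in \<open>auto simp: f_def\<close>)
  qed
qed

text \<open>Now images of points of \<open>Q\<close> and \<open>R\<close> are never admissible as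
  fixed points of \<open>y\<close>. The short cycle has length 3 instead, one point each from
  \<open>Q\<close>, \<open>R\<close> and \<open>P\<close>, and contains \<open>x v\<close>; the long
  one has odd length n - 5, which exceeds 3 as n is even and above 8.\<close>

lemma good_three_crossing:
  assumes ev: "even (card U)" "8 < card U" and Q3: "3 \<le> card Q" and P: "p \<in> P"
    and xQ: "\<And>q. q \<in> Q \<Longrightarrow> x q \<in> R" and xR: "\<And>r. r \<in> R \<Longrightarrow> x r \<in> Q"
  shows "good K L x"
proof -
  have pick: "\<exists>r\<in>R. r \<noteq> a \<and> r \<noteq> b" for a b
  proof (rule ccontr)
    assume "\<not> ?thesis"
    then have "R \<subseteq> {a, b}" by blast
    then have "card R \<le> card {a, b}" by (intro card_mono) auto
    also have "\<dots> \<le> 2" by (simp add: card_insert_if)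
    finally show False using Q3 card_R by simp
  qed
  obtain u where u: "u \<in> Q" using Q3 by fastforce
  define r1 where "r1 = x u"
  have r1: "r1 \<in> R" using u xQ r1_def by simp
  obtain u' where u': "x u' = u" using permutes_surj[OF xper] by (metis surj_def)
  \<comment> \<open>The two exclusions keep \<open>x u\<close> away from v and \<open>x v\<close>
    away from u, so the pair is disjoint from its image.\<close>
  obtain v where v: "v \<in> R" "v \<noteq> r1" "v \<noteq> u'" using pick by blast
  define q2 where "q2 = x v"
  have q2: "q2 \<in> Q" "q2 \<noteq> u" using v xR u' x_inj[of v u'] unfolding q2_def by auto
  obtain r where r: "r \<in> R" "r \<noteq> v" "r \<noteq> r1" using pick by blast
  have ne: "u \<noteq> v" "u \<noteq> r1" "u \<noteq> r" "u \<noteq> p" "v \<noteq> q2" "v \<noteq> p" "r1 \<noteq> q2" "r1 \<noteq> p" "q2 \<noteq> r" "q2 \<noteq> p" "r \<noteq> p"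
    using u v q2 r r1 P disjPQRS by auto
  define A where "A = {q2, r, p}"
  define B where "B = U - {u, v} - A"
  have sub: "P \<subseteq> U" "Q \<subseteq> U" "R \<subseteq> U" using K_eq L_eq by auto
  have cA: "card A = 3" unfolding A_def using ne by simp
  have "card {u, v} = 2" using ne by simp
  moreover have sU: "{u, v} \<subseteq> U" "A \<subseteq> U - {u, v}" unfolding A_def using u v q2 r P sub ne by auto
  moreover have "card (U - {u, v}) = card U - card {u, v}" using sU fin by (intro card_Diff_subset) auto
  moreover have "card B = card (U - {u, v}) - card A" unfolding B_def
    using sU fin by (intro card_Diff_subset) (auto simp: A_def)
  ultimately have cB: "card B = card U - 5" using cA by simp
  have "A \<inter> Q = {q2}" "A \<inter> R = {r}" unfolding A_def using q2 r P disjPQRS by auto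
  then have lA: "lcyc A" using sU by (intro lcyc_ex) auto
  have BQ: "B \<inter> Q = Q - {u, q2}" and BR: "B \<inter> R = R - {v, r}"
    unfolding B_def A_def using u v q2 r P sub disjPQRS by auto
  have "card (Q - {u, q2}) = card Q - card {u, q2}" using u q2 finPQRS by (intro card_Diff_subset) auto
  then have "card (B \<inter> Q) = card Q - 2" unfolding BQ using q2 by simp
  moreover have "card (R - {v, r}) = card R - card {v, r}" using v r finPQRS by (intro card_Diff_subset) auto
  then have "card (B \<inter> R) = card Q - 2" unfolding BR using r card_R by simp
  ultimately have "lcyc B" using Q3 unfolding B_def by (intro lcyc_ex) fastforce+
  show ?thesis
  proof (rule good_three_orbits[OF legal_pairI(3)[OF u v(1)] lA \<open>lcyc B\<close>])
    show "U = {u, v} \<union> A \<union> B" unfolding B_def using sU by blast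
    show "odd (card A)" using cA by simp
    show "odd (card B)" using cB ev by simp
    show "u \<in> U" "v \<in> U" "u \<in> U" using u v sub by auto
    show "(u \<in> {u, v}) \<noteq> (x u \<in> {u, v})" using ne v unfolding r1_def by auto
    show "(v \<in> A) \<noteq> (x v \<in> A)" using ne r unfolding A_def q2_def by auto
    have "x u \<in> B" unfolding B_def A_def r1_def[symmetric] using r1 sub ne v r by auto
    then show "(u \<in> B) \<noteq> (x u \<in> B)" unfolding B_def by auto
    show "x u \<in> {u, v} \<or> x v \<in> {u, v} \<or> card A < card B \<and> x v \<in> A \<and> x u \<notin> A"
      using \<open>x u \<in> B\<close> cA cB ev unfolding B_def A_def q2_def by auto
  qed (use ne r v q2(2) in \<open>auto simp: A_def B_def\<close>)
qed

text \<open>The insertion of \<open>x w\<close> directly after \<open>e\<close> makes the block \<open>{x u, x v, x w}\<close> that would arise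
  from a block \<open>{u, v, w}\<close> meet its own \<open>y\<close>-image.\<close>

lemma good_two_crossing:
  assumes ev: "even (card U)" "6 < card U" and Q2: "card Q = 2"
    and xP: "\<And>p. p \<in> P \<Longrightarrow> x p \<in> P" and xS: "\<And>p. p \<in> S \<Longrightarrow> x p \<in> S"
    and xQ: "\<And>q. q \<in> Q \<Longrightarrow> x q \<in> R" and xR: "\<And>r. r \<in> R \<Longrightarrow> x r \<in> Q"
    and w: "w \<in> P \<union> S" "x w \<noteq> w"
  shows "good K L x"
proof -
  obtain u where u: "u \<in> Q" using Q2 by fastforce
  define r1 where "r1 = x u"
  have r1: "r1 \<in> R" using u xQ r1_def by simp
  have "R - {r1} \<noteq> {}"
  proof
    assume "R - {r1} = {}"
    then have "card R \<le> card {r1}" by (intro card_mono) auto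
    then show False using card_R Q2 by simp
  qed
  then obtain v where v: "v \<in> R" "v \<noteq> r1" by blast
  define q2 where "q2 = x v"
  have q2: "q2 \<in> Q" using v xR unfolding q2_def by auto
  define w' where "w' = x w"
  have w': "w' \<in> P \<union> S" "w' \<in> K \<longleftrightarrow> w \<in> K" "w' \<noteq> w" "w' \<in> x ` K \<longleftrightarrow> w' \<in> K"
    using w xP xS disj unfolding w'_def PQRS_def by auto
  have sub: "P \<subseteq> U" "Q \<subseteq> U" "R \<subseteq> U" "S \<subseteq> U" using K_eq L_eq by auto
  have ne: "u \<noteq> v" "u \<noteq> r1" "u \<noteq> w" "u \<noteq> w'" "v \<noteq> w" "v \<noteq> w'" "r1 \<noteq> w" "r1 \<noteq> w'" "q2 \<noteq> w" "q2 \<noteq> w'" "v \<noteq> q2" "q2 \<noteq> r1"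
    using u v q2 r1 w w' disjPQRS by auto
  show ?thesis
  \<comment> \<open>If \<open>x v\<close> is u, the pair meets its own image and the simpler
    construction with fixed point w applies.\<close>
  proof (cases "q2 = u")
    case True
    show ?thesis
    proof (rule good_single[of w u v u u])
      show "(u \<in> P \<and> v \<in> P \<or> u \<in> S \<and> v \<in> S) \<and> Q \<noteq> {} \<or> (u \<in> Q \<and> v \<in> R \<or> u \<in> R \<and> v \<in> Q) \<and> 2 \<le> card Q"
        using u v Q2 by simp
    qed (use ev w ne v True q2_def r1_def in auto)
  next
    case False
    define B where "B = U - {u, v, w}"
    define W where "W = B - {w'}"
    have eq: "insert w' W = B" "w' \<notin> W" using w' sub ne unfolding W_def B_def by auto
    have r1W: "r1 \<in> W" "q2 \<in> W" unfolding W_def B_def using r1 q2 ne sub False v(2) by auto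
    have "Q = {u, q2}"
      using u q2 False Q2 finPQRS by (intro card_seteq[symmetric]) auto
    moreover have "R = {r1, v}"
      using r1 v Q2 card_R finPQRS by (intro card_seteq[symmetric]) auto
    ultimately have "W \<inter> Q = {q2}" "W \<inter> R = {r1}"
      unfolding W_def B_def using ne sub u v(2) False w w' disjPQRS by auto
    then have "lcyc W" unfolding W_def B_def by (intro lcyc_ex) auto
    then obtain g where g: "g permutes W" "cyc_on g W" "legal g W" unfolding lcyc_def by blast
    \<comment> \<open>e is chosen on the same side as \<open>w'\<close>, so the insertion is
      admissible, and it is one of the two image points \<open>x u\<close>,
      \<open>x v\<close>.\<close>
    define e where "e = (if w' \<in> K then q2 else r1)"
    have e: "e \<in> W" "e \<in> K \<longleftrightarrow> w' \<in> K" "e = q2 \<or> e = r1"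
      using r1W q2 r1 unfolding e_def Q_def R_def by auto
    note h = permutes_insert_cycle[OF g(1,2) e(1) eq(2), unfolded eq(1)]
    define h' where "h' = g \<circ> transpose e w'"
    have "legal h' B"
      unfolding legal_def
    proof
      fix z assume z: "z \<in> B"
      show "h' z \<in> x ` K \<longleftrightarrow> z \<in> K"
      proof (cases "z = w' \<or> z = e")
        case True
        then show ?thesis using h(3,4) e g(3) w' unfolding legal_def h'_def by auto
      next
        case False
        then show ?thesis using h(5)[of z] z eq g(3) unfolding legal_def h'_def by auto
      qed
    qed
    define y where "y = transpose u v \<circ> h'"
    have uvB: "{u, v} \<inter> B = {}" unfolding B_def by blast
    have tp: "transpose u v permutes {u, v}" by (simp add: permutes_swap_id)
    note y = permutes_comp_disjoint[OF tp h(1)[folded h'_def] uvB, folded y_def]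
    have "{u, v} \<union> B \<subseteq> U" unfolding B_def using u v sub by auto
    then have yU: "y permutes U" using y(1) permutes_subset by blast
    have yuv: "y u = v" "y v = u" using y(2) by auto
    have "w \<notin> {u, v} \<union> B" unfolding B_def using ne by auto
    then have yw: "y w = w" using y(1) permutes_not_in by metis
    have cB: "cyc_on y B" using h(2)[folded h'_def] cyc_on_cong[of B y h'] y(3) by blast
    have ye: "y e = w'" using y(3)[of e] h(3)[folded h'_def] eq e by auto
    have wU: "w \<in> U" using w sub by auto
    have Ueq: "U = {u, v} \<union> {w} \<union> B" unfolding B_def using u v wU sub by auto
    have ww: "w \<in> x ` K \<longleftrightarrow> w \<in> K" using w disj unfolding PQRS_def by auto
    have lp: "legal_pair u v" using legal_pairI u v by blast
    have "legal y U"
      unfolding legal_def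
    proof
      fix z assume "z \<in> U"
      then consider "z = u" | "z = v" | "z = w" | "z \<in> B" using Ueq by blast
      then show "y z \<in> x ` K \<longleftrightarrow> z \<in> K"
        using lp yuv yw ww \<open>legal h' B\<close> y(3) unfolding legal_def legal_pair_def by cases auto
    qed
    have fU: "finite U" using fin by blast
    have r1B: "r1 \<in> B" "q2 \<in> B" "w' \<in> B" using r1W eq by auto
    have uU: "u \<in> U" "v \<in> U" using u v sub by auto
    have tr: "trans_on_set U {x, y}"
    proof (rule trans_on_set_three[OF fU xper yU _ cyc_on_pair[OF yuv] cyc_on_singleton[where f = y and z = w, OF yw] cB])
      show "U \<subseteq> {u, v} \<union> {w} \<union> B" using Ueq by blast
      show "u \<in> U" "w \<in> U" "u \<in> U" using uU wU by auto
      show "(u \<in> {u, v}) \<noteq> (x u \<in> {u, v})" using ne v r1_def by auto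
      show "(w \<in> {w}) \<noteq> (x w \<in> {w})" using w by auto
      show "(u \<in> B) \<noteq> (x u \<in> B)" using uvB r1B r1_def by auto
    qed
    have "generates_sym U {x, y}"
    proof (rule generates_sym_if_glues[OF fU xper yU uU ne(1) yuv _ _ tr])
      have "card B = card U - card {u, v, w}" unfolding B_def
        using uU wU fU by (intro card_Diff_subset) auto
      then have cardB: "card B = card U - 3" using ne by simp
      then show "odd (card B)" using ev by simp
      show "(y ^^ card B) z = z" if "z \<in> U" "z \<noteq> u" "z \<noteq> v" for z
      proof (cases "z = w")
        case True
        have "(y ^^ i) w = w" for i by (induction i) (use yw in auto)
        then show ?thesis using True by blast
      next
        case False
        then have "z \<in> B" using that unfolding B_def by blast
        moreover have "finite B" using fU unfolding B_def by blast
        ultimately show ?thesis using cyc_on_funpow_eq_iff[OF cB yU fU] by simp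
      qed
      fix T assume "inv_relation U {x, y} T" and uvR: "(u, v) \<in> T"
      then interpret inv_relation U "{x, y}" T by simp
      have uv: "rel u v" using uvR unfolding rel_def .
      have pre: "\<exists>c. rel u c \<and> x c = b" if r1b: "rel r1 b" for b
      proof -
        have "b \<in> x ` U" using rel_mem[OF r1b] permutes_image[OF xper] by simp
        then obtain c where c: "c \<in> U" "x c = b" by auto
        then have "rel u c" using rel_app[of x u c] uU r1b r1_def by auto
        then show ?thesis using c by blast
      qed
      have rq: "rel r1 q2" using rel_app[of x u v] uv uU unfolding r1_def q2_def by auto
      have closed: "rel a c" if "rel a (y a)" "rel a b" "b \<in> B" "c \<in> B" for a b c
      proof -
        have "rel a a" using that(1) rel_mem rel_refl by blast
        then show ?thesis using rel_cyc[of y a a B b c] that cB by blast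
      qed
      show "T = U \<times> U"
      proof (cases "\<exists>b\<in>B. rel u b")
        case True
        then have "rel u r1" using closed[of u] uv yuv r1B by auto
        show ?thesis
        proof (rule full_if_closed[OF uU(1)])
          show "\<exists>d. rel u d \<and> rel u (g d)" if "g \<in> {x, y}" for g
            using that \<open>rel u r1\<close> uv yuv r1_def rel_refl[OF uU(1)] by auto
        qed
      next
        case no: False
        have "False"
        proof (cases "rel u w")
          \<comment> \<open>The block \<open>{r1, q2, w'}\<close> contains both e and its
            \<open>y\<close>-image, so it absorbs the cycle \<open>B\<close>. Its preimage has at
            most the three points u, v, w, but \<open>B\<close> has n - 3 points, and n exceeds
            6.\<close>
          case True
          then have "rel r1 w'" using rel_app[of x u w] uU wU unfolding r1_def w'_def by auto
          then have "rel e (y e)" using e(3) ye rq rel_sym rel_trans by metis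
          moreover have "rel e r1" using e(3) rq rel_refl rel_sym rel_mem by metis
          ultimately have "rel r1 b" if "b \<in> B" for b
            using closed[of e r1 b] r1B that rel_sym rel_trans by blast
          then have "B \<subseteq> x ` {c. rel u c}" using pre by blast
          moreover have "{c. rel u c} \<subseteq> {u, v, w}" using no rel_mem Ueq by blast
          ultimately have "B \<subseteq> x ` {u, v, w}" by blast
          then have "card B \<le> card (x ` {u, v, w})" by (intro card_mono) auto
          also have "\<dots> \<le> card {u, v, w}" by (rule card_image_le) simp
          finally have "card U - 3 \<le> 3" unfolding cardB using ne by simp
          then show False using ev by simp
        next
          \<comment> \<open>The block is exactly \<open>{u, v}\<close>. As \<open>y\<close> fixes w,
            a larger block of w would contain all of \<open>B\<close> and thus \<open>r1\<close>,
            putting w into the image of \<open>{u, v}\<close>. So w is alone in its block, and then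
            every block is trivial.\<close>
          case nw: False
          have D: "c = u \<or> c = v" if "rel u c" for c using that no nw rel_mem Ueq by blast
          have "b = w" if wb: "rel w b" for b
          proof (rule ccontr)
            assume "b \<noteq> w"
            moreover have "b \<noteq> u" "b \<noteq> v" using wb nw uv rel_sym rel_trans by blast+
            ultimately have "b \<in> B" using rel_mem[OF wb] Ueq by blast
            then have "rel w r1" using closed[of w b r1] wb yw r1B rel_refl[OF wU] by simp
            then obtain c where "rel u c" "x c = w" using pre rel_sym by blast
            then show False using D[of c] ne unfolding r1_def q2_def by auto
          qed
          then have "u = v" using cls_trivial_if[OF wU] uv by blast
          then show False using ne by simp
        qed
        then show ?thesis by simp
      qed
    qed
    then show ?thesis using good_if_legal yU \<open>legal y U\<close> by blast
  qed
qed

end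

section \<open>Generators built from commutators\<close>

text \<open>Conjugating a by \<open>x\<close> only renames u to \<open>x u\<close> in its cycles,
  since \<open>x\<close> fixes the rest of \<open>A\<close>. Against the inverse of a everything
  cancels except around u.\<close>

lemma commutator_cyc3:
  assumes x: "x permutes U" and a: "a permutes A" and u: "u \<in> A" "a u \<noteq> u" "x u \<notin> A"
    and fx: "\<And>z. z \<in> A \<Longrightarrow> z \<noteq> u \<Longrightarrow> x z = z"
  shows "x \<circ> a \<circ> inv' x \<circ> inv' a = cyc3 u (x u) (a u)"
proof -
  have ia: "inv' a z = w \<longleftrightarrow> z = a w" for z w using permutes_inv_eq[OF a] by metis
  have ix: "inv' x z = w \<longleftrightarrow> z = x w" for z w using permutes_inv_eq[OF x] by metis
  have xi: "x z = x w \<longleftrightarrow> z = w" for z w using permutes_inj[OF x] by (simp add: inj_eq)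
  have ai: "a z = a w \<longleftrightarrow> z = w" for z w using permutes_inj[OF a] by (simp add: inj_eq)
  have aA: "a z \<in> A \<longleftrightarrow> z \<in> A" for z using permutes_in_image[OF a] .
  have aN: "z \<notin> A \<Longrightarrow> a z = z" for z using permutes_not_in[OF a] .
  have au: "a u \<in> A" "x (a u) = a u" using aA fx u by auto
  \<comment> \<open>Every point has the form \<open>a (x v)\<close>, and there both inverses cancel:
    the commutator takes the value \<open>x (a v)\<close>.\<close>
  have "(x \<circ> a \<circ> inv' x \<circ> inv' a) (a (x v)) = cyc3 u (x u) (a u) (a (x v))" for v
  proof -
    have L: "(x \<circ> a \<circ> inv' x \<circ> inv' a) (a (x v)) = x (a v)"
      using ia ix by (metis comp_apply)
    consider "v = u" | "v \<noteq> u" "x v = u" | "v \<noteq> u" "v \<in> A" | "v \<noteq> u" "v \<notin> A" "x v \<noteq> u" by blast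
    then show ?thesis
    proof cases
      case 1
      then show ?thesis using L au u aN[of "x u"] by (auto simp: cyc3_def)
    next
      case 2
      then have "v \<notin> A" using fx u by metis
      then show ?thesis using L 2 aN[of v] u by (auto simp: cyc3_def)
    next
      case 3
      then have xv: "x v = v" using fx by blast
      show ?thesis
      proof (cases "a v = u")
        case True
        have "u \<noteq> x u" using u by metis
        then show ?thesis using L xv True u(2) by (auto simp: cyc3_def)
      next
        case False
        then have "x (a v) = a v" using fx aA 3 by blast
        moreover have "a v \<noteq> x u" using u aA 3 by metis
        moreover have "a v \<noteq> a u" using 3 ai by blast
        ultimately show ?thesis using L xv False by (auto simp: cyc3_def)
      qed
    next
      case 4
      have "x v \<notin> A"
      proof
        assume "x v \<in> A"
        then have "x (x v) = x v" using 4 fx by blast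
        then have "x v = v" using xi by blast
        then show False using 4 \<open>x v \<in> A\<close> by simp
      qed
      then have "a (x v) = x v" "a v = v" "x v \<noteq> a u" "x v \<noteq> x u" using aN 4 aA u xi by metis+
      then show ?thesis using L 4 by (auto simp: cyc3_def)
    qed
  qed
  moreover have "\<exists>v. z = a (x v)" for z
    using permutes_surj[OF a] permutes_surj[OF x] by (metis surj_def)
  ultimately show ?thesis by (metis ext)
qed

text \<open>The classical fact that two permutations whose supports meet in a single point c have a
  3-cycle as commutator.\<close>

lemma commutator_cyc3_meet:
  assumes x: "x permutes U" and y: "y permutes U" and c: "x c \<noteq> c" "y c \<noteq> c"
    and fx: "\<And>z. z \<noteq> c \<Longrightarrow> x z = z \<or> y z = z"
  shows "x \<circ> y \<circ> inv' x \<circ> inv' y = cyc3 c (x c) (y c)"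
proof -
  have iy: "inv' y z = w \<longleftrightarrow> z = y w" for z w using permutes_inv_eq[OF y] by metis
  have ix: "inv' x z = w \<longleftrightarrow> z = x w" for z w using permutes_inv_eq[OF x] by metis
  have xi: "x z = x w \<longleftrightarrow> z = w" for z w using permutes_inj[OF x] by (simp add: inj_eq)
  have yi: "y z = y w \<longleftrightarrow> z = w" for z w using permutes_inj[OF y] by (simp add: inj_eq)
  have d: "y (x c) = x c" and e: "x (y c) = y c" using fx c xi yi by metis+
  have de: "x c \<noteq> y c" using d c yi by metis
  have "(x \<circ> y \<circ> inv' x \<circ> inv' y) (y (x v)) = cyc3 c (x c) (y c) (y (x v))" for v
  proof -
    have L: "(x \<circ> y \<circ> inv' x \<circ> inv' y) (y (x v)) = x (y v)"
      using iy ix by (metis comp_apply)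
    consider "v = c" | "v \<noteq> c" "x v = c" | "v \<noteq> c" "x v \<noteq> c" "x v = v" | "v \<noteq> c" "x v \<noteq> c" "x v \<noteq> v" by blast
    then show ?thesis
    proof cases
      case 1 then show ?thesis using L d e c de by (auto simp: cyc3_def)
    next
      case 2
      then have "y v = v" using fx by metis
      then show ?thesis using L 2 c by (auto simp: cyc3_def)
    next
      case 3
      show ?thesis
      proof (cases "y v = c")
        case True then show ?thesis using L 3 c by (auto simp: cyc3_def)
      next
        case False
        have "y v \<noteq> y c" "y v \<noteq> x c" using 3 yi xi d c by metis+
        moreover have "x (y v) = y v"
          using fx[OF False] 3 yi by metis
        ultimately show ?thesis using L 3 False by (auto simp: cyc3_def)
      qed
    next
      case 4
      then have yv: "y v = v" using fx by blast
      have "y (x v) = x v" using fx[OF 4(2)] 4 xi by metis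
      moreover have "x v \<noteq> x c" "x v \<noteq> y c" using 4 xi e by metis+
      ultimately show ?thesis using L 4 yv by (auto simp: cyc3_def)
    qed
  qed
  moreover have "\<exists>v. z = y (x v)" for z
    using permutes_surj[OF x] permutes_surj[OF y] by (metis surj_def)
  ultimately show ?thesis by (metis ext)
qed

lemma funpow_permutes: "f permutes U \<Longrightarrow> (f ^^ i) permutes U"
proof (induction i)
  case 0 then show ?case using permutes_id[of U] by (simp add: id_def)
next
  case (Suc i) then show ?case using permutes_compose[of "f ^^ i" U f] by (metis funpow.simps(2))
qed

lemma funpow_eq_id: "(\<And>z. z \<in> A \<Longrightarrow> f z = z) \<Longrightarrow> z \<in> A \<Longrightarrow> (f ^^ i) z = z"
  by (induction i) auto

section \<open>Even degree: elements of the stabiliser chosen directly\<close>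

context two_parts
begin

lemma fU: "finite U" using fin by blast

lemma goodI:
  assumes "m permutes U" "m ` K = K" "generates_sym U {x, m}" shows "good K L x"
  using assms unfolding good_def by blast

lemma generates_sym_if_cyc3:
  assumes m: "m permutes U" "\<not> evenperm m" and uvw: "u \<in> U" "v \<in> U" "w \<in> U" "distinct [u, v, w]"
    and H: "\<And>H. perm_closed H \<Longrightarrow> {x, m} \<subseteq> H \<Longrightarrow> cyc3 u v w \<in> H"
    and tr: "trans_on_set U {x, m}"
    and full: "\<And>T. inv_relation U {x, m} T \<Longrightarrow> (u, v) \<in> T \<Longrightarrow> T = U \<times> U"
  shows "generates_sym U {x, m}"
proof (rule generates_sym_if_alt_odd[OF fU _ _ m])
  show "generates_alt U {x, m}"
  proof (rule generates_alt_if_cyc3[OF fU _ uvw H])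
    fix T assume "inv_equiv U {x, m} T" "(u, v) \<in> T" "(u, w) \<in> T"
    then show "T = U \<times> U"
      using full[of T] fU xper m tr unfolding inv_relation_def by blast
  qed (use xper m in auto)
qed simp

text \<open>Let \<open>m\<close> be a cycle on \<open>K\<close>, a cycle on \<open>L\<close> without
  w, and fix w; it is odd because n is even. Its power \<open>card L - 1\<close> is trivial outside
  \<open>K\<close> and, by the divisibility hypothesis, moves u, so its commutator with
  \<open>x\<close> is a 3-cycle through u and \<open>x u\<close>.\<close>

lemma good_one_moved:
  assumes ev: "even (card U)" and u: "u \<in> K" "x u \<notin> K" and fx: "\<And>z. z \<in> K \<Longrightarrow> z \<noteq> u \<Longrightarrow> x z = z"
    and w: "w \<in> L" "w \<noteq> x u" "x w \<noteq> w" and nd: "\<not> card K dvd card L - 1"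
  shows "good K L x"
proof -
  define r where "r = x u"
  define B where "B = L - {w}"
  have "r \<in> L" using u x_mem[of u] unfolding r_def by blast
  then have rB: "r \<in> B" using w unfolding B_def r_def by simp
  have finB: "finite B" using fin unfolding B_def by simp
  obtain f where f: "f permutes K" "cyc_on f K" "evenperm f \<longleftrightarrow> odd (card K)"
    using ex_cyc_on[OF fin(1)] u by blast
  obtain g where g: "g permutes B" "cyc_on g B" "evenperm g \<longleftrightarrow> odd (card B)"
    using ex_cyc_on[OF finB] rB by blast
  have KB: "K \<inter> B = {}" using disj unfolding B_def by blast
  define m where "m = f \<circ> g"
  note m = permutes_comp_disjoint[OF f(1) g(1) KB, folded m_def]
  have cK: "cyc_on m K" and cB: "cyc_on m B"
    using cyc_on_comp_disjoint[OF f(1) g(1) KB, folded m_def] f g by auto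
  have mU: "m permutes U" using permutes_subset[OF m(1)] unfolding B_def by blast
  have mw: "m w = w" using permutes_not_in[OF m(1)] w disj unfolding B_def by blast
  have mK: "m ` K = K" using m(2) permutes_image[OF f(1)] by (metis image_cong)
  have Ueq: "U = K \<union> {w} \<union> B" using w unfolding B_def by blast
  have cardB: "card B = card L - 1" using w fin unfolding B_def by simp
  have cL: "card L > 0" using w fin by (auto simp: card_gt_0_iff)
  have "card U = card K + card L" using fin disj by (simp add: card_Un_disjoint)
  then have modd: "\<not> evenperm m"
    unfolding m_def evenperm_comp_permutes[OF f(1) g(1) fin(1) finB] f(3) g(3) cardB using ev cL by auto
  define a where "a = m ^^ (card L - 1)"
  have aU: "a permutes U" unfolding a_def using mU by (rule funpow_permutes)
  have afix: "a z = z" if zK: "z \<notin> K" for z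
  proof -
    consider "z \<in> B" | "z \<notin> K \<union> B" using zK by blast
    then show ?thesis
    proof cases
      case 1
      then show ?thesis
        unfolding a_def using cyc_on_funpow_eq_iff[OF cB mU fU finB] cardB by simp
    next
      case 2
      then have "m z = z" using permutes_not_in[OF m(1)] by blast
      then show ?thesis unfolding a_def using funpow_eq_id[of "{z}" m] by simp
    qed
  qed
  have aK: "a permutes K" using permutes_superset[OF aU] afix by blast
  have au: "a u \<noteq> u"
    unfolding a_def using cyc_on_funpow_eq_iff[OF cK mU fU fin(1) u(1)] nd by simp
  have comm: "x \<circ> a \<circ> inv' x \<circ> inv' a = cyc3 u (x u) (a u)"
    by (rule commutator_cyc3[OF xper aK u(1) au u(2) fx])
  have auK: "a u \<in> K" using permutes_in_image[OF aK] u by blast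
  have tr: "trans_on_set U {x, m}"
  proof (rule trans_on_set_three[OF fU xper mU _ cK cyc_on_singleton[where f = m and z = w, OF mw] cB])
    show "U \<subseteq> K \<union> {w} \<union> B" using Ueq by blast
    show "u \<in> U" "w \<in> U" "u \<in> U" using u w by auto
    show "(u \<in> K) \<noteq> (x u \<in> K)" using u by simp
    show "(w \<in> {w}) \<noteq> (x w \<in> {w})" using w by simp
    show "(u \<in> B) \<noteq> (x u \<in> B)" using rB u KB unfolding r_def by blast
  qed
  have "generates_sym U {x, m}"
  proof (rule generates_sym_if_cyc3[OF mU modd _ _ _ _ _ tr])
    show "u \<in> U" "x u \<in> U" "a u \<in> U" using u auK x_mem by auto
    show "distinct [u, x u, a u]" using u auK au by auto
    show "cyc3 u (x u) (a u) \<in> H" if H: "perm_closed H" "{x, m} \<subseteq> H" for H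
    proof -
      have "a \<in> H" unfolding a_def using perm_closed_funpow[OF H(1)] H(2) by blast
      then show ?thesis using comm[symmetric] perm_closedD(2,3)[OF H(1)] H(2) by simp
    qed
    fix T assume "inv_relation U {x, m} T" and uT: "(u, x u) \<in> T"
    then interpret inv_relation U "{x, m}" T by simp
    have ur: "rel u r" using uT unfolding rel_def r_def .
    have wU: "w \<in> U" using w by simp
    have ww: "rel w w" using rel_refl wU by blast
    \<comment> \<open>\<open>m\<close> fixes w, so a non-trivial block of w absorbs one of the two
      long cycles and with it u or r. These two share a block, and \<open>x\<close> maps u to r, so
      the block of w is invariant under both generators.\<close>
    have "\<exists>b. rel w b \<and> b \<noteq> w"
    proof (rule ccontr)
      assume "\<not> ?thesis"
      then have "u = r" using cls_trivial_if[OF wU _ ur] by blast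
      then show False using u rB KB r_def by auto
    qed
    then obtain b where b: "rel w b" "b \<noteq> w" by blast
    then have "b \<in> K \<or> b \<in> B" using rel_mem[OF b(1)] Ueq by blast
    moreover have "rel w u" if "b \<in> K"
      using rel_cyc[of m w w K b u] ww mw cK that b u by simp
    moreover have "rel w r" if "b \<in> B"
      using rel_cyc[of m w w B b r] ww mw cB that b rB by simp
    ultimately have "rel w u" "rel w r" using ur rel_sym rel_trans by blast+
    show "T = U \<times> U"
    proof (rule full_if_closed[OF wU])
      show "\<exists>d. rel w d \<and> rel w (g d)" if "g \<in> {x, m}" for g
        using that \<open>rel w u\<close> \<open>rel w r\<close> ww mw r_def by auto
    qed
  qed
  then show ?thesis using goodI mU mK by blast
qed

text \<open>\<open>m\<close> swaps the two points of \<open>L\<close>, fixes f and has one cycle on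
  the other points of \<open>K\<close>, of odd length as \<open>card K\<close> is even. Its power
  \<open>card K - 1\<close> is therefore the swap of \<open>L\<close>.\<close>

lemma good_card_two:
  assumes L2: "card L = 2" and K: "even (card K)" "2 < card K" and f: "f \<in> K" "x f \<noteq> f"
    and t: "card Q = 1 \<and> f \<in> P \<or> card Q = 2 \<and> f \<in> Q"
  shows "good K L x"
proof -
  obtain r s where L: "L = {r, s}" "r \<noteq> s" using L2 by (metis card_2_iff)
  define A where "A = K - {f}"
  have finA: "finite A" "card A = card K - 1" using fin f unfolding A_def by auto
  then have "A \<noteq> {}" using K by auto
  then obtain g where g: "g permutes A" "cyc_on g A" using ex_cyc_on finA by metis
  have t2: "transpose r s permutes L" using L by (simp add: permutes_swap_id)
  have AL: "L \<inter> A = {}" using disj unfolding A_def by blast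
  define m where "m = transpose r s \<circ> g"
  note m = permutes_comp_disjoint[OF t2 g(1) AL, folded m_def]
  have mA: "cyc_on m A" using cyc_on_comp_disjoint(2)[OF t2 g(1) AL] g unfolding m_def by blast
  have mrs: "m r = s" "m s = r" using m(2) L by auto
  have mU: "m permutes U" using permutes_subset[OF m(1)] unfolding A_def by blast
  have mf: "m f = f" using permutes_not_in[OF m(1)] f disj unfolding A_def by blast
  have Ueq: "U = {r, s} \<union> {f} \<union> A" using L f unfolding A_def by blast
  have "m ` A = A" using m(3) permutes_image[OF g(1)] by (metis image_cong)
  moreover have "K = insert f A" using f unfolding A_def by blast
  ultimately have mK: "m ` K = K" using mf by simp
  have preQ: "\<exists>c\<in>L. x c = q" if "q \<in> Q" for q
    using that image_L K_eq unfolding Q_def by (metis DiffE DiffI UnI1 imageE)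
  obtain q where q: "q \<in> Q" "q \<noteq> f"
  proof (cases "f \<in> Q")
    case True
    then have "card Q = 2" using t disjPQRS by auto
    then show ?thesis using that True by (metis card_2_iff insertCI)
  next
    case False
    have "Q \<noteq> {}" using t by auto
    then show ?thesis using that False by blast
  qed
  obtain c where c: "c \<in> L" "x c = q" using preQ q by blast
  have qK: "q \<in> K" using q K_eq by blast
  have cU: "c \<in> U" "f \<in> U" using c f by auto
  have tr: "trans_on_set U {x, m}"
  proof (rule trans_on_set_three[OF fU xper mU _ cyc_on_pair[OF mrs] cyc_on_singleton[where f = m and z = f, OF mf] mA])
    show "U \<subseteq> {r, s} \<union> {f} \<union> A" using Ueq by blast
    show "c \<in> U" "f \<in> U" "c \<in> U" using cU by auto
    show "(c \<in> {r, s}) \<noteq> (x c \<in> {r, s})" using c L qK disj by auto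
    show "(f \<in> {f}) \<noteq> (x f \<in> {f})" using f by simp
    show "(c \<in> A) \<noteq> (x c \<in> A)" using c q qK disj unfolding A_def by auto
  qed
  have rsU: "r \<in> U" "s \<in> U" using L by auto
  have "generates_sym U {x, m}"
  proof (rule generates_sym_if_glues[OF fU xper mU rsU L(2) mrs _ _ tr])
    show "odd (card A)" using finA K by auto
    show "(m ^^ card A) z = z" if "z \<in> U" "z \<noteq> r" "z \<noteq> s" for z
    proof (cases "z = f")
      case True then show ?thesis using funpow_eq_id[of "{f}" m] mf by simp
    next
      case False
      then have "z \<in> A" using that L unfolding A_def by auto
      then show ?thesis using cyc_on_funpow_eq_iff[OF mA mU fU finA(1)] by simp
    qed
    fix T assume "inv_relation U {x, m} T" and rsT: "(r, s) \<in> T"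
    then interpret inv_relation U "{x, m}" T by simp
    have rs: "rel r s" using rsT unfolding rel_def .
    show "T = U \<times> U"
    proof (cases "x r \<in> L \<or> x s \<in> L")
      case True
      then show ?thesis using full_if_swap_meets[OF refl rs mrs(1)] L by blast
    next
      case False
      have "x ` L \<subseteq> Q"
      proof
        fix y assume "y \<in> x ` L"
        then have "y \<notin> L" "y \<in> U" "y \<notin> x ` K" using False L image_L by auto
        then show "y \<in> Q" unfolding Q_def by blast
      qed
      moreover have "card (x ` L) = 2"
        using L2 permutes_inj[OF xper] by (simp add: card_image inj_on_subset)
      ultimately have "card Q \<ge> 2" using card_mono finPQRS by metis
      then have fQ: "f \<in> Q" "card Q = 2" using t by auto
      obtain c' where c': "c' \<in> L" "x c' = f" using preQ fQ by blast
      have "rel c' c" using rs c c' L rel_sym rel_refl rsU by auto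
      then have "rel f q" using rel_app[of x c' c] c c' by auto
      moreover have ff: "rel f f" using rel_refl cU by blast
      moreover have "q \<in> A" using q qK unfolding A_def by blast
      ultimately have A: "rel f b" if "b \<in> A" for b
        using rel_cyc[of m f f A q b] mf mA that by simp
      \<comment> \<open>\<open>K\<close> has more than the two points of \<open>Q\<close>. A point
        of \<open>P\<close> has its preimage in \<open>K\<close> too, so a block containing
        \<open>K\<close> meets its image under \<open>x\<close>.\<close>
      have "P \<noteq> {}"
      proof
        assume "P = {}"
        then show False using card_K fQ K(2) by simp
      qed
      then obtain p where "p \<in> P" by blast
      then obtain d where d: "d \<in> K" "x d = p" "p \<in> K" unfolding P_def by blast
      have fK: "rel f b" if "b \<in> K" for b using A ff that unfolding A_def by blast
      show ?thesis
      proof (rule full_if_closed[OF cU(2)])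
        show "\<exists>d. rel f d \<and> rel f (g d)" if "g \<in> {x, m}" for g
          using that fK[OF d(1)] fK[OF d(3)] d(2) ff mf by auto
      qed
    qed
  qed
  then show ?thesis using goodI mU mK by blast
qed

text \<open>\<open>m\<close> swaps r and s, fixes \<open>r'\<close> and has an odd cycle on
  \<open>K\<close>, so a power of it is \<open>(r s)\<close>; this pair meets its
  \<open>x\<close>-image in the fixed point s.\<close>

lemma good_fixed_in_L:
  assumes K: "odd (card K)" and L: "L = {r, s, r'}" "distinct [r, s, r']"
    and x: "x s = s" "x r \<in> K" "x r' \<in> K"
  shows "good K L x"
proof -
  have "K \<noteq> {}" using K by auto
  then obtain g where g: "g permutes K" "cyc_on g K" using ex_cyc_on fin by metis
  have t2: "transpose r s permutes {r, s}" by (simp add: permutes_swap_id)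
  have AL: "{r, s} \<inter> K = {}" using disj L by blast
  define m where "m = transpose r s \<circ> g"
  note m = permutes_comp_disjoint[OF t2 g(1) AL, folded m_def]
  have mA: "cyc_on m K" using cyc_on_comp_disjoint(2)[OF t2 g(1) AL] g unfolding m_def by blast
  have mrs: "m r = s" "m s = r" using m(2) by auto
  have sub: "{r, s} \<union> K \<subseteq> U" using L by blast
  have mU: "m permutes U" using permutes_subset[OF m(1) sub] .
  have r'K: "r' \<notin> K" using disj L by blast
  then have mf: "m r' = r'" using permutes_not_in[OF m(1)] L by auto
  have mK: "m ` K = K" using m(3) permutes_image[OF g(1)] by (metis image_cong)
  have rK: "r \<notin> K" using disj L by blast
  have tr: "trans_on_set U {x, m}"
  proof (rule trans_on_set_three[OF fU xper mU _ cyc_on_pair[OF mrs] cyc_on_singleton[where f = m and z = r', OF mf] mA])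
    show "U \<subseteq> {r, s} \<union> {r'} \<union> K" using L by blast
    show "r \<in> U" "r' \<in> U" "r \<in> U" using L by auto
    show "(r \<in> {r, s}) \<noteq> (x r \<in> {r, s})" using x AL by auto
    show "(r' \<in> {r'}) \<noteq> (x r' \<in> {r'})" using x r'K by auto
    show "(r \<in> K) \<noteq> (x r \<in> K)" using x rK by auto
  qed
  have rsU: "r \<in> U" "s \<in> U" "r \<noteq> s" using L by auto
  have "generates_sym U {x, m}"
  proof (rule generates_sym_if_glues[OF fU xper mU rsU mrs K _ tr])
    show "(m ^^ card K) z = z" if "z \<in> U" "z \<noteq> r" "z \<noteq> s" for z
    proof (cases "z = r'")
      case True then show ?thesis using funpow_eq_id[of "{r'}" m] mf by simp
    next
      case False
      then have "z \<in> K" using that L by auto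
      then show ?thesis using cyc_on_funpow_eq_iff[OF mA mU fU fin(1)] by simp
    qed
    fix T assume "inv_relation U {x, m} T" and rsT: "(r, s) \<in> T"
    then interpret inv_relation U "{x, m}" T by simp
    have "rel r s" using rsT unfolding rel_def .
    then show "T = U \<times> U" using full_if_swap_meets[OF refl _ mrs(1)] x by blast
  qed
  then show ?thesis using goodI mU mK by blast
qed

text \<open>\<open>x\<close> moves only q, \<open>q'\<close>, r, \<open>r'\<close>. Choose
  \<open>m\<close> fixing q such that the other three are moved off this set; then \<open>x\<close>
  and its conjugate by \<open>m\<close> have supports meeting only in q, and their commutator is a
  3-cycle. In \<open>L\<close> this means that r and \<open>r'\<close> are not neighbours in the
  cycle of \<open>m\<close>, whence at least four points there.\<close>

lemma good_four_moved:
  assumes ev: "even (card U)" and L4: "4 \<le> card L" and K3: "3 \<le> card K" and Q2: "card Q = 2"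
    and fP: "\<And>p. p \<in> P \<Longrightarrow> x p = p" and fS: "\<And>p. p \<in> S \<Longrightarrow> x p = p"
    and xQ: "\<And>q. q \<in> Q \<Longrightarrow> x q \<in> R" and xR: "\<And>r. r \<in> R \<Longrightarrow> x r \<in> Q"
  shows "good K L x"
proof -
  obtain q q' where Qe: "Q = {q, q'}" "q \<noteq> q'" using Q2 by (metis card_2_iff)
  obtain r r' where Re: "R = {r, r'}" "r \<noteq> r'" using card_R Q2 by (metis card_2_iff)
  have memK: "q \<in> K" "q' \<in> K" and memL: "r \<in> L" "r' \<in> L" using Qe Re K_eq L_eq by auto
  have nK: "r \<notin> K" "r' \<notin> K" and nL: "q \<notin> L" "q' \<notin> L" using memK memL disj by auto
  define A where "A = K - {q}"
  have finA: "finite A" "card A = card K - 1" using fin memK unfolding A_def by auto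
  then have "A \<noteq> {}" using K3 by auto
  then obtain f where f: "f permutes A" "cyc_on f A" "evenperm f \<longleftrightarrow> odd (card A)"
    using ex_cyc_on[OF finA(1)] by blast
  define B where "B = L - {r'}"
  have finB: "finite B" "card B = card L - 1" using fin memL unfolding B_def by auto
  have rB: "r \<in> B" using memL Re unfolding B_def by blast
  then obtain g0 where g0: "g0 permutes B" "cyc_on g0 B" "evenperm g0 \<longleftrightarrow> odd (card B)"
    using ex_cyc_on[OF finB(1)] by blast
  obtain r0 where r0: "g0 r0 = r" using permutes_surj[OF g0(1)] by (metis surj_def)
  have "\<not> B \<subseteq> {r, r0}"
  proof
    assume "B \<subseteq> {r, r0}"
    then have "card B \<le> card {r, r0}" by (intro card_mono) auto
    also have "\<dots> \<le> 2" by (simp add: card_insert_if)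
    finally show False using finB L4 by simp
  qed
  \<comment> \<open>Inserting \<open>r'\<close> after e puts it directly behind neither r nor the
    predecessor \<open>r0\<close> of r, so neither of r, \<open>r'\<close> follows the
    other.\<close>
  then obtain e where e: "e \<in> B" "e \<noteq> r" "e \<noteq> r0" by blast
  have "r' \<notin> B" "insert r' B = L" using memL unfolding B_def by auto
  note ins = permutes_insert_cycle[OF g0(1,2) e(1) this(1), unfolded this(2)]
  define g where "g = g0 \<circ> transpose e r'"
  note ins = ins[folded g_def]
  have "permutation g0" using permutes_imp_permutation[OF finB(1) g0(1)] .
  then have "evenperm g \<longleftrightarrow> \<not> evenperm g0"
    unfolding g_def using e \<open>r' \<notin> B\<close> by (auto simp: evenperm_comp permutation_swap_id evenperm_swap)
  then have evg: "evenperm g \<longleftrightarrow> odd (card L)" using g0(3) finB L4 by auto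
  have AL: "A \<inter> L = {}" using disj unfolding A_def by blast
  define m where "m = f \<circ> g"
  note m = permutes_comp_disjoint[OF f(1) ins(1) AL, folded m_def]
  have cA: "cyc_on m A" and cL: "cyc_on m L"
    using cyc_on_comp_disjoint[OF f(1) ins(1) AL, folded m_def] f ins(2) by auto
  have mU: "m permutes U" using permutes_subset[OF m(1)] unfolding A_def by blast
  have mq: "m q = q" using permutes_not_in[OF m(1)] nL unfolding A_def by blast
  have "m ` A = A" using m(2) permutes_image[OF f(1)] by (metis image_cong)
  moreover have "K = insert q A" using memK unfolding A_def by blast
  ultimately have mK: "m ` K = K" using mq by simp
  have "card U = card K + card L" using fin disj by (simp add: card_Un_disjoint)
  then have modd: "\<not> evenperm m"
    unfolding m_def evenperm_comp_permutes[OF f(1) ins(1) finA(1) fin(2)] f(3) evg finA(2) using ev K3 by auto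
  have nofix: "m z \<noteq> z" if "z \<in> A \<or> z \<in> L" for z
  proof -
    have "card A > 1" "card L > 1" using finA K3 L4 by auto
    then show ?thesis
      using that cyc_on_funpow_eq_iff[OF cA mU fU finA(1), of z 1]
        cyc_on_funpow_eq_iff[OF cL mU fU fin(2), of z 1] by auto
  qed
  have q'A: "q' \<in> A" using memK Qe unfolding A_def by blast
  have "m r = g r" "m r' = g r'" using m(3) memL by auto
  moreover have "g r = g0 r" "g0 r \<in> B" using ins(5)[OF rB] e(2) rB permutes_in_image[OF g0(1)] by auto
  moreover have "g r' \<noteq> r" using ins(4) e r0 permutes_inj[OF g0(1)] by (metis inj_eq)
  ultimately have mr: "m r \<noteq> r'" "m r' \<noteq> r" using \<open>r' \<notin> B\<close> by auto
  have mL: "m r \<in> L" "m r' \<in> L" using cyc_on_closed[OF cL] memL by auto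
  have mq': "m q' \<in> A" "m q' \<noteq> q'" using cyc_on_closed[OF cA q'A] nofix q'A by auto
  have mr2: "m r \<noteq> r" "m r' \<noteq> r'" using nofix memL by auto
  define x' where "x' = m \<circ> x \<circ> inv' m"
  have x'U: "x' permutes U" unfolding x'_def using xper mU by (intro permutes_compose permutes_inv)
  have x'm: "x' (m z) = m (x z)" for z unfolding x'_def using permutes_inverses[OF mU] by simp
  have fixx: "x z = z" if "z \<notin> {q, q', r, r'}" for z
  proof (cases "z \<in> U")
    case True
    then have "z \<in> P \<or> z \<in> S" using that K_eq L_eq Qe Re by blast
    then show ?thesis using fP fS by blast
  next
    case False then show ?thesis using permutes_not_in[OF xper] by blast
  qed
  have xq: "x q \<in> R" "x q' \<in> R" using xQ Qe by auto
  have comm: "x \<circ> x' \<circ> inv' x \<circ> inv' x' = cyc3 q (x q) (x' q)"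
  proof (rule commutator_cyc3_meet[OF xper x'U])
    show "x q \<noteq> q" using xq Qe disjPQRS by auto
    have "x' q = m (x q)" using x'm[of q] mq by simp
    moreover have "m (x q) \<in> L" using xq Re mL by auto
    ultimately show "x' q \<noteq> q" using nL by auto
    fix z assume z: "z \<noteq> q"
    show "x z = z \<or> x' z = z"
    proof (cases "z \<in> {q', r, r'}")
      case True
      obtain z' where z': "z = m z'" using permutes_surj[OF mU] by (metis surj_def)
      have "z' \<notin> {q, q', r, r'}"
      proof -
        have "m q' \<in> K" using mq' unfolding A_def by blast
        then have "m q' \<notin> {q', r, r'}" using mq' nK by auto
        moreover have "m r \<notin> {q', r, r'}" "m r' \<notin> {q', r, r'}" using mr mr2 mL nL by auto
        ultimately show ?thesis using z z' True mq by auto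
      qed
      then have "x' z = z" using fixx x'm z' by metis
      then show ?thesis by blast
    qed (use z fixx in auto)
  qed
  have x'q: "x' q = m (x q)" using x'm[of q] mq by simp
  have xqL: "x q \<in> L" using xq L_eq by blast
  have qU: "q \<in> U" "q' \<in> U" using memK by auto
  have tr: "trans_on_set U {x, m}"
  proof (rule trans_on_set_three[OF fU xper mU _ cyc_on_singleton[where f = m and z = q, OF mq] cA cL])
    show "U \<subseteq> {q} \<union> A \<union> L" unfolding A_def by blast
    show "q \<in> U" "q' \<in> U" "q \<in> U" using qU by auto
    show "(q \<in> {q}) \<noteq> (x q \<in> {q})" using xqL nL by auto
    have "x q' \<in> L" using xq L_eq by blast
    then show "(q' \<in> A) \<noteq> (x q' \<in> A)" using q'A AL by blast
    show "(q \<in> L) \<noteq> (x q \<in> L)" using xqL nL by auto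
  qed
  have "generates_sym U {x, m}"
  proof (rule generates_sym_if_cyc3[OF mU modd _ _ _ _ _ tr])
    have "x' q \<in> L" using x'q cyc_on_closed[OF cL xqL] by simp
    moreover have "x' q \<noteq> x q" using x'q nofix xqL by simp
    ultimately show "distinct [q, x q, x' q]" "x' q \<in> U" using xqL nL by auto
    show "q \<in> U" "x q \<in> U" using qU x_mem by auto
    show "cyc3 q (x q) (x' q) \<in> H" if H: "perm_closed H" "{x, m} \<subseteq> H" for H
    proof -
      have "x' \<in> H" unfolding x'_def using perm_closedD(2,3)[OF H(1)] H(2) by simp
      then show ?thesis using comm[symmetric] perm_closedD(2,3)[OF H(1)] H(2) by simp
    qed
    fix T assume "inv_relation U {x, m} T" and uT: "(q, x q) \<in> T"
    then interpret inv_relation U "{x, m}" T by simp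
    have "rel q (x q)" using uT unfolding rel_def .
    moreover have "rel q q" using rel_refl qU by blast
    ultimately show "T = U \<times> U"
    proof (intro full_if_closed[OF qU(1)])
      show "\<exists>d. rel q d \<and> rel q (g d)" if "g \<in> {x, m}" for g
        using that \<open>rel q (x q)\<close> \<open>rel q q\<close> mq by auto
    qed
  qed
  then show ?thesis using goodI mU mK by blast
qed

end

section \<open>Odd degree, and a part \<open>L\<close> with two points\<close>

context two_parts
begin

lemmas finKL = fin

text \<open>The cycle outside the pair has odd length n - 2. A block \<open>{u, v}\<close> disjoint
  from its image would give a block of two points inside this cycle; the power of \<open>y\<close>
  taking one to the other would have to swap them, which is impossible in a cycle of odd
  length.\<close>

lemma good_odd_pair:
  assumes od: "odd (card U)" and uv: "legal_pair u v" and O: "lcyc (U - {u, v})"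
    and a: "a \<in> {u, v}" "x a \<notin> {u, v}"
  shows "good K L x"
proof -
  define B where "B = U - {u, v}"
  obtain g where g: "g permutes B" "cyc_on g B" "legal g B" using O unfolding lcyc_def B_def by blast
  have uvB: "{u, v} \<inter> B = {}" unfolding B_def by blast
  have tp: "transpose u v permutes {u, v}" by (simp add: permutes_swap_id)
  define y where "y = transpose u v \<circ> g"
  note y = permutes_comp_disjoint[OF tp g(1) uvB, folded y_def]
  have uvU: "u \<in> U" "v \<in> U" "u \<noteq> v" using uv unfolding legal_pair_def by auto
  then have Ueq: "U = {u, v} \<union> B" unfolding B_def by blast
  then have yU: "y permutes U" using y(1) by simp
  have yuv: "y u = v" "y v = u" using y(2) by auto
  have cB: "cyc_on y B" using g(2) cyc_on_cong[of B y g] y(3) by blast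
  have "legal y U"
    using g(3) y(3) uv yuv unfolding Ueq legal_def legal_pair_def by auto
  have finB: "finite B" unfolding B_def using fU by blast
  have "card B = card U - card {u, v}" unfolding B_def using uvU by (intro card_Diff_subset) auto
  then have oB: "odd (card B)" using od uvU card_mono[OF fU, of "{u, v}"] by auto
  have aU: "a \<in> U" using a uvU by auto
  have tr: "trans_on_set U {x, y}"
    by (rule trans_on_set_two[OF fU xper yU _ cyc_on_pair[OF yuv] cB aU]) (use Ueq a in auto)
  have "generates_sym U {x, y}"
  proof (rule generates_sym_if_glues[OF fU xper yU uvU yuv oB _ tr])
    show "(y ^^ card B) z = z" if "z \<in> U" "z \<noteq> u" "z \<noteq> v" for z
      using cyc_on_funpow_eq_iff[OF cB yU fU finB, of z] that unfolding B_def by simp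
    fix T assume "inv_relation U {x, y} T" and uT: "(u, v) \<in> T"
    then interpret inv_relation U "{x, y}" T by simp
    have uv: "rel u v" using uT unfolding rel_def .
    have uu: "rel u u" using rel_refl uvU by blast
    show "T = U \<times> U"
    proof (cases "x u \<in> {u, v} \<or> x v \<in> {u, v}")
      case True
      then show ?thesis using full_if_swap_meets[OF refl uv yuv(1)] by blast
    next
      case False
      have xB: "x u \<in> B" "x v \<in> B" using False x_mem uvU unfolding B_def by auto
      have "\<exists>b\<in>B. rel u b"
      proof (rule ccontr)
        assume no: "\<not> ?thesis"
        define D where "D = {b. \<exists>j. b = (y ^^ j) (x u)}"
        have "y ` D \<subseteq> D" unfolding D_def by clarify (metis comp_apply funpow.simps(2))
        moreover have "x u \<in> D" unfolding D_def by (rule CollectI, rule exI[of _ 0]) simp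
        ultimately have "B \<subseteq> D" using cyc_on_subset[OF cB] xB(1) by blast
        then obtain j where j: "x v = (y ^^ j) (x u)" using xB(2) unfolding D_def by blast
        have E: "rel (x u) (x v)" using rel_app[of x u v] uv uvU by auto
        have "rel (x v) ((y ^^ j) (x v))" using rel_funpow[of y _ _ j, OF _ E] j by simp
        then have *: "rel (x u) ((y ^^ j) (x v))" using E rel_trans by blast
        then have "(y ^^ j) (x v) \<in> x ` U" using rel_mem permutes_image[OF xper] by blast
        then obtain c where c: "c \<in> U" "(y ^^ j) (x v) = x c" by blast
        then have "rel u c" using * rel_app[of x u c] uvU by simp
        then have "c = u \<or> c = v" using no c Ueq by blast
        moreover have inj: "inj (y ^^ j)" using yU permutes_inj inj_fn by blast
        have "c \<noteq> v"
        proof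
          assume "c = v"
          then have "(y ^^ j) (x v) = (y ^^ j) (x u)" using c j by simp
          then show False using inj x_inj uvU by (simp add: inj_eq)
        qed
        ultimately have "(y ^^ j) ((y ^^ j) (x u)) = x u" using c j by simp
        then have "(y ^^ (j + j)) (x u) = x u" by (simp add: funpow_add)
        then have "card B dvd j + j" using cyc_on_funpow_eq_iff[OF cB yU fU finB xB(1)] by blast
        then have "card B dvd 2 * j" by (simp add: mult_2)
        then have "card B dvd j" using oB by (simp add: coprime_dvd_mult_right_iff)
        then have "x v = x u" using cyc_on_funpow_eq_iff[OF cB yU fU finB xB(1)] j by simp
        then show False using x_inj uvU by simp
      qed
      then obtain b where b: "b \<in> B" "rel u b" by blast
      then have "rel u (x u)" using rel_cyc[of y u u B b "x u"] uu uv yuv cB xB by simp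
      then show ?thesis
      proof (intro full_if_closed[OF uvU(1)])
        show "\<exists>d. rel u d \<and> rel u (g d)" if "g \<in> {x, y}" for g
          using that \<open>rel u (x u)\<close> uu uv yuv by auto
      qed
    qed
  qed
  then show ?thesis using good_if_legal yU \<open>legal y U\<close> by blast
qed

text \<open>The case that admits no suitable pair. \<open>m\<close> is a full cycle on each part,
  odd because \<open>card K\<close> is even; its cube is trivial on \<open>L\<close> and moves u, so
  its commutator with \<open>x\<close> is a 3-cycle.\<close>

lemma good_swap_three:
  assumes K: "even (card K)" and L3: "card L = 3" and u: "u \<in> K" and r: "x u \<in> L"
    and fx: "\<And>z. z \<in> K \<Longrightarrow> z \<noteq> u \<Longrightarrow> x z = z"
    and sw: "\<And>z. z \<in> L \<Longrightarrow> z \<noteq> x u \<Longrightarrow> x z \<noteq> z \<and> x z \<in> L \<and> x z \<noteq> x u"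
  shows "good K L x"
proof -
  define r where "r = x u"
  have rL: "r \<in> L" "r \<notin> K" using r disj unfolding r_def by auto
  obtain f where f: "f permutes K" "cyc_on f K" "evenperm f \<longleftrightarrow> odd (card K)"
    using ex_cyc_on[OF fin(1)] u by blast
  obtain g where g: "g permutes L" "cyc_on g L" "evenperm g \<longleftrightarrow> odd (card L)"
    using ex_cyc_on[OF fin(2)] rL by blast
  define m where "m = f \<circ> g"
  note m = permutes_comp_disjoint[OF f(1) g(1) disj, folded m_def]
  have cK: "cyc_on m K" and cL: "cyc_on m L"
    using cyc_on_comp_disjoint[OF f(1) g(1) disj, folded m_def] f g by auto
  have mK: "m ` K = K" using m(2) permutes_image[OF f(1)] by (metis image_cong)
  have modd: "\<not> evenperm m"
    unfolding m_def evenperm_comp_permutes[OF f(1) g(1) fin] f(3) g(3) using K L3 by simp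
  have K1: "\<not> card K dvd 3" "\<not> card K dvd 1" using K by (metis dvd_trans odd_numeral, metis dvd_trans odd_one)
  define a where "a = m ^^ 3"
  have aU: "a permutes U" unfolding a_def using m(1) by (rule funpow_permutes)
  have "a z = z" if "z \<in> L" for z
    unfolding a_def using cyc_on_funpow_eq_iff[OF cL m(1) fU fin(2) that] L3 by simp
  then have aK: "a permutes K" using permutes_superset[OF aU] by blast
  have au: "a u \<noteq> u" unfolding a_def using cyc_on_funpow_eq_iff[OF cK m(1) fU fin(1) u] K1 by simp
  have xu: "x u \<notin> K" using rL unfolding r_def by simp
  have comm: "x \<circ> a \<circ> inv' x \<circ> inv' a = cyc3 u (x u) (a u)"
    by (rule commutator_cyc3[OF xper aK u au xu fx])
  have auK: "a u \<in> K" using permutes_in_image[OF aK] u by blast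
  have uU: "u \<in> U" "r \<in> U" using u rL by auto
  have tr: "trans_on_set U {x, m}"
    by (rule trans_on_set_two[OF fU xper m(1) subset_refl cK cL uU(1)]) (use u xu in simp)
  have "generates_sym U {x, m}"
  proof (rule generates_sym_if_cyc3[OF m(1) modd _ _ _ _ _ tr])
    show "u \<in> U" "x u \<in> U" "a u \<in> U" using u auK x_mem by auto
    show "distinct [u, x u, a u]" using u auK au xu by auto
    show "cyc3 u (x u) (a u) \<in> H" if H: "perm_closed H" "{x, m} \<subseteq> H" for H
    proof -
      have "a \<in> H" unfolding a_def using perm_closed_funpow[OF H(1)] H(2) by blast
      then show ?thesis using comm[symmetric] perm_closedD(2,3)[OF H(1)] H(2) by simp
    qed
    fix T assume "inv_relation U {x, m} T" and uT: "(u, x u) \<in> T"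
    then interpret inv_relation U "{x, m}" T by simp
    have ur: "rel u r" using uT unfolding rel_def r_def .
    define s where "s = m r"
    have nofix: "m z \<noteq> z" if "z \<in> L" for z
      using cyc_on_funpow_eq_iff[OF cL m(1) fU finKL(2) that, of 1] L3 by simp
    have s: "s \<in> L" "s \<noteq> r" using cyc_on_closed[OF cL] rL nofix unfolding s_def by auto
    have ms: "m s \<in> L" "m s \<noteq> s" using cyc_on_closed[OF cL] s nofix by auto
    have "m s \<noteq> r"
    proof
      assume "m s = r"
      then have "L \<subseteq> {r, s}" using cyc_on_subset[OF cL, of "{r, s}" r] rL s_def by auto
      then have "card L \<le> card {r, s}" by (intro card_mono) auto
      then show False using L3 s by simp
    qed
    have xs: "x s \<in> L" "x s \<noteq> s" "x s \<noteq> r" using sw s unfolding r_def by auto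
    have "L = {r, s, m s}"
      using rL s ms \<open>m s \<noteq> r\<close> L3 finKL by (intro card_seteq[symmetric]) auto
    then have "x s = m s" using xs by blast
    have muK: "m u \<in> K" using cyc_on_closed[OF cK u] .
    have "m u \<noteq> u" using cyc_on_funpow_eq_iff[OF cK m(1) fU finKL(1) u, of 1] K1 by simp
    then have xmu: "x (m u) = m u" using fx muK by blast
    \<comment> \<open>Apply \<open>m\<close> to the relation of u and r, then \<open>x\<close>: this
      fixes \<open>m u\<close> and sends s to \<open>m s\<close>. Hence s and \<open>m s\<close>
      share a block, and undoing \<open>m\<close> puts r and s in one block.\<close>
    have "rel (m u) s" using rel_app[of m u r] ur uU unfolding s_def by simp
    moreover from this have "rel (m u) (m s)" using rel_app[of x "m u" s] rel_mem xmu \<open>x s = m s\<close> by auto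
    ultimately have "rel (m r) (m s)" using rel_sym rel_trans unfolding s_def by blast
    then have rs: "rel r s" using rel_app[of m r s] uU s by simp
    show "T = U \<times> U"
    proof (rule full_if_closed[OF uU(2)])
      show "\<exists>d. rel r d \<and> rel r (g d)" if "g \<in> {x, m}" for g
        using that rs ur rel_sym rel_refl[OF uU(2)] unfolding s_def r_def by blast
    qed
  qed
  then show ?thesis using goodI m(1) mK by blast
qed

lemma P_nonfixed_pair:
  assumes "p \<in> P" "x p \<noteq> p" "3 \<le> card P"
  obtains v where "v \<in> P" "v \<noteq> p" "x p \<notin> {p, v}"
proof -
  have "\<not> P \<subseteq> {p, x p}"
  proof
    assume "P \<subseteq> {p, x p}"
    then have "card P \<le> card {p, x p}" by (intro card_mono) auto
    then show False using assms by simp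
  qed
  then show ?thesis using that assms by auto
qed

lemma lcyc_rest_pair:
  assumes "u \<in> P \<and> v \<in> P \<or> u \<in> S \<and> v \<in> S" "Q \<noteq> {}" shows "lcyc (U - {u, v})"
proof (rule lcyc_ex)
  have "(U - {u, v}) \<inter> Q = Q" "(U - {u, v}) \<inter> R = R" using assms K_eq L_eq disjPQRS by auto
  then show "card ((U - {u, v}) \<inter> Q) = card ((U - {u, v}) \<inter> R)" "(U - {u, v}) \<inter> Q \<noteq> {}"
    using card_R assms by auto
qed blast

lemma transpose_if_fixed:
  assumes fP: "\<And>p. p \<in> P \<Longrightarrow> x p = p" and fS: "\<And>p. p \<in> S \<Longrightarrow> x p = p" and Q: "Q = {q}"
  obtains r where "r \<in> L" "x = transpose q r"
proof -
  obtain r where r: "R = {r}" using card_R Q by (metis card_1_singletonE card_1_singleton_iff)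
  have qK: "q \<in> K" and rL: "r \<in> L" using Q r K_eq L_eq by auto
  have xq: "x q = r"
  proof -
    have "x q \<noteq> p" if "p \<in> P" for p using that fP[OF that] x_inj[of q p] Q disjPQRS by auto
    then show ?thesis using x_Q[of q] Q r by auto
  qed
  have xr: "x r = q"
  proof -
    have "x r \<noteq> p" if "p \<in> S" for p using that fS[OF that] x_inj[of r p] r disjPQRS by auto
    then show ?thesis using x_R[of r] Q r by auto
  qed
  have "x z = transpose q r z" for z
  proof (cases "z \<in> U")
    case True
    then have "z \<in> P \<or> z \<in> S \<or> z = q \<or> z = r" using K_eq L_eq Q r by auto
    then show ?thesis using xq xr fP fS Q r disjPQRS by (auto simp: transpose_def)
  next
    case False
    then show ?thesis using permutes_not_in[OF xper] qK rL by (auto simp: transpose_def)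
  qed
  then show ?thesis using that rL by blast
qed

lemma moved_in_S:
  assumes fP: "\<And>p. p \<in> P \<Longrightarrow> x p = p" and Q: "Q = {q}"
    and ntr: "\<And>a b. a \<in> K \<Longrightarrow> b \<in> L \<Longrightarrow> x \<noteq> transpose a b"
  obtains s where "s \<in> S" "x s \<noteq> s"
proof -
  have "\<exists>s\<in>S. x s \<noteq> s"
  proof (rule ccontr)
    assume "\<not> ?thesis"
    then have fS: "\<And>p. p \<in> S \<Longrightarrow> x p = p" by blast
    obtain r where "r \<in> L" "x = transpose q r" using transpose_if_fixed[OF fP fS Q] .
    moreover have "q \<in> K" using Q K_eq by blast
    ultimately show False using ntr by blast
  qed
  then show ?thesis using that by blast
qed

text \<open>The pair is taken in \<open>P\<close> if \<open>x\<close> moves a point there; otherwise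
  across \<open>Q\<close> and \<open>R\<close> if these have two points; otherwise in
  \<open>S\<close>. The last choice fails only if \<open>S\<close> consists of two points swapped by
  \<open>x\<close>.\<close>

lemma good_odd:
  assumes od: "odd (card U)" and L3: "3 \<le> card L" and KL: "card L + 3 \<le> card K" and Q: "Q \<noteq> {}"
    and ntr: "\<And>a b. a \<in> K \<Longrightarrow> b \<in> L \<Longrightarrow> x \<noteq> transpose a b"
  shows "good K L x"
proof -
  have cU: "card U = card K + card L" using fin disj by (simp add: card_Un_disjoint)
  have P3: "3 \<le> card P" using card_K card_L KL by simp
  show ?thesis
  proof (cases "\<exists>p\<in>P. x p \<noteq> p")
    case True
    then obtain p v where pv: "p \<in> P" "v \<in> P" "v \<noteq> p" "x p \<notin> {p, v}" using P_nonfixed_pair P3 by metis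
    show ?thesis
      by (rule good_odd_pair[OF od legal_pairI(1)[OF pv(1,2)] lcyc_rest_pair, of p]) (use pv Q in auto)
  next
    case False
    then have fP: "\<And>p. p \<in> P \<Longrightarrow> x p = p" by blast
    obtain q where q: "q \<in> Q" using Q by blast
    have xq: "x q \<in> R"
    proof -
      have "x q \<noteq> p" if "p \<in> P" for p using that fP[OF that] x_inj[of q p] q disjPQRS by auto
      then show ?thesis using x_Q[OF q] by auto
    qed
    show ?thesis
    proof (cases "card Q = 1")
      case False
      have "card Q > 0" using Q finPQRS by (simp add: card_gt_0_iff)
      then have Q2: "2 \<le> card Q" using False by simp
      have cq: "card (Q - {q}) = card Q - 1" using q finPQRS by simp
      have "card (R - {x q}) = card Q - 1" using xq card_R finPQRS by simp
      then have "R - {x q} \<noteq> {}" using Q2 by force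
      then obtain r where r: "r \<in> R" "r \<noteq> x q" by blast
      have qr: "q \<notin> R" "r \<notin> Q" "q \<noteq> r" using q r disjPQRS by auto
      have "(U - {q, r}) \<inter> Q = Q - {q}" "(U - {q, r}) \<inter> R = R - {r}" using qr K_eq L_eq by auto
      moreover have "card (R - {r}) = card Q - 1" using r card_R finPQRS by simp
      moreover have "Q - {q} \<noteq> {}" using cq Q2 by force
      ultimately have "lcyc (U - {q, r})" using cq by (intro lcyc_ex) auto
      moreover have "x q \<noteq> q" using xq q disjPQRS by auto
      ultimately show ?thesis
        by (intro good_odd_pair[OF od legal_pairI(3)[OF q r(1)], of q]) (use r in auto)
    next
      case True
      then have Qq: "Q = {q}" using q by (metis card_1_singletonE singletonD)
      have cS: "card S = card L - 1" using card_L True by simp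
      obtain s where s: "s \<in> S" "x s \<noteq> s" using moved_in_S[OF fP Qq ntr] .
      show ?thesis
      proof (cases "\<exists>a b. a \<in> S \<and> b \<in> S \<and> a \<noteq> b \<and> x a \<notin> {a, b}")
        case True
        then obtain a b where ab: "a \<in> S" "b \<in> S" "a \<noteq> b" "x a \<notin> {a, b}" by blast
        show ?thesis
          by (rule good_odd_pair[OF od legal_pairI(2)[OF ab(1-3)] lcyc_rest_pair, of a]) (use ab Q in auto)
      next
        case no: False
        have "S \<subseteq> {s, x s}" using no s by blast
        then have "card S \<le> card {s, x s}" by (intro card_mono) auto
        then have "card S \<le> 2" using s by simp
        then have L: "card L = 3" "card S = 2" using cS L3 by auto
        have S: "S = {s, x s}"
          using \<open>S \<subseteq> {s, x s}\<close> L s by (intro card_seteq) auto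
        have "x (x s) \<noteq> x s" using s x_inj by simp
        moreover have "x s \<in> S" using S by blast
        ultimately have xxs: "x (x s) = s" using no s by (metis insertE singletonD)
        have "even (card K)" using od L cU by simp
        then show ?thesis
        proof (rule good_swap_three[OF _ L(1), of q])
          show "q \<in> K" "x q \<in> L" using q xq K_eq L_eq by auto
          show "x z = z" if "z \<in> K" "z \<noteq> q" for z using that fP Qq K_eq by blast
          have "card R = 1" using card_R True by simp
          then have "R = {x q}" using xq by (metis card_1_singletonE singletonD)
          then show "x z \<noteq> z \<and> x z \<in> L \<and> x z \<noteq> x q" if "z \<in> L" "z \<noteq> x q" for z
          proof -
            have z: "z \<in> S" using that L_eq \<open>R = {x q}\<close> by blast
            then have "x z \<in> S" "x z \<noteq> z" using S xxs s by auto
            moreover have "x q \<notin> S" using xq disjPQRS by blast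
            ultimately show ?thesis using L_eq by auto
          qed
        qed
      qed
    qed
  qed
qed

lemma good_even_two:
  assumes L2: "card L = 2" and K: "even (card K)" "2 < card K" and Q: "Q \<noteq> {}"
    and ntr: "\<And>a b. a \<in> K \<Longrightarrow> b \<in> L \<Longrightarrow> x \<noteq> transpose a b"
  shows "good K L x"
proof -
  have "card Q > 0" "card Q \<le> 2" using Q finPQRS card_L L2 by (auto simp: card_gt_0_iff)
  then consider "card Q = 2" | "card Q = 1" by linarith
  then show ?thesis
  proof cases
    case 1
    obtain f where f: "f \<in> Q" using Q by blast
    then have "x f \<noteq> f" using x_Q disjPQRS by (metis disjoint_iff)
    then show ?thesis using good_card_two[OF L2 K, of f] f 1 K_eq by auto
  next
    case 2
    then obtain q where Qq: "Q = {q}" by (metis card_1_singletonE)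
    show ?thesis
    proof (cases "\<exists>f\<in>P. x f \<noteq> f")
      case True
      then obtain f where "f \<in> P" "x f \<noteq> f" by blast
      then show ?thesis using good_card_two[OF L2 K, of f] 2 K_eq by auto
    next
      case False
      then have fP: "\<And>p. p \<in> P \<Longrightarrow> x p = p" by blast
      obtain w where w: "w \<in> S" "x w \<noteq> w" using moved_in_S[OF fP Qq ntr] .
      have xq: "x q \<in> R"
      proof -
        have "x q \<noteq> p" if "p \<in> P" for p using that fP[OF that] x_inj[of q p] Qq disjPQRS by auto
        then show ?thesis using x_Q[of q] Qq by auto
      qed
      show ?thesis
      proof (rule good_one_moved[of q w])
        have "card U = card K + card L" using fin disj by (simp add: card_Un_disjoint)
        then show "even (card U)" using K L2 by simp
        show "q \<in> K" "w \<in> L" using Qq w K_eq L_eq by auto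
        show "x q \<notin> K" using xq unfolding R_def by blast
        show "x z = z" if "z \<in> K" "z \<noteq> q" for z using that fP Qq K_eq by blast
        show "w \<noteq> x q" using w xq disjPQRS by blast
        show "\<not> card K dvd card L - 1" using L2 K by auto
      qed (use w in simp)
    qed
  qed
qed

end

text \<open>With one point in \<open>Q\<close>, the moved points of \<open>P\<close> and
  \<open>S\<close> decide the construction. With more, a point of \<open>Q\<close> or
  \<open>R\<close> sent into \<open>P\<close> or \<open>S\<close> suffices; without one,
  \<open>x\<close> exchanges \<open>Q\<close> with \<open>R\<close> and preserves \<open>P\<close>
  and \<open>S\<close>.\<close>

lemma (in two_parts) good_even:
  assumes ev: "even (card U)" and gc: "1 < gcd (card K) (card L)" and L3: "3 \<le> card L"
    and KL: "card L < card K" and Q: "Q \<noteq> {}"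
    and ntr: "\<And>a b. a \<in> K \<Longrightarrow> b \<in> L \<Longrightarrow> x \<noteq> transpose a b"
  shows "good K L x"
proof -
  define d where "d = gcd (card K) (card L)"
  have d: "1 < d" "d dvd card K" "d dvd card L" using gc unfolding d_def by auto
  then have "d dvd card K - card L" using KL by (simp add: dvd_diff_nat)
  then have dKL: "card L + d \<le> card K" using KL dvd_imp_le[of d "card K - card L"] by simp
  have dvd_three: "d = 3" if "d dvd 3"
  proof -
    have "d = 2 \<or> d = 3" using dvd_imp_le[OF that] d by auto
    then show ?thesis using that by auto
  qed
  have cU: "card U = card K + card L" using fin disj by (simp add: card_Un_disjoint)
  \<comment> \<open>If \<open>card L\<close> is at least 4, then \<open>card K\<close> is at least 6
    since the gcd is at least 2. If it is 3, the gcd is 3 and \<open>card K\<close> is an odd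
    multiple of 3 above 3, so at least 9.\<close>
  have K6: "6 \<le> card K" "10 \<le> card U"
  proof -
    show "6 \<le> card K"
    proof (cases "card L = 3")
      case True
      then have "d = 3" using dvd_three d by simp
      then show ?thesis using dKL True by simp
    qed (use dKL d L3 in linarith)
    show "10 \<le> card U"
    proof (cases "card L = 3")
      case True
      have "odd (card K)" using ev True cU by simp
      moreover have "3 dvd card K" "card K > 3"
      proof -
        have "d = 3" using dvd_three d True by simp
        then show "3 dvd card K" "card K > 3" using d dKL True by auto
      qed
      ultimately have "card K \<noteq> 6" "card K \<ge> 6" using \<open>6 \<le> card K\<close> by auto
      then show ?thesis using cU True by simp
    qed (use cU dKL d L3 \<open>6 \<le> card K\<close> in linarith)
  qed
  have tL: "card Q \<le> card L" using card_L by simp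
  have t0: "0 < card Q" using Q finPQRS by (simp add: card_gt_0_iff)
  have P2: "2 \<le> card P" using card_K tL dKL d by linarith
  interpret sw: two_parts L K x by (rule two_parts_commute)
  show ?thesis
  proof (cases "card Q = 1")
    case t1: True
    then obtain q where Qq: "Q = {q}" by (metis card_1_singletonE)
    obtain r where Rr: "R = {r}" using card_R t1 by (metis card_1_singletonE)
    have qK: "q \<in> K" "r \<in> L" using Qq Rr K_eq L_eq by auto
    have P5: "5 \<le> card P" using card_K t1 K6 by simp
    show ?thesis
    proof (cases "\<exists>f\<in>P. x f \<noteq> f")
      case False
      then have fP: "\<And>p. p \<in> P \<Longrightarrow> x p = p" by blast
      obtain w where w: "w \<in> S" "x w \<noteq> w" using moved_in_S[OF fP Qq ntr] .
      have xq: "x q \<in> R"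
      proof -
        have "x q \<noteq> p" if "p \<in> P" for p using that fP[OF that] x_inj[of q p] Qq disjPQRS by auto
        then show ?thesis using x_Q[of q] Qq by auto
      qed
      show ?thesis
      proof (rule good_one_moved[of q w])
        show "w \<in> L" using w L_eq by auto
        show "x q \<notin> K" using xq unfolding R_def by blast
        show "x z = z" if "z \<in> K" "z \<noteq> q" for z using that fP Qq K_eq by blast
        show "w \<noteq> x q" using w xq disjPQRS by blast
        show "\<not> card K dvd card L - 1" using L3 KL by (auto dest: dvd_imp_le)
      qed (use w ev qK in auto)
    next
      case True
      then obtain f where f: "f \<in> P" "x f \<noteq> f" by blast
      show ?thesis
      proof (cases "\<exists>g\<in>S. x g \<noteq> g")
        case False
        then have fS: "\<And>p. p \<in> S \<Longrightarrow> x p = p" by blast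
        have xr: "x r \<in> Q"
        proof -
          have "x r \<noteq> p" if "p \<in> S" for p using that fS[OF that] x_inj[of r p] Rr disjPQRS by auto
          then show ?thesis using x_R[of r] Rr by auto
        qed
        have "good L K x"
        \<comment> \<open>The roles of \<open>K\<close> and \<open>L\<close> are exchanged: r is the
          only moved point of \<open>L\<close>, and f is the point that \<open>m\<close> fixes. The
          divisibility condition holds because the gcd divides \<open>card K\<close> and so cannot
          divide \<open>card K - 1\<close>.\<close>
        proof (rule sw.good_one_moved[of r f])
          show "even (card (L \<union> K))" using ev by (simp add: Un_commute)
          show "f \<in> K" using f K_eq by auto
          have "x r \<in> K" using xr K_eq by auto
          then show "x r \<notin> L" using disj by blast
          show "x z = z" if "z \<in> L" "z \<noteq> r" for z using that fS Rr L_eq by blast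
          show "f \<noteq> x r" using f xr disjPQRS by blast
          show "\<not> card L dvd card K - 1"
          proof
            assume "card L dvd card K - 1"
            then have "d dvd card K - 1" using d dvd_trans by blast
            moreover have "card K = Suc (card K - 1)" using K6 by simp
            ultimately have "d dvd 1" using d(2) by (metis dvd_add_right_iff plus_1_eq_Suc add.commute)
            then show False using d by simp
          qed
        qed (use f qK in auto)
        then show ?thesis using good_commute[OF disj] by blast
      next
        case True
        then obtain g where g: "g \<in> S" "x g \<noteq> g" by blast
        show ?thesis
        proof (cases "\<exists>z\<in>P. x z = z")
          case True
          then show ?thesis using good_fixed_point[OF ev Q] f g by blast
        next
          case False
          then show ?thesis using good_all_moved[OF ev _ Q] P5 t1 K6 by simp
        qed
      qed
    qed
  next
    case False
    then have t2: "2 \<le> card Q" using t0 by simp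
    show ?thesis
    proof (cases "\<exists>v. v \<in> Q \<and> x v \<in> P \<or> v \<in> R \<and> x v \<in> S")
      case True
      then show ?thesis using good_cross[OF ev _ t2] K6 by auto
    next
      case no: False
      have xQ: "x q \<in> R" if "q \<in> Q" for q using x_Q[OF that] that no by blast
      have xR: "x r \<in> Q" if "r \<in> R" for r using x_R[OF that] that no by blast
      have inj: "inj_on x A" for A using permutes_inj[OF xper] inj_on_subset by blast
      have imQ: "x ` Q = R" using xQ finPQRS card_R card_image[OF inj] by (intro card_subset_eq) auto
      have imR: "x ` R = Q" using xR finPQRS card_R card_image[OF inj] by (intro card_subset_eq) auto
      have xP: "x p \<in> P" if p: "p \<in> P" for p
      proof -
        have "x p \<notin> R"
        proof
          assume "x p \<in> R"
          then obtain q where "q \<in> Q" "x p = x q" using imQ by auto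
          then show False using x_inj p disjPQRS by auto
        qed
        then show ?thesis using x_P[OF p] by blast
      qed
      have xS: "x p \<in> S" if p: "p \<in> S" for p
      proof -
        have "x p \<notin> Q"
        proof
          assume "x p \<in> Q"
          then obtain q where "q \<in> R" "x p = x q" using imR by auto
          then show False using x_inj p disjPQRS by auto
        qed
        then show ?thesis using x_S[OF p] by blast
      qed
      obtain p where p: "p \<in> P" using P2 by fastforce
      show ?thesis
      proof (cases "card Q = 2")
        case False
        then show ?thesis using good_three_crossing[OF ev _ _ p xQ xR] t2 K6 by simp
      next
        case Q2: True
        show ?thesis
        proof (cases "\<exists>w\<in>P \<union> S. x w \<noteq> w")
          case True
          then show ?thesis using good_two_crossing[OF ev _ Q2 xP xS xQ xR] K6 by auto
        next
          case False
          then have fP: "\<And>p. p \<in> P \<Longrightarrow> x p = p" and fS: "\<And>p. p \<in> S \<Longrightarrow> x p = p" by blast+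
          show ?thesis
          proof (cases "card L = 3")
            case False
            then show ?thesis using good_four_moved[OF ev _ _ Q2 fP fS xQ xR] L3 K6 by simp
          next
            case True
            obtain r r' where Re: "R = {r, r'}" "r \<noteq> r'" using card_R Q2 by (metis card_2_iff)
            have "card S = 1" using True card_L Q2 by simp
            then obtain s where S: "S = {s}" by (metis card_1_singletonE)
            have "odd (card K)" using ev True cU by simp
            moreover have "L = {r, s, r'}" using L_eq Re S by auto
            moreover have "distinct [r, s, r']" using Re S disjPQRS by auto
            moreover have "x r \<in> K" "x r' \<in> K" using xR Re K_eq by auto
            ultimately show ?thesis using good_fixed_in_L[of r s r'] fS S by blast
          qed
        qed
      qed
    qed
  qed
qed

theorem (in two_parts) good_if_moved:
  assumes gc: "1 < gcd (card K) (card L)" and KL: "card L < card K" and xK: "x ` K \<noteq> K"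
    and ntr: "\<And>a b. a \<in> K \<Longrightarrow> b \<in> L \<Longrightarrow> x \<noteq> transpose a b"
  shows "good K L x"
proof -
  define d where "d = gcd (card K) (card L)"
  have d: "1 < d" "d dvd card K" "d dvd card L" using gc unfolding d_def by auto
  then have "d dvd card K - card L" using KL by (simp add: dvd_diff_nat)
  then have dKL: "card L + d \<le> card K" using KL dvd_imp_le[of d "card K - card L"] by simp
  have cU: "card U = card K + card L" using fin disj by (simp add: card_Un_disjoint)
  have "0 < card L"
  proof (rule ccontr)
    assume "\<not> ?thesis"
    then have "L = {}" using fin by simp
    then have "x ` K = K" using permutes_image[OF xper] by simp
    then show False using xK by simp
  qed
  then have dL: "d \<le> card L" using d dvd_imp_le by blast
  have Q: "Q \<noteq> {}"
  proof
    assume "Q = {}"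
    then have "K \<subseteq> x ` K" unfolding Q_def by blast
    moreover have "card (x ` K) = card K" using permutes_inj[OF xper] by (simp add: card_image inj_on_subset)
    ultimately show False using xK fin card_seteq[of "x ` K" K] by auto
  qed
  show ?thesis
  proof (cases "even (card U)")
    case True
    show ?thesis
    proof (cases "card L = 2")
      case False
      then show ?thesis using good_even[OF True gc _ KL Q ntr] d dL by simp
    next
      case L2: True
      have "even (card K)" using True cU L2 by simp
      then show ?thesis using good_even_two[OF L2 _ _ Q ntr] KL L2 by simp
    qed
  next
    case False
    \<comment> \<open>The gcd divides the degree, so an odd degree forces it to be at least 3; then
      \<open>L\<close> has three points and \<open>K\<close> at least three more.\<close>
    have "d \<noteq> 2"
    proof
      assume "d = 2"
      then show False using d False cU by simp
    qed
    then have "3 \<le> d" using d by simp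
    then show ?thesis using good_odd[OF False _ _ Q ntr] dL dKL by simp
  qed
qed

section \<open>Pairs that do not generate\<close>

text \<open>A coclique containing \<open>M\<close> cannot contain a vertex outside \<open>C\<close>,
  since that vertex has a neighbour in \<open>M\<close>. So \<open>C\<close> is the largest coclique
  containing \<open>M\<close>, which yields maximality and uniqueness at once.\<close>

lemma unique_maximal_cocliqueI:
  assumes C: "C \<subseteq> gen_graph_verts G" and M: "M - {\<one>\<^bsub>G\<^esub>} \<subseteq> C"
    and indep: "\<And>x y. x \<in> C \<Longrightarrow> y \<in> C \<Longrightarrow> x \<noteq> y \<Longrightarrow> generate G {x, y} \<noteq> carrier G"
    and adj: "\<And>x. x \<in> gen_graph_verts G \<Longrightarrow> x \<notin> C \<Longrightarrow>
      \<exists>m\<in>M. m \<in> gen_graph_verts G \<and> m \<noteq> x \<and> generate G {x, m} = carrier G"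
  shows "unique_maximal_coclique_containing G M C"
proof -
  have "{x, y} \<notin> gen_graph_edges G" if "x \<in> C" "y \<in> C" for x y
    using indep[OF that] indep[OF that(2,1)] unfolding gen_graph_edges_def
    by (auto simp: doubleton_eq_iff)
  then have coC: "gen_graph_coclique G C" using C unfolding gen_graph_coclique_def by blast
  have sub: "D \<subseteq> C" if D: "gen_graph_coclique G D" "M - {\<one>\<^bsub>G\<^esub>} \<subseteq> D" for D
  proof
    fix x assume x: "x \<in> D"
    show "x \<in> C"
    proof (rule ccontr)
      assume "x \<notin> C"
      moreover have xv: "x \<in> gen_graph_verts G" using D x unfolding gen_graph_coclique_def by blast
      ultimately obtain m where m: "m \<in> M" "m \<in> gen_graph_verts G" "m \<noteq> x" "generate G {x, m} = carrier G"
        using adj by blast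
      then have "m \<in> D" using D(2) unfolding gen_graph_verts_def by blast
      moreover have "{x, m} \<in> gen_graph_edges G" unfolding gen_graph_edges_def using m xv by blast
      ultimately show False using D x unfolding gen_graph_coclique_def by blast
    qed
  qed
  then have "gen_graph_maximal_coclique G C"
    using coC M unfolding gen_graph_maximal_coclique_def by blast
  moreover have "D = C" if "gen_graph_maximal_coclique G D" "M - {\<one>\<^bsub>G\<^esub>} \<subseteq> D" for D
    using that sub[of D] coC unfolding gen_graph_maximal_coclique_def by blast
  ultimately show ?thesis
    using M unfolding unique_maximal_coclique_containing_def coclique_contains_subgroup_def by blast
qed

section \<open>Closed sets and the subgroup \<open>generate\<close>\<close>

lemma generate_subset_perm_closed:
  assumes G: "G = sym_group n \<or> G = alt_group n" and X: "X \<subseteq> carrier G"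
    and H: "perm_closed H" "X \<subseteq> H"
  shows "generate G X \<subseteq> H"
proof
  fix h assume "h \<in> generate G X"
  then show "h \<in> H"
  proof induction
    case one then show ?case using G perm_closedD(1)[OF H(1)] by (metis sym_group_one alt_group_one)
  next
    case (incl h) then show ?case using H by blast
  next
    case (inv h)
    then have "h \<in> carrier G" "h \<in> H" using X H by auto
    then show ?case using G perm_closedD(3)[OF H(1)] by (auto simp: alt_group_inv_equality)
  next
    case (eng a b)
    then show ?case using G perm_closedD(2)[OF H(1)] by (metis sym_group_mult alt_group_mult)
  qed
qed

lemma perm_closed_generate:
  assumes G: "G = sym_group n \<or> G = alt_group n" and X: "X \<subseteq> carrier G"
  shows "perm_closed (generate G X)"
proof -
  have gr: "group G" using G sym_group_is_group alt_group_is_group by blast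
  have in_car: "h \<in> carrier G" if "h \<in> generate G X" for h
    using that group.generate_in_carrier[OF gr X] by blast
  have "id \<in> generate G X" using generate.one[of G X] G by (auto simp: sym_group_one alt_group_one)
  moreover have "a \<circ> b \<in> generate G X" if "a \<in> generate G X" "b \<in> generate G X" for a b
    using generate.eng[OF that] G by (auto simp: sym_group_mult alt_group_mult)
  moreover have "inv' a \<in> generate G X" if a: "a \<in> generate G X" for a
    using group.generate_m_inv_closed[OF gr X a] in_car[OF a] G by (auto simp: alt_group_inv_equality)
  ultimately show ?thesis unfolding perm_closed_def by blast
qed

lemma generate_sym_group_iff:
  assumes "x \<in> carrier (sym_group n)" "y \<in> carrier (sym_group n)"
  shows "generate (sym_group n) {x, y} = carrier (sym_group n) \<longleftrightarrow> generates_sym {1..n} {x, y}"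
proof
  assume gen: "generate (sym_group n) {x, y} = carrier (sym_group n)"
  have "carrier (sym_group n) \<subseteq> H" if "perm_closed H" "{x, y} \<subseteq> H" for H
    using generate_subset_perm_closed[of "sym_group n" n "{x, y}" H] assms that gen by simp
  then show "generates_sym {1..n} {x, y}"
    unfolding generates_sym_def using sym_group_carrier by blast
next
  assume gen: "generates_sym {1..n} {x, y}"
  have "perm_closed (generate (sym_group n) {x, y})"
    using perm_closed_generate[of "sym_group n" n "{x, y}"] assms by simp
  moreover have "{x, y} \<subseteq> generate (sym_group n) {x, y}"
    using generate.incl[of _ "{x, y}" "sym_group n"] by blast
  ultimately have "carrier (sym_group n) \<subseteq> generate (sym_group n) {x, y}"
    using gen sym_group_carrier unfolding generates_sym_def by blast
  moreover have "generate (sym_group n) {x, y} \<subseteq> carrier (sym_group n)"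
    using group.generate_incl[OF sym_group_is_group, of "{x, y}"] assms by simp
  ultimately show "generate (sym_group n) {x, y} = carrier (sym_group n)" by blast
qed

lemma generate_alt_group_iff:
  assumes "x \<in> carrier (alt_group n)" "y \<in> carrier (alt_group n)"
  shows "generate (alt_group n) {x, y} = carrier (alt_group n) \<longleftrightarrow> generates_alt {1..n} {x, y}"
proof
  assume gen: "generate (alt_group n) {x, y} = carrier (alt_group n)"
  have "carrier (alt_group n) \<subseteq> H" if "perm_closed H" "{x, y} \<subseteq> H" for H
    using generate_subset_perm_closed[of "alt_group n" n "{x, y}" H] assms that gen by simp
  then show "generates_alt {1..n} {x, y}"
    unfolding generates_alt_def using alt_group_carrier by blast
next
  assume gen: "generates_alt {1..n} {x, y}"
  have "perm_closed (generate (alt_group n) {x, y})"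
    using perm_closed_generate[of "alt_group n" n "{x, y}"] assms by simp
  moreover have "{x, y} \<subseteq> generate (alt_group n) {x, y}"
    using generate.incl[of _ "{x, y}" "alt_group n"] by blast
  ultimately have "carrier (alt_group n) \<subseteq> generate (alt_group n) {x, y}"
    using gen alt_group_carrier unfolding generates_alt_def by blast
  moreover have "generate (alt_group n) {x, y} \<subseteq> carrier (alt_group n)"
    using group.generate_incl[OF alt_group_is_group, of "{x, y}"] assms by simp
  ultimately show "generate (alt_group n) {x, y} = carrier (alt_group n)" by blast
qed

section \<open>Obstructions to generating the alternating group\<close>

lemma generates_sym_imp_alt: "generates_sym U F \<Longrightarrow> generates_alt U F"
  unfolding generates_sym_def generates_alt_def by blast

lemma cyc3_eq_transpose: "distinct [a, b, c] \<Longrightarrow> cyc3 a b c = transpose a b \<circ> transpose b c"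
  by (auto simp: cyc3_def transpose_def fun_eq_iff)

lemma cyc3_permutes:
  assumes "a \<in> U" "b \<in> U" "c \<in> U" "distinct [a, b, c]"
  shows "cyc3 a b c permutes U" "evenperm (cyc3 a b c)"
  unfolding cyc3_eq_transpose[OF assms(4)]
  using assms by (auto intro!: permutes_compose permutes_swap_id simp: evenperm_comp permutation_swap_id evenperm_swap)

lemma ex_not_in:
  assumes "finite A" "card A < card U" shows "\<exists>z\<in>U. z \<notin> A"
  using assms by (meson card_mono linorder_not_less subsetI)

text \<open>Covers invariant subsets as well as block systems.\<close>

lemma not_generates_alt_if_colour:
  fixes col :: "'a \<Rightarrow> 'b"
  assumes per: "\<And>g. g \<in> F \<Longrightarrow> g permutes U" and U: "4 \<le> card U"
    and col: "\<And>g y z. g \<in> F \<Longrightarrow> y \<in> U \<Longrightarrow> z \<in> U \<Longrightarrow> col (g y) = col (g z) \<longleftrightarrow> col y = col z"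
    and abc: "a \<in> U" "b \<in> U" "c \<in> U" "a \<noteq> b" "col a = col b" "col c \<noteq> col a"
  shows "\<not> generates_alt U F"
proof
  assume gen: "generates_alt U F"
  define H where "H = {h. h permutes U \<and> (\<forall>y\<in>U. \<forall>z\<in>U. col (h y) = col (h z) \<longleftrightarrow> col y = col z)}"
  have "inv' h \<in> H" if "h \<in> H" for h
  proof -
    have h: "h permutes U" using that unfolding H_def by blast
    have "col (inv' h y) = col (inv' h z) \<longleftrightarrow> col y = col z" if "y \<in> U" "z \<in> U" for y z
    proof -
      have "\<forall>y\<in>U. \<forall>z\<in>U. col (h y) = col (h z) \<longleftrightarrow> col y = col z" using \<open>h \<in> H\<close> unfolding H_def by blast
      moreover have "inv' h y \<in> U" "inv' h z \<in> U" using that permutes_in_image[OF permutes_inv[OF h]] by auto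
      ultimately have "col (h (inv' h y)) = col (h (inv' h z)) \<longleftrightarrow> col (inv' h y) = col (inv' h z)" by blast
      then show ?thesis using permutes_inverses(1)[OF h] by simp
    qed
    then show ?thesis using permutes_inv[OF h] unfolding H_def by blast
  qed
  moreover have "g \<circ> h \<in> H" if gh: "g \<in> H" "h \<in> H" for g h
  proof -
    have "h z \<in> U" if "z \<in> U" for z using gh that permutes_in_image[of h U] unfolding H_def by blast
    moreover have "g \<circ> h permutes U" using gh permutes_compose unfolding H_def by blast
    ultimately show ?thesis using gh unfolding H_def by simp
  qed
  moreover have "id \<in> H" using permutes_id[of U] unfolding H_def by (auto simp: id_def)
  ultimately have H: "perm_closed H" unfolding perm_closed_def by blast
  have "F \<subseteq> H" using per col unfolding H_def by blast
  \<comment> \<open>A fourth point e makes the even permutation \<open>(b c e)\<close> available: it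
    fixes a and moves b to c, so it separates the equally coloured a and b.\<close>
  have "card {a, b, c} < card U" using U by (simp add: card_insert_if)
  then obtain e where e: "e \<in> U" "e \<notin> {a, b, c}" using ex_not_in[of "{a, b, c}" U] by blast
  have d: "distinct [b, c, e]" using abc e by auto
  then have "cyc3 b c e \<in> H"
    using gen H \<open>F \<subseteq> H\<close> cyc3_permutes[of b U c e] abc e unfolding generates_alt_def by blast
  then have "col (cyc3 b c e a) = col (cyc3 b c e b)" using abc unfolding H_def by auto
  moreover have "cyc3 b c e a = a" "cyc3 b c e b = c" using abc e d by (auto simp: cyc3_def)
  ultimately show False using abc by simp
qed

text \<open>The dihedral situation: each generator inverts the product z, so every element of the
  group commutes with z or inverts it. A suitable 3-cycle does neither.\<close>

lemma not_generates_alt_if_involutions: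
  assumes per: "x permutes U" "y permutes U" and U: "4 \<le> card U"
    and inv: "x \<circ> x = id" "y \<circ> y = id" and ne: "x \<noteq> y"
  shows "\<not> generates_alt U {x, y}"
proof
  assume gen: "generates_alt U {x, y}"
  define z where "z = x \<circ> y"
  have xx: "x (x a) = a" "y (y a) = a" for a using inv by (auto simp: fun_eq_iff)
  have iz: "inv' z = y \<circ> x" unfolding z_def by (rule inv_unique_comp) (auto simp: fun_eq_iff xx)
  have zU: "z permutes U" unfolding z_def using per permutes_compose by blast
  define H where "H = {h. h permutes U \<and> (h \<circ> z = z \<circ> h \<or> h \<circ> z = inv' z \<circ> h)}"
  have zz: "z (inv' z a) = a" "inv' z (z a) = a" for a using permutes_inverses[OF zU] by auto
  have flip: "h \<circ> inv' z = (if h \<circ> z = z \<circ> h then inv' z \<circ> h else z \<circ> h)" if "h \<in> H" for h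
  proof -
    have "h \<circ> z = z \<circ> h \<Longrightarrow> h (inv' z a) = inv' z (h a)" for a
      using zz by (metis comp_apply)
    moreover have "h \<circ> z = inv' z \<circ> h \<Longrightarrow> h (inv' z a) = z (h a)" for a
      using zz by (metis comp_apply)
    ultimately show ?thesis using that unfolding H_def by (auto simp: fun_eq_iff)
  qed
  have "g \<circ> h \<in> H" if "g \<in> H" "h \<in> H" for g h
  proof -
    have "g \<circ> h permutes U" using that permutes_compose unfolding H_def by blast
    moreover have "h \<circ> z = z \<circ> h \<or> h \<circ> z = inv' z \<circ> h" using that unfolding H_def by blast
    then have "g \<circ> h \<circ> z = z \<circ> (g \<circ> h) \<or> g \<circ> h \<circ> z = inv' z \<circ> (g \<circ> h)"
    proof
      assume h: "h \<circ> z = z \<circ> h"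
      have "g \<circ> z = z \<circ> g \<or> g \<circ> z = inv' z \<circ> g" using that unfolding H_def by blast
      moreover have "g \<circ> h \<circ> z = (g \<circ> z) \<circ> h" by (simp only: comp_assoc h)
      ultimately show ?thesis by (elim disjE) (simp_all only: comp_assoc simp_thms)
    next
      assume h: "h \<circ> z = inv' z \<circ> h"
      have "g \<circ> inv' z = inv' z \<circ> g \<or> g \<circ> inv' z = z \<circ> g" using flip[OF that(1)] by presburger
      moreover have "g \<circ> h \<circ> z = (g \<circ> inv' z) \<circ> h" by (simp only: comp_assoc h)
      ultimately show ?thesis by (elim disjE) (simp_all only: comp_assoc simp_thms)
    qed
    ultimately show ?thesis unfolding H_def by blast
  qed
  moreover have "inv' h \<in> H" if hH: "h \<in> H" for h
  proof -
    have h: "h permutes U" using hH unfolding H_def by blast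
    have hh: "h (inv' h a) = a" "inv' h (h a) = a" for a using permutes_inverses[OF h] by auto
    have "h \<circ> z = z \<circ> h \<or> h \<circ> z = inv' z \<circ> h" using hH unfolding H_def by blast
    then have "inv' h \<circ> z = z \<circ> inv' h \<or> inv' h \<circ> z = inv' z \<circ> inv' h"
    proof
      assume *: "h \<circ> z = z \<circ> h"
      have "inv' h (z a) = z (inv' h a)" for a using * hh by (metis comp_apply)
      then show ?thesis by (auto simp: fun_eq_iff)
    next
      assume "h \<circ> z = inv' z \<circ> h"
      then have "z (h (z a)) = h a" for a using zz by (metis comp_apply)
      then have "inv' h (z a) = inv' z (inv' h a)" for a using hh zz by metis
      then show ?thesis by (auto simp: fun_eq_iff)
    qed
    then show ?thesis using permutes_inv[OF h] unfolding H_def by blast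
  qed
  moreover have "id \<in> H" using permutes_id[of U] unfolding H_def by (auto simp: id_def fun_eq_iff)
  ultimately have H: "perm_closed H" unfolding perm_closed_def by blast
  have "x \<circ> z = inv' z \<circ> x" "y \<circ> z = inv' z \<circ> y"
    unfolding iz by (auto simp: z_def fun_eq_iff xx)
  then have xyH: "{x, y} \<subseteq> H" using per unfolding H_def by blast
  obtain p where "x p \<noteq> y p" using ne by (metis ext)
  then have "z (y p) \<noteq> y p" unfolding z_def by (simp add: xx)
  then obtain a where a: "z a \<noteq> a" by blast
  then have aU: "a \<in> U" "z a \<in> U" using permutes_not_in[OF zU] permutes_in_image[OF zU] by blast+
  define b where "b = z a"
  \<comment> \<open>The 3-cycle \<open>(b c e)\<close> will fix a and send \<open>z a\<close>, which
    is b, to c. Commuting with z would require c to be b, and inverting z would require c to be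
    \<open>inv' z a\<close>; both are avoided here.\<close>
  have "card {a, b, inv' z a} < card U" using U by (simp add: card_insert_if)
  then obtain c where c: "c \<in> U" "c \<notin> {a, b, inv' z a}" using ex_not_in[of "{a, b, inv' z a}" U] by blast
  have "card {a, b, c} < card U" using U by (simp add: card_insert_if)
  then obtain e where e: "e \<in> U" "e \<notin> {a, b, c}" using ex_not_in[of "{a, b, c}" U] by blast
  have d: "distinct [b, c, e]" using c e by auto
  then have "cyc3 b c e \<in> H"
    using gen H xyH cyc3_permutes[of b U c e] aU c e unfolding generates_alt_def b_def by blast
  then have "cyc3 b c e (z a) = z (cyc3 b c e a) \<or> cyc3 b c e (z a) = inv' z (cyc3 b c e a)"
    unfolding H_def by (auto simp: fun_eq_iff)
  moreover have "cyc3 b c e a = a" "cyc3 b c e (z a) = c" using a c e d by (auto simp: cyc3_def b_def)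
  ultimately show False using c b_def by auto
qed

text \<open>Membership in \<open>D\<close> is the colouring. Two points of equal colour are found
  inside \<open>D\<close>, or outside it when \<open>D\<close> is a singleton.\<close>

lemma not_generates_alt_if_invariant:
  assumes per: "\<And>g. g \<in> F \<Longrightarrow> g permutes U" and U: "4 \<le> card U"
    and D: "D \<subseteq> U" "\<And>g. g \<in> F \<Longrightarrow> g ` D \<subseteq> D" and a: "a \<in> D" and c: "c \<in> U" "c \<notin> D"
  shows "\<not> generates_alt U F"
proof -
  have "finite D" using D U by (metis card.infinite finite_subset not_numeral_le_zero)
  have mem: "g y \<in> D \<longleftrightarrow> y \<in> D" if "g \<in> F" for g y
    by (rule closed_mem_iff[OF per[OF that] \<open>finite D\<close> D(2)[OF that]])
  have *: "(g y \<in> D) = (g z \<in> D) \<longleftrightarrow> (y \<in> D) = (z \<in> D)" if "g \<in> F" for g y z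
    using mem[OF that] by blast
  show ?thesis
  proof (cases "\<exists>b\<in>D. b \<noteq> a")
    case True
    then obtain b where "b \<in> D" "b \<noteq> a" by blast
    then show ?thesis
      using not_generates_alt_if_colour[of F U "\<lambda>z. z \<in> D" a b c, OF per U *] a c D by blast
  next
    case False
    have "card {a, c} < card U" using U by (simp add: card_insert_if)
    then obtain e where "e \<in> U" "e \<notin> {a, c}" using ex_not_in[of "{a, c}" U] by blast
    then show ?thesis
      using not_generates_alt_if_colour[of F U "\<lambda>z. z \<in> D" c e a, OF per U *] a c D False by blast
  qed
qed

text \<open>If \<open>m\<close> has a single cycle on each of the two parts, label the points \<open>m^i a\<close> and \<open>m^i b\<close> by
  \<open>i\<close> modulo the gcd of the two cycle lengths: \<open>m\<close> shifts the labels and \<open>transpose a b\<close>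
  preserves them.\<close>

lemma not_generates_alt_stabilizer_transpose:
  assumes fin: "finite K" "finite L" and disj: "K \<inter> L = {}" and gc: "1 < gcd (card K) (card L)"
    and U: "4 \<le> card (K \<union> L)" and m: "m permutes (K \<union> L)" "m ` K = K" and ab: "a \<in> K" "b \<in> L"
  shows "\<not> generates_alt (K \<union> L) {m, transpose a b}"
proof (cases "\<exists>c\<in>K \<union> L. c \<notin> range (\<lambda>i. (m ^^ i) a) \<union> range (\<lambda>i. (m ^^ i) b)")
  case True
  \<comment> \<open>If the two orbits under \<open>m\<close> do not cover everything, their union is
    invariant under \<open>m\<close>, and under the transposition too since it contains both a and
    b.\<close>
  define D where "D = range (\<lambda>i. (m ^^ i) a) \<union> range (\<lambda>i. (m ^^ i) b)"
  have mm: "m ((m ^^ i) c) = (m ^^ Suc i) c" for i c by simp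
  have mD: "m ` D \<subseteq> D" unfolding D_def image_Un image_image mm by blast
  have aD: "a \<in> D" "b \<in> D" unfolding D_def by (auto intro: range_eqI[of _ _ 0])
  then have tD: "transpose a b ` D \<subseteq> D" by (auto simp: transpose_def)
  have "(m ^^ i) z \<in> K \<union> L \<longleftrightarrow> z \<in> K \<union> L" for i z
    using permutes_in_image[OF funpow_permutes[OF m(1)]] .
  then have "D \<subseteq> K \<union> L" unfolding D_def using ab by blast
  moreover have "transpose a b permutes (K \<union> L)" using ab by (simp add: permutes_swap_id)
  moreover obtain c where "c \<in> K \<union> L" "c \<notin> D" using True unfolding D_def by blast
  ultimately show ?thesis
    using not_generates_alt_if_invariant[of "{m, transpose a b}" "K \<union> L" D a c] U m aD mD tD by blast
next
  case False
  define d where "d = gcd (card K) (card L)"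
  have d: "1 < d" "d dvd card K" "d dvd card L" using gc unfolding d_def by auto
  have fU: "finite (K \<union> L)" using fin by blast
  have mL: "m ` L = L" using permutes_image_compl[OF m(1) disj m(2)] .
  have powK: "(m ^^ i) a \<in> K" for i using ab m(2) by (induction i) auto
  have powL: "(m ^^ i) b \<in> L" for i using ab mL by (induction i) auto
  have ex: "\<exists>i. z = (m ^^ i) a \<or> z = (m ^^ i) b" if "z \<in> K \<union> L" for z using False that by blast
  have K: "\<exists>i. z = (m ^^ i) a" if "z \<in> K" for z
    using ex[of z] that powL disj by (metis UnI1 disjoint_iff)
  have L: "\<exists>i. z = (m ^^ i) b" if "z \<in> L" for z
    using ex[of z] that powK disj by (metis UnI2 disjoint_iff)
  have cyc: "cyc_on m W"
    if "finite W" "m ` W = W" "c \<in> W" and orb: "\<And>z. z \<in> W \<Longrightarrow> \<exists>i. z = (m ^^ i) c" for W c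
    unfolding cyc_on_def
  proof (intro conjI allI impI)
    fix D assume D: "D \<subseteq> W" "D \<noteq> {}" "m ` D \<subseteq> D"
    have pw: "(m ^^ i) z \<in> D \<longleftrightarrow> z \<in> D" for i z
      by (induction i) (use closed_mem_iff[OF m(1) finite_subset[OF D(1) that(1)] D(3)] in auto)
    obtain z where "z \<in> D" using D by blast
    then have "c \<in> D" using orb D pw by blast
    then have "W \<subseteq> D" using orb pw by blast
    then show "D = W" using D by blast
  qed (use that in simp)
  have cyK: "cyc_on m K" using cyc[OF fin(1) m(2) ab(1) K] .
  have cyL: "cyc_on m L" using cyc[OF fin(2) mL ab(2) L] .
  \<comment> \<open>Labels are well defined: exponents reaching the same point differ by a multiple
    of the cycle length, which d divides.\<close>
  have uniq: "i mod d = j mod d"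
    if "cyc_on m W" "finite W" "d dvd card W" "c \<in> W" "(m ^^ i) c = (m ^^ j) c" for W c i j
  proof -
    have *: "i mod d = j mod d" if ij: "i \<le> j" "(m ^^ i) c = (m ^^ j) c" "cyc_on m W" "finite W" "d dvd card W" "c \<in> W" for i j
    proof -
      have "(m ^^ j) c = (m ^^ i) ((m ^^ (j - i)) c)"
        using ij by (metis funpow_add o_apply le_add_diff_inverse)
      then have "(m ^^ (j - i)) c = c"
        using ij permutes_inj[OF funpow_permutes[OF m(1)]] by (metis inj_eq)
      then have "card W dvd j - i" using cyc_on_funpow_eq_iff[OF ij(3) m(1) fU ij(4,6)] by blast
      then have "d dvd j - i" using dvd_trans[OF ij(5)] by simp
      then show ?thesis using mod_eq_dvd_iff_nat[OF ij(1), of d] by simp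
    qed
    show ?thesis
    proof (cases "i \<le> j")
      case True
      show ?thesis by (rule *[OF True that(5,1-4)])
    next
      case False
      then have "j \<le> i" by simp
      then show ?thesis by (rule *[OF _ that(5)[symmetric] that(1-4), symmetric])
    qed
  qed
  define col where "col z = (SOME i. z = (m ^^ i) a \<or> z = (m ^^ i) b) mod d" for z
  have colI: "col z = i mod d" if z: "z = (m ^^ i) a \<or> z = (m ^^ i) b" for z i
  proof -
    define j where "j = (SOME i. z = (m ^^ i) a \<or> z = (m ^^ i) b)"
    have j: "z = (m ^^ j) a \<or> z = (m ^^ j) b" unfolding j_def by (rule someI[of _ i]) (rule z)
    have "j mod d = i mod d"
      using z
    proof
      assume "z = (m ^^ i) a"
      moreover from this have "z = (m ^^ j) a" using j powK powL disj by (metis disjoint_iff)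
      ultimately show ?thesis using uniq[OF cyK fin(1) d(2) ab(1), of j i] by simp
    next
      assume "z = (m ^^ i) b"
      moreover from this have "z = (m ^^ j) b" using j powK powL disj by (metis disjoint_iff)
      ultimately show ?thesis using uniq[OF cyL fin(2) d(3) ab(2), of j i] by simp
    qed
    then show ?thesis unfolding col_def j_def .
  qed
  have colm: "col (m z) = Suc (col z) mod d" if zU: "z \<in> K \<union> L" for z
  proof -
    obtain i where i: "z = (m ^^ i) a \<or> z = (m ^^ i) b" using ex[OF zU] by blast
    then have "m z = (m ^^ Suc i) a \<or> m z = (m ^^ Suc i) b" by auto
    then show ?thesis using colI[of "m z" "Suc i"] colI[OF i] by (simp add: mod_Suc_eq)
  qed
  have lt: "col z < d" for z unfolding col_def using d by simp
  have cola: "col a = 0" "col b = 0" using colI[of a 0] colI[of b 0] by auto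
  have colt: "col (transpose a b z) = col z" for z using cola by (auto simp: transpose_def)
  have sh: "Suc p mod d = Suc q mod d \<longleftrightarrow> p = q" if "p < d" "q < d" for p q
    using that by (auto simp: mod_Suc split: if_splits)
  \<comment> \<open>A second colour exists because d exceeds 1; the equally coloured pair is a, b
    with label 0.\<close>
  have col1: "col (m a) = 1" using colm[of a] cola ab d by simp
  have t: "transpose a b permutes (K \<union> L)" using ab by (simp add: permutes_swap_id)
  show ?thesis
  proof (rule not_generates_alt_if_colour[of _ _ col a b "m a"])
    show "g permutes (K \<union> L)" if "g \<in> {m, transpose a b}" for g using that m(1) t by auto
    show "col (g y) = col (g z) \<longleftrightarrow> col y = col z"
      if g: "g \<in> {m, transpose a b}" and yz: "y \<in> K \<union> L" "z \<in> K \<union> L" for g y z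
    proof (cases "g = m")
      case True
      then show ?thesis using colm[OF yz(1)] colm[OF yz(2)] sh[OF lt lt] by simp
    next
      case False
      then show ?thesis using g colt by simp
    qed
    show "m a \<in> K \<union> L" using cyc_on_closed[OF cyK ab(1)] by simp
    show "a \<noteq> b" using ab disj by blast
  qed (use ab cola col1 U in auto)
qed

section \<open>The intransitive subgroup of the symmetric group\<close>

lemma set_stabilizer_sym: "g \<in> set_stabilizer (sym_group n) k \<longleftrightarrow> g permutes {1..n} \<and> g ` {1..k} = {1..k}"
  unfolding set_stabilizer_def stabilizer_def by (auto simp: sym_group_carrier)

lemma set_stabilizer_alt:
  "g \<in> set_stabilizer (alt_group n) k \<longleftrightarrow> g permutes {1..n} \<and> evenperm g \<and> g ` {1..k} = {1..k}"
  unfolding set_stabilizer_def stabilizer_def by (auto simp: alt_group_carrier)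

text \<open>Conjugation by \<open>m\<close> moves both entries by \<open>inv' m\<close>, which
  stabilises \<open>{1..k}\<close>. Conversely swapping a with 1 and b with k + 1 gives an element
  of the stabiliser that realises any pair.\<close>

lemma conjugates_transpose:
  assumes k: "1 \<le> k" "k < n"
  shows "conjugates_by (sym_group n) (transpose 1 (k + 1)) (set_stabilizer (sym_group n) k) =
    {transpose a b | a b. a \<in> {1..k} \<and> b \<in> {k + 1..n}}" (is "?X = ?T")
proof
  have conj: "inv\<^bsub>sym_group n\<^esub> m \<otimes>\<^bsub>sym_group n\<^esub> transpose p q \<otimes>\<^bsub>sym_group n\<^esub> m = transpose (inv' m p) (inv' m q)"
    if "m permutes {1..n}" for m p q
    using transpose_conj[OF permutes_bij[OF permutes_inv[OF that]], of p q] permutes_inv_inv[OF that] that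
    by (simp add: sym_group_mult sym_group_carrier)
  show "?X \<subseteq> ?T"
  proof
    fix g assume "g \<in> ?X"
    then obtain m where m: "m permutes {1..n}" "m ` {1..k} = {1..k}"
      "g = transpose (inv' m 1) (inv' m (k + 1))"
      unfolding conjugates_by_def using conj set_stabilizer_sym by fastforce
    have "m z \<in> {1..k} \<longleftrightarrow> z \<in> {1..k}" for z
      by (rule closed_mem_iff[OF m(1)]) (use m(2) in auto)
    from this[of "inv' m 1"] this[of "inv' m (k + 1)"]
    have "inv' m 1 \<in> {1..k}" "inv' m (k + 1) \<notin> {1..k}"
      using permutes_inverses(1)[OF m(1)] k by auto
    moreover have "inv' m (k + 1) \<in> {1..n}" using permutes_in_image[OF permutes_inv[OF m(1)]] k by simp
    ultimately have "inv' m (k + 1) \<in> {k + 1..n}" by auto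
    then show "g \<in> ?T" using m(3) \<open>inv' m 1 \<in> {1..k}\<close> by blast
  qed
  show "?T \<subseteq> ?X"
  proof
    fix g assume "g \<in> ?T"
    then obtain a b where ab: "a \<in> {1..k}" "b \<in> {k + 1..n}" "g = transpose a b" by blast
    have t1: "transpose a 1 permutes {1..k}" and t2: "transpose b (k + 1) permutes {k + 1..n}"
      using ab k by (auto intro: permutes_swap_id)
    have dis: "{1..k} \<inter> {k + 1..n} = {}" by auto
    define m where "m = transpose a 1 \<circ> transpose b (k + 1)"
    note m = permutes_comp_disjoint[OF t1 t2 dis, folded m_def]
    have "{1..k} \<union> {k + 1..n} = {1..n}" using k by auto
    then have mn: "m permutes {1..n}" using m(1) by simp
    have "m ` {1..k} = {1..k}" using m(2) permutes_image[OF t1] by (metis image_cong)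
    then have "m \<in> set_stabilizer (sym_group n) k" using mn set_stabilizer_sym by blast
    moreover have "m a = 1" "m b = k + 1" using m(2)[of a] m(3)[of b] ab by auto
    then have "inv' m 1 = a" "inv' m (k + 1) = b" using permutes_inv_eq[OF mn] by auto
    then have "g = inv\<^bsub>sym_group n\<^esub> m \<otimes>\<^bsub>sym_group n\<^esub> transpose 1 (k + 1) \<otimes>\<^bsub>sym_group n\<^esub> m"
      using conj[OF mn, of 1 "k + 1"] ab(3) by simp
    ultimately show "g \<in> ?X"
      unfolding conjugates_by_def by blast
  qed
qed

text \<open>The identity is no vertex, so it must be ruled out as the neighbour found. Everything
  generated by \<open>x\<close> alone commutes with \<open>x\<close>, whereas a transposition moving
  \<open>x a\<close> and fixing a does not.\<close>

lemma commuting_not_generates_sym: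
  assumes x: "x permutes U" "x \<noteq> id" and U: "3 \<le> card U"
  shows "\<not> generates_sym U {x, id}"
proof
  assume gen: "generates_sym U {x, id}"
  define H where "H = {h. h permutes U \<and> h \<circ> x = x \<circ> h}"
  have "inv' h \<in> H" if "h \<in> H" for h
  proof -
    have h: "h permutes U" "\<And>a. h (x a) = x (h a)" using that unfolding H_def by (auto simp: fun_eq_iff)
    have "inv' h (x a) = x (inv' h a)" for a using permutes_inverses[OF h(1)] h(2) by metis
    then show ?thesis using permutes_inv[OF h(1)] unfolding H_def by (auto simp: fun_eq_iff)
  qed
  moreover have "g \<circ> h \<in> H" if "g \<in> H" "h \<in> H" for g h
    using that permutes_compose[of h U g] unfolding H_def by (auto simp: fun_eq_iff)
  moreover have "id \<in> H" using permutes_id[of U] unfolding H_def by (auto simp: id_def)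
  ultimately have "perm_closed H" "{x, id} \<subseteq> H" using x unfolding perm_closed_def H_def by auto
  then have H: "p \<in> H" if "p permutes U" for p using gen that unfolding generates_sym_def by blast
  obtain a where a: "x a \<noteq> a" using x by (metis ext id_apply)
  then have aU: "a \<in> U" "x a \<in> U" using permutes_not_in[OF x(1)] permutes_in_image[OF x(1)] by blast+
  have "card {a, x a} < card U" using U a by simp
  then obtain c where c: "c \<in> U" "c \<notin> {a, x a}" using ex_not_in[of "{a, x a}" U] by blast
  have "transpose (x a) c \<in> H" using H[OF permutes_swap_id[OF aU(2) c(1)]] .
  then have "transpose (x a) c \<circ> x = x \<circ> transpose (x a) c" unfolding H_def by blast
  from fun_cong[OF this, of a] have "transpose (x a) c (x a) = x (transpose (x a) c a)" by simp
  moreover have "transpose (x a) c a = a" using a c by (auto simp: transpose_def)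
  ultimately show False using c by simp
qed

lemma sym_group_coclique:
  fixes n k :: nat
  assumes n: "4 \<le> n" and kn: "k < n" "n < 2 * k" and gc: "1 < gcd n k"
  defines "M \<equiv> set_stabilizer (sym_group n) k"
  shows "unique_maximal_coclique_containing (sym_group n) M
    ((M \<union> conjugates_by (sym_group n) (transpose 1 (k + 1)) M) - {\<one>\<^bsub>sym_group n\<^esub>})"
proof -
  define K L where "K = {1..k}" and "L = {k + 1..n}"
  define X where "X = {transpose a b | a b. a \<in> K \<and> b \<in> L}"
  have "1 \<le> k" using kn by simp
  then have X: "conjugates_by (sym_group n) (transpose 1 (k + 1)) M = X"
    unfolding M_def X_def K_def L_def using conjugates_transpose[of k n] kn by blast
  have U: "{1..n} = K \<union> L" unfolding K_def L_def using kn by auto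
  have disj: "K \<inter> L = {}" and fin: "finite K" "finite L" unfolding K_def L_def by auto
  have card: "card K = k" "card L = n - k" unfolding K_def L_def by auto
  have cU: "card (K \<union> L) = n" using U by (metis card_atLeastAtMost diff_Suc_1)
  have "gcd k (n - k) = gcd n k" using kn by (metis gcd.commute gcd_diff1_nat less_imp_le_nat)
  then have gKL: "1 < gcd (card K) (card L)" using gc card by simp
  have KL: "card L < card K" using card kn by simp
  \<comment> \<open>Degree 4 would mean k = 3 with gcd 1. The degree is thus at least 5, so two
    transpositions always leave a common fixed point.\<close>
  have "n \<noteq> 4"
  proof
    assume "n = 4"
    then have "k = 3" using kn by simp
    then have "gcd n k = 1" using \<open>n = 4\<close> by (simp add: gcd_non_0_nat)
    then show False using gc by simp
  qed
  then have n5: "5 \<le> n" using n by simp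
  have mem: "g \<in> carrier (sym_group n) \<longleftrightarrow> g permutes K \<union> L" for g
    using sym_group_carrier[of g n] unfolding U .
  have M: "g \<in> M \<longleftrightarrow> g permutes K \<union> L \<and> g ` K = K" for g
    unfolding M_def using set_stabilizer_sym[of g n k] U unfolding K_def by simp
  have XU: "g permutes K \<union> L" if "g \<in> X" for g using that unfolding X_def by (auto intro: permutes_swap_id)
  have verts: "g \<in> gen_graph_verts (sym_group n) \<longleftrightarrow> g permutes K \<union> L \<and> g \<noteq> id" for g
    unfolding gen_graph_verts_def using mem by (simp add: sym_group_one)
  have gen: "generate (sym_group n) {x, y} = carrier (sym_group n) \<longleftrightarrow> generates_sym (K \<union> L) {x, y}"
    if "x permutes K \<union> L" "y permutes K \<union> L" for x y
    using generate_sym_group_iff[of x n y] that mem U by simp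
  have "1 \<in> K" "n \<in> L" "n \<notin> K" unfolding K_def L_def using kn by auto
  have MM: "\<not> generates_alt (K \<union> L) {x, y}" if "x \<in> M" "y \<in> M" for x y
    using not_generates_alt_if_invariant[of "{x, y}" "K \<union> L" K 1 n] that M n cU \<open>1 \<in> K\<close> \<open>n \<in> L\<close> \<open>n \<notin> K\<close>
    by auto
  have MX: "\<not> generates_alt (K \<union> L) {x, y}" if xy: "x \<in> M" "y \<in> X" for x y
  proof -
    obtain a b where ab: "a \<in> K" "b \<in> L" "y = transpose a b" using xy unfolding X_def by blast
    have "4 \<le> card (K \<union> L)" using cU n by simp
    then show ?thesis
      using not_generates_alt_stabilizer_transpose[OF fin disj gKL _ _ _ ab(1,2), of x] xy(1) M ab(3) by blast
  qed
  have XX: "\<not> generates_alt (K \<union> L) {x, y}" if xy: "x \<in> X" "y \<in> X" for x y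
  proof -
    obtain a b where ab: "x = transpose a b" "a \<in> K" "b \<in> L" using xy unfolding X_def by blast
    obtain c d where cd: "y = transpose c d" "c \<in> K" "d \<in> L" using xy unfolding X_def by blast
    have "card {a, b, c, d} < card (K \<union> L)" using cU n5 by (simp add: card_insert_if)
    then obtain z where z: "z \<in> K \<union> L" "z \<notin> {a, b, c, d}" using ex_not_in[of "{a, b, c, d}"] by blast
    have "4 \<le> card (K \<union> L)" using cU n by simp
    then show ?thesis
    proof (rule not_generates_alt_if_invariant[of "{x, y}" "K \<union> L" "{z}" z a, rotated])
      show "g permutes K \<union> L" if "g \<in> {x, y}" for g using that XU xy by blast
      show "g ` {z} \<subseteq> {z}" if "g \<in> {x, y}" for g using that z ab cd by auto
    qed (use z ab in auto)
  qed
  show ?thesis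
    unfolding X
  proof (rule unique_maximal_cocliqueI)
    show "M \<union> X - {\<one>\<^bsub>sym_group n\<^esub>} \<subseteq> gen_graph_verts (sym_group n)"
      using verts M XU by (auto simp: sym_group_one)
    fix x y assume "x \<in> M \<union> X - {\<one>\<^bsub>sym_group n\<^esub>}" "y \<in> M \<union> X - {\<one>\<^bsub>sym_group n\<^esub>}"
    then have xy: "x \<in> M \<or> x \<in> X" "y \<in> M \<or> y \<in> X" by auto
    then have "\<not> generates_alt (K \<union> L) {x, y}"
      using MM[of x y] MX[of x y] MX[of y x] XX[of x y] by (metis insert_commute)
    moreover have "x permutes K \<union> L" "y permutes K \<union> L" using xy M XU by auto
    ultimately show "generate (sym_group n) {x, y} \<noteq> carrier (sym_group n)"
      using gen generates_sym_imp_alt by blast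
  next
    fix x assume x: "x \<in> gen_graph_verts (sym_group n)" "x \<notin> M \<union> X - {\<one>\<^bsub>sym_group n\<^esub>}"
    then have xp: "x permutes K \<union> L" "x \<noteq> id" "x \<notin> M" "x \<notin> X" using verts by (auto simp: sym_group_one)
    interpret two_parts K L x using fin disj xp by unfold_locales
    have "good K L x"
    proof (rule good_if_moved[OF gKL KL])
      show "x ` K \<noteq> K" using xp M by blast
      show "x \<noteq> transpose a b" if "a \<in> K" "b \<in> L" for a b using that xp unfolding X_def by blast
    qed
    then obtain m where m: "m permutes K \<union> L" "m ` K = K" "generates_sym (K \<union> L) {x, m}"
      unfolding good_def by blast
    then have "m \<in> M" using M by blast
    moreover have "m \<noteq> id" using m(3) commuting_not_generates_sym[OF xp(1,2)] cU n by auto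
    ultimately show "\<exists>m\<in>M. m \<in> gen_graph_verts (sym_group n) \<and> m \<noteq> x \<and>
        generate (sym_group n) {x, m} = carrier (sym_group n)"
      using m verts gen[OF xp(1) m(1)] xp by blast
  qed auto
qed

section \<open>Small degrees\<close>

text \<open>Position 0 holds the dummy fixed point 0, so that the list can be indexed by the points
  \<open>1..n\<close> themselves.\<close>

definition perm_list :: "nat \<Rightarrow> (nat \<Rightarrow> nat) \<Rightarrow> nat list"
  where "perm_list n f = map f [0..<Suc n]"

definition list_comp :: "nat list \<Rightarrow> nat list \<Rightarrow> nat list"
  where "list_comp p q = map ((!) p) q"

text \<open>Every permutation of \<open>{1..Suc n}\<close> is a permutation of \<open>{1..n}\<close>
  followed by a swap of \<open>Suc n\<close> with some b; the parity is kept exactly when b is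
  \<open>Suc n\<close>.\<close>

primrec perm_lists :: "nat \<Rightarrow> (bool \<times> nat list) list"
  where
    "perm_lists 0 = [(True, [0])]"
  | "perm_lists (Suc n) = concat (map (\<lambda>b. map (\<lambda>(e, p).
      (e = (b = Suc n), map (transpose (Suc n) b) (p @ [Suc n]))) (perm_lists n)) [1..<Suc (Suc n)])"

text \<open>\<open>True\<close> stands for the first generator and \<open>False\<close> for the
  second; the rightmost letter acts first.\<close>

primrec word_list :: "nat \<Rightarrow> nat list \<Rightarrow> nat list \<Rightarrow> bool list \<Rightarrow> nat list"
  where
    "word_list n p q [] = [0..<Suc n]"
  | "word_list n p q (b # w) = list_comp (if b then p else q) (word_list n p q w)"

text \<open>One step of block closure: if p maps a point of \<open>E\<close> into \<open>E\<close>,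
  a block containing \<open>E\<close> meets its p-image and so contains the image of
  \<open>E\<close>. Without such a point nothing may be concluded and \<open>E\<close> stays as it
  is.\<close>

definition grow :: "nat list \<Rightarrow> nat list \<Rightarrow> nat list"
  where "grow p E = (if list_ex (\<lambda>i. p ! i \<in> set E) E
    then E @ filter (\<lambda>i. i \<notin> set E) (map ((!) p) E) else E)"

text \<open>The word evaluates to a 3-cycle, and a few images under the generators show that no
  proper block contains its support.\<close>

definition generating_word :: "nat \<Rightarrow> nat list \<Rightarrow> nat list \<Rightarrow> bool list \<Rightarrow> bool"
  where "generating_word n p q w \<longleftrightarrow>
    (let r = word_list n p q w in
     case filter (\<lambda>i. r ! i \<noteq> i) [1..<Suc n] of
       [a, b, c] \<Rightarrow> r ! a \<in> {b, c} \<and> r ! b \<in> {a, c} \<and> r ! c \<in> {a, b} \<and> r ! 0 = 0 \<and>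
         r ! a \<noteq> r ! b \<and> r ! a \<noteq> r ! c \<and> r ! b \<noteq> r ! c \<and>
         (let E = grow q (grow p (grow q (grow p (grow q (grow p [a, b, c]))))) in list_all (\<lambda>i. i \<in> set E) [1..<Suc n])
     | _ \<Rightarrow> False)"

definition stab_list :: "nat \<Rightarrow> nat list \<Rightarrow> bool"
  where "stab_list k p \<longleftrightarrow> list_all (\<lambda>i. p ! i \<le> k) [1..<Suc k]"

text \<open>The flag \<open>s\<close> selects the symmetric (\<open>True\<close>) or the alternating group; the boolean attached
  to a list is the parity of the permutation, \<open>True\<close> meaning even.\<close>

definition stab_lists :: "bool \<Rightarrow> nat \<Rightarrow> nat \<Rightarrow> (bool \<times> nat list) list"
  where "stab_lists s n k = filter (\<lambda>(e, p). (s \<or> e) \<and> stab_list k p) (perm_lists n)"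

text \<open>The equation g q = q p expresses that p is the conjugate of g by q without computing an
  inverse.\<close>

definition conj_list :: "nat list \<Rightarrow> (bool \<times> nat list) list \<Rightarrow> nat list \<Rightarrow> bool"
  where "conj_list g Ms p \<longleftrightarrow> list_ex (\<lambda>(_, q). list_comp g q = list_comp q p) Ms"

text \<open>A word only certifies the alternating group; for the symmetric group one of the two
  generators must in addition be odd.\<close>

definition all_adjacent ::
    "bool \<Rightarrow> nat \<Rightarrow> nat \<Rightarrow> nat list \<Rightarrow> (bool \<times> nat list) list \<Rightarrow>
      ((bool \<times> nat list) \<times> bool list) list \<Rightarrow> bool"
  where "all_adjacent s n k g Ms ws \<longleftrightarrow> list_all (\<lambda>(e, p). (s \<or> e) \<longrightarrow> stab_list k p \<or>
    list_ex (\<lambda>((e', q), w). (s \<longrightarrow> \<not> e \<or> \<not> e') \<and> generating_word n p q w) ws \<or>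
    conj_list g Ms p) (perm_lists n)"

definition words_ok ::
    "nat \<Rightarrow> (bool \<times> nat list) list \<Rightarrow> ((bool \<times> nat list) \<times> bool list) list \<Rightarrow> bool"
  where "words_ok n Ms ws \<longleftrightarrow> list_all (\<lambda>(q, w). q \<in> set Ms \<and> snd q \<noteq> [0..<Suc n]) ws"

definition preserves_colour :: "nat \<Rightarrow> nat list \<Rightarrow> nat list \<Rightarrow> bool"
  where "preserves_colour n c p \<longleftrightarrow> list_all (\<lambda>i. list_all (\<lambda>j.
    (c ! (p ! i) = c ! (p ! j)) = (c ! i = c ! j)) [1..<Suc n]) [1..<Suc n]"

definition colour_ok :: "nat \<Rightarrow> nat list \<Rightarrow> bool"
  where "colour_ok n c \<longleftrightarrow> list_ex (\<lambda>a. list_ex (\<lambda>b. list_ex (\<lambda>d.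
    a \<noteq> b \<and> c ! a = c ! b \<and> c ! d \<noteq> c ! a) [1..<Suc n]) [1..<Suc n]) [1..<Suc n]"

text \<open>Three reasons why g and q fail to generate: q squares to the identity as g does, both
  are even in a symmetric group, or they preserve a common colouring. Testing g alone is enough,
  since a pair with another conjugate can be conjugated back by an element of
  \<open>M\<close>.\<close>

definition none_adjacent ::
    "bool \<Rightarrow> nat \<Rightarrow> nat list \<Rightarrow> (bool \<times> nat list) list \<Rightarrow> nat list list \<Rightarrow> bool"
  where "none_adjacent s n g Ms cs \<longleftrightarrow>
    list_all (\<lambda>(e, q). list_comp q q = [0..<Suc n] \<or> s \<and> e \<or>
      list_ex (\<lambda>c. preserves_colour n c g \<and> preserves_colour n c q \<and> colour_ok n c) cs) Ms"

section \<open>Correctness of the list computations\<close>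

lemma nth_perm_list: "i \<le> n \<Longrightarrow> perm_list n f ! i = f i"
  unfolding perm_list_def by (simp del: upt_Suc)

lemma permutes_le: "f permutes {1..n} \<Longrightarrow> i \<le> n \<Longrightarrow> f i \<le> (n::nat)"
  by (cases "i = 0") (use permutes_in_image[of f "{1..n}" i] permutes_not_in[of f "{1..n}" 0] in auto)

lemma list_comp_perm_list:
  "g permutes {1..n} \<Longrightarrow> list_comp (perm_list n f) (perm_list n g) = perm_list n (f \<circ> g)"
  unfolding list_comp_def perm_list_def[of n g] perm_list_def[of n "f \<circ> g"]
  using permutes_le by (auto simp: nth_perm_list simp del: upt_Suc)

lemma perm_list_id: "perm_list n id = [0..<Suc n]"
  unfolding perm_list_def by simp

lemma perm_list_inject:
  assumes "perm_list n f = perm_list n g" "f permutes {1..n}" "g permutes {1..n}" shows "f = g"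
proof
  fix z show "f z = g z"
  proof (cases "z \<le> n")
    case True then show ?thesis using nth_perm_list[of z n f] nth_perm_list[of z n g] assms by simp
  next
    case False
    then show ?thesis using permutes_not_in[OF assms(2), of z] permutes_not_in[OF assms(3), of z] by simp
  qed
qed

lemma set_perm_lists:
  "set (perm_lists n) = (\<lambda>f. (evenperm f, perm_list n f)) ` {f. f permutes {1..n}}"
proof (induction n)
  case 0
  have "perm_list 0 (\<lambda>x. x) = [0]" by (simp add: perm_list_def)
  then show ?case by (simp add: id_def)
next
  case (Suc n)
  let ?t = "\<lambda>b p. transpose (Suc n) b \<circ> p"
  have step: "(evenperm f = (b = Suc n), map (transpose (Suc n) b) (perm_list n f @ [Suc n])) =
      (evenperm (?t b f), perm_list (Suc n) (?t b f))" if f: "f permutes {1..n}" for b f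
  proof -
    have "permutation f" using f permutes_imp_permutation[of "{1..n}"] by blast
    then have "evenperm (?t b f) \<longleftrightarrow> evenperm f = (b = Suc n)"
      by (auto simp: evenperm_comp permutation_swap_id evenperm_swap)
    moreover have "f (Suc n) = Suc n" using permutes_not_in[OF f] by simp
    then have "perm_list (Suc n) (?t b f) = map (transpose (Suc n) b) (perm_list n f @ [Suc n])"
      unfolding perm_list_def by simp
    ultimately show ?thesis by simp
  qed
  have I: "{1..Suc n} = insert (Suc n) {1..n}" by auto
  define A where "A b = (\<lambda>(e, p). (e = (b = Suc n), map (transpose (Suc n) b) (p @ [Suc n]))) ` set (perm_lists n)" for b
  have A: "A b = (\<lambda>f. (evenperm (?t b f), perm_list (Suc n) (?t b f))) ` {f. f permutes {1..n}}" for b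
    unfolding A_def Suc.IH image_image using step by (intro image_cong refl) simp
  have "set (perm_lists (Suc n)) = (\<Union>b\<in>set [1..<Suc (Suc n)]. A b)"
    unfolding A_def by (simp del: upt_Suc)
  also have "set [1..<Suc (Suc n)] = {1..Suc n}" by (simp only: set_upt atLeastLessThanSuc_atLeastAtMost)
  also have "(\<Union>b\<in>{1..Suc n}. A b) = (\<lambda>f. (evenperm f, perm_list (Suc n) f)) ` {f. f permutes {1..Suc n}}"
  proof -
    have "{f. f permutes insert (Suc n) {1..n}} = (\<Union>b\<in>insert (Suc n) {1..n}. ?t b ` {f. f permutes {1..n}})"
    proof -
      have "(\<lambda>(b, p). F b p) ` {(b, p). b \<in> V \<and> p \<in> W} = (\<Union>b\<in>V. F b ` W)"
        for F :: "nat \<Rightarrow> (nat \<Rightarrow> nat) \<Rightarrow> (nat \<Rightarrow> nat)" and V W by auto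
      then show ?thesis unfolding permutes_insert .
    qed
    then show ?thesis unfolding A I by (simp only: image_UN image_image)
  qed
  finally show ?case .
qed

lemma stab_list_iff:
  assumes f: "f permutes {1..n}" and k: "k \<le> n"
  shows "stab_list k (perm_list n f) \<longleftrightarrow> f ` {1..k} = {1..k}"
proof
  assume stab: "stab_list k (perm_list n f)"
  have le: "f i \<le> k" if "i \<in> {1..k}" for i
    
  proof -
    have "i \<in> set [1..<Suc k]" using that by (simp del: upt_Suc)
    then have "perm_list n f ! i \<le> k" using stab unfolding stab_list_def list_all_iff by blast
    then show ?thesis using nth_perm_list[of i n f] that k by simp
  qed
  have "f i \<noteq> 0" if "i \<in> {1..k}" for i
    using that permutes_in_image[OF f, of i] k by auto
  then have "f ` {1..k} \<subseteq> {1..k}" using le by (auto simp: Suc_le_eq)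
  moreover have "card (f ` {1..k}) = card {1..k}"
    using permutes_inj[OF f] by (simp add: card_image inj_on_subset)
  ultimately show "f ` {1..k} = {1..k}" by (simp add: card_subset_eq)
next
  assume f: "f ` {1..k} = {1..k}"
  have "f i \<le> k" if "i \<in> {1..k}" for i using that f by (metis atLeastAtMost_iff imageI)
  then show "stab_list k (perm_list n f)"
    using k by (auto simp: stab_list_def list_all_iff nth_perm_list simp del: upt_Suc)
qed

lemma word_list_perm:
  assumes f: "f permutes {1..n}" and g: "g permutes {1..n}"
  shows "\<exists>h. h permutes {1..n} \<and> word_list n (perm_list n f) (perm_list n g) w = perm_list n h \<and>
    (\<forall>H. perm_closed H \<longrightarrow> {f, g} \<subseteq> H \<longrightarrow> h \<in> H)"
proof (induction w)
  case Nil
  show ?case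
  proof (intro exI[of _ id] conjI allI impI)
    show "id permutes {1..n}" by (rule permutes_id)
    show "word_list n (perm_list n f) (perm_list n g) [] = perm_list n id"
      unfolding perm_list_id by simp
    show "id \<in> H" if "perm_closed H" for H using perm_closedD(1)[OF that] .
  qed
next
  case (Cons b w)
  then obtain h where h: "h permutes {1..n}" "word_list n (perm_list n f) (perm_list n g) w = perm_list n h"
    "\<And>H. perm_closed H \<Longrightarrow> {f, g} \<subseteq> H \<Longrightarrow> h \<in> H" by blast
  define c where "c = (if b then f else g)"
  have "c permutes {1..n}" using f g unfolding c_def by simp
  then have "c \<circ> h permutes {1..n}" using h(1) permutes_compose by blast
  moreover have "word_list n (perm_list n f) (perm_list n g) (b # w) = perm_list n (c \<circ> h)"
    using list_comp_perm_list[OF h(1), of c] h(2) unfolding c_def by (cases b) simp_all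
  moreover have "c \<circ> h \<in> H" if "perm_closed H" "{f, g} \<subseteq> H" for H
    using perm_closedD(2)[OF that(1)] h(3)[OF that] that(2) unfolding c_def by simp
  ultimately show ?case by blast
qed

lemma set_grow_subset:
  assumes R: "inv_equiv {1..n} F R" and g: "g \<in> F" and E: "set E \<subseteq> {e. (a, e) \<in> R}"
  shows "set (grow (perm_list n g) E) \<subseteq> {e. (a, e) \<in> R}"
proof -
  have eq: "equiv {1..n} R" using R unfolding inv_equiv_def by blast
  then have RU: "R \<subseteq> {1..n} \<times> {1..n}" and sy: "sym R" and tr: "trans R" unfolding equiv_def by auto
  have Ele: "e \<in> {1..n}" if "e \<in> set E" for e using that E RU by blast
  then have nth: "perm_list n g ! e = g e" if "e \<in> set E" for e using that nth_perm_list by simp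
  have "(a, g e) \<in> R" if i: "i \<in> set E" "g i \<in> set E" and e: "e \<in> set E" for i e
  proof -
    have ai: "(a, i) \<in> R" "(a, e) \<in> R" "(a, g i) \<in> R" using E i e by auto
    then have "(i, e) \<in> R" using symD[OF sy ai(1)] transD[OF tr] by blast
    then have "(g i, g e) \<in> R" using R g Ele[OF i(1)] Ele[OF e] unfolding inv_equiv_def by blast
    then show ?thesis using transD[OF tr ai(3)] by blast
  qed
  then show ?thesis using E nth unfolding grow_def by (auto simp: list_ex_iff)
qed

lemma generates_alt_if_generating_word:
  assumes f: "f permutes {1..n}" and g: "g permutes {1..n}"
    and w: "generating_word n (perm_list n f) (perm_list n g) w"
  shows "generates_alt {1..n} {f, g}"
proof -
  obtain h where h: "h permutes {1..n}" "word_list n (perm_list n f) (perm_list n g) w = perm_list n h"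
    "\<And>H. perm_closed H \<Longrightarrow> {f, g} \<subseteq> H \<Longrightarrow> h \<in> H" using word_list_perm[OF f g] by blast
  define mv where "mv = filter (\<lambda>i. perm_list n h ! i \<noteq> i) [1..<Suc n]"
  obtain a b c where abc: "mv = [a, b, c]"
    using w unfolding generating_word_def h(2) Let_def mv_def[symmetric]
    by (auto split: list.splits)
  let ?p = "grow (perm_list n f)" and ?q = "grow (perm_list n g)"
  define E where "E = ?q (?p (?q (?p (?q (?p [a, b, c])))))"
  have "set mv = {i \<in> {1..n}. h i \<noteq> i}" unfolding mv_def by (auto simp: nth_perm_list simp del: upt_Suc)
  then have mem: "a \<in> {1..n}" "b \<in> {1..n}" "c \<in> {1..n}" and fx: "\<And>i. i \<in> {1..n} \<Longrightarrow> i \<notin> {a, b, c} \<Longrightarrow> h i = i"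
    unfolding abc by auto
  have "distinct mv" unfolding mv_def by simp
  then have d: "distinct [a, b, c]" unfolding abc .
  have le: "a \<le> n" "b \<le> n" "c \<le> n" using mem by auto
  have hh: "h a \<in> {b, c}" "h b \<in> {a, c}" "h c \<in> {a, b}" "h a \<noteq> h b" "h a \<noteq> h c" "h b \<noteq> h c"
    and E: "list_all (\<lambda>i. i \<in> set E) [1..<Suc n]"
    using w unfolding generating_word_def h(2) Let_def mv_def[symmetric] abc E_def
    by (simp_all add: nth_perm_list le del: upt_Suc)
  have h_other: "h z = z" if "z \<notin> {a, b, c}" for z
    using that fx permutes_not_in[OF h(1)] by blast
  have "h = cyc3 a b c \<or> h = cyc3 a c b"
  proof (cases "h a = b")
    case True
    then have "h b = c" "h c = a" using hh by auto
    then have "h = cyc3 a b c" using True h_other d by (auto simp: cyc3_def fun_eq_iff)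
    then show ?thesis by blast
  next
    case False
    then have "h a = c" "h c = b" "h b = a" using hh by auto
    then have "h = cyc3 a c b" using h_other d by (auto simp: cyc3_def fun_eq_iff)
    then show ?thesis by blast
  qed
  then have cy: "cyc3 a b c \<in> H" if H: "perm_closed H" "{f, g} \<subseteq> H" for H
  proof
    assume "h = cyc3 a c b"
    then have "cyc3 a c b \<in> H" using h(3)[OF H] by simp
    then have "cyc3 b c a \<in> H" using cyc3_mem_rev[OF H(1)] d by auto
    then have "cyc3 c a b \<in> H" using cyc3_mem_rot[OF H(1)] d by auto
    then show ?thesis using cyc3_mem_rot[OF H(1)] d by auto
  qed (use h(3)[OF H] in simp)
  show ?thesis
  proof (rule generates_alt_if_cyc3[OF _ _ mem d cy])
    fix R assume R: "inv_equiv {1..n} {f, g} R" and ab: "(a, b) \<in> R" "(a, c) \<in> R"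
    have eq: "equiv {1..n} R" using R unfolding inv_equiv_def by blast
    then have RU: "R \<subseteq> {1..n} \<times> {1..n}" and rf: "refl_on {1..n} R" and sy: "sym R" and tr: "trans R"
      unfolding equiv_def by auto
    have "set [a, b, c] \<subseteq> {e. (a, e) \<in> R}" using ab rf mem unfolding refl_on_def by auto
    then have "set E \<subseteq> {e. (a, e) \<in> R}"
      unfolding E_def by (intro set_grow_subset[OF R]) simp_all
    moreover have "{1..n} \<subseteq> set E" using E by (auto simp: list_all_iff)
    ultimately have "(a, e) \<in> R" if "e \<in> {1..n}" for e using that by blast
    then have "(e, e') \<in> R" if "e \<in> {1..n}" "e' \<in> {1..n}" for e e'
      using that symD[OF sy] transD[OF tr] by blast
    then show "R = {1..n} \<times> {1..n}" using RU by auto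
  qed (use f g in auto)
qed

lemma not_generates_alt_if_preserves_colour:
  assumes f: "f permutes {1..n}" and g: "g permutes {1..n}" and n: "4 \<le> n"
    and c: "preserves_colour n c (perm_list n f)" "preserves_colour n c (perm_list n g)" "colour_ok n c"
  shows "\<not> generates_alt {1..n} {f, g}"
proof -
  obtain a b d where abd: "a \<in> {1..n}" "b \<in> {1..n}" "d \<in> {1..n}" "a \<noteq> b" "c ! a = c ! b" "c ! d \<noteq> c ! a"
    using c(3) unfolding colour_ok_def list_ex_iff set_upt atLeastLessThanSuc_atLeastAtMost by blast
  have "c ! h y = c ! h z \<longleftrightarrow> c ! y = c ! z"
    if "preserves_colour n c (perm_list n h)" "y \<in> {1..n}" "z \<in> {1..n}" for h y z
  proof -
    have "perm_list n h ! y = h y" "perm_list n h ! z = h z" using that by (auto intro: nth_perm_list)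
    then show ?thesis
      using that(1)[unfolded preserves_colour_def list_all_iff set_upt atLeastLessThanSuc_atLeastAtMost,
          rule_format, OF that(2,3)] by simp
  qed
  then show ?thesis
    using f g n c(1,2) by (intro not_generates_alt_if_colour[of "{f, g}" "{1..n}" "(!) c", OF _ _ _ abd]) auto
qed

text \<open>Moves the conjugation from g to q, so that the finite check needs to treat only g
  itself.\<close>

lemma generates_alt_conj:
  assumes m: "m permutes U" and U: "finite U" and gq: "g permutes U" "q permutes U" and gen: "generates_alt U {inv' m \<circ> g \<circ> m, q}"
  shows "generates_alt U {g, m \<circ> q \<circ> inv' m}"
  unfolding generates_alt_def
proof (intro allI impI)
  fix H p assume H: "perm_closed H" "{g, m \<circ> q \<circ> inv' m} \<subseteq> H" and p: "p permutes U" "evenperm p"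
  have mm: "inv' m (m z) = z" "m (inv' m z) = z" for z using permutes_inverses[OF m] by auto
  define H' where "H' = {h. h permutes U \<and> m \<circ> h \<circ> inv' m \<in> H}"
  have "h \<circ> h' \<in> H'" if hh: "h \<in> H'" "h' \<in> H'" for h h'
  proof -
    have "(m \<circ> h \<circ> inv' m) \<circ> (m \<circ> h' \<circ> inv' m) \<in> H"
      using hh perm_closedD(2)[OF H(1)] unfolding H'_def by blast
    moreover have "(m \<circ> h \<circ> inv' m) \<circ> (m \<circ> h' \<circ> inv' m) = m \<circ> (h \<circ> h') \<circ> inv' m"
      by (auto simp: fun_eq_iff mm)
    ultimately show ?thesis using hh permutes_compose unfolding H'_def by auto
  qed
  moreover have "inv' h \<in> H'" if hH: "h \<in> H'" for h
  proof -
    have h: "h permutes U" using hH unfolding H'_def by blast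
    have "inv' (m \<circ> h \<circ> inv' m) = m \<circ> inv' h \<circ> inv' m"
      by (rule inv_unique_comp) (auto simp: fun_eq_iff mm permutes_inverses[OF h])
    then show ?thesis using hH perm_closedD(3)[OF H(1)] permutes_inv[OF h] unfolding H'_def by force
  qed
  moreover have "m \<circ> id \<circ> inv' m = id" by (auto simp: fun_eq_iff mm)
  then have "id \<in> H'" using permutes_id[of U] perm_closedD(1)[OF H(1)] unfolding H'_def by auto
  ultimately have H': "perm_closed H'" unfolding perm_closed_def by blast
  have "m \<circ> (inv' m \<circ> g \<circ> m) \<circ> inv' m = g" by (auto simp: fun_eq_iff mm)
  then have "{inv' m \<circ> g \<circ> m, q} \<subseteq> H'"
    using H(2) gq m unfolding H'_def by (auto intro!: permutes_compose permutes_inv)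
  moreover have "inv' m \<circ> p \<circ> m permutes U" using m p by (intro permutes_compose permutes_inv)
  moreover have "permutation m" "permutation p" using m p U permutes_imp_permutation by blast+
  then have "evenperm (inv' m \<circ> p \<circ> m)"
    using p(2) by (auto simp: evenperm_comp permutation_compose permutation_inverse evenperm_inv)
  ultimately have "inv' m \<circ> p \<circ> m \<in> H'" using gen H' unfolding generates_alt_def by blast
  moreover have "m \<circ> (inv' m \<circ> p \<circ> m) \<circ> inv' m = p" by (auto simp: fun_eq_iff mm)
  ultimately show "p \<in> H" unfolding H'_def by auto
qed

text \<open>The words \<open>ws\<close> give each vertex outside the set a neighbour in
  \<open>M\<close>, and the colourings \<open>cs\<close> help to show that g has none there. Pairs
  inside \<open>M\<close> preserve \<open>{1..k}\<close>, and pairs of conjugates of g are pairs of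
  involutions.\<close>

lemma small_coclique:
  fixes n k :: nat and s :: bool and g :: "nat \<Rightarrow> nat"
  assumes n: "4 \<le> n" and k: "1 \<le> k" "k < n"
    and g: "g permutes {1..n}" "evenperm g" "g \<circ> g = id"
    and Ms: "stab_lists s n k = Ms"
    and adj: "all_adjacent s n k (perm_list n g) Ms ws" "words_ok n Ms ws"
    and nadj: "none_adjacent s n (perm_list n g) Ms cs"
  defines "G \<equiv> if s then sym_group n else alt_group n"
  defines "M \<equiv> set_stabilizer G k"
  shows "unique_maximal_coclique_containing G M ((M \<union> conjugates_by G g M) - {\<one>\<^bsub>G\<^esub>})"
proof -
  define U where "U = {1..n}"
  define X where "X = {inv' m \<circ> g \<circ> m | m. m \<in> M}"
  have finU: "finite U" and cU: "4 \<le> card U" unfolding U_def using n by auto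
  have gU: "g permutes U" using g unfolding U_def by simp
  have car: "h \<in> carrier G \<longleftrightarrow> h permutes U \<and> (s \<or> evenperm h)" for h
    unfolding G_def U_def by (simp only: sym_group_carrier alt_group_carrier if_distrib split: if_split) blast
  have M: "h \<in> M \<longleftrightarrow> h permutes U \<and> (s \<or> evenperm h) \<and> h ` {1..k} = {1..k}" for h
    unfolding M_def G_def U_def using set_stabilizer_sym[of h n k] set_stabilizer_alt[of h n k] by (cases s) auto
  have one: "\<one>\<^bsub>G\<^esub> = id" unfolding G_def by (simp only: sym_group_one alt_group_one if_cancel split: if_split) blast
  have conj: "inv\<^bsub>G\<^esub> m \<otimes>\<^bsub>G\<^esub> g \<otimes>\<^bsub>G\<^esub> m = inv' m \<circ> g \<circ> m" if "m \<in> M" for m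
  proof -
    have "m \<in> carrier G" using that car M by blast
    then show ?thesis unfolding G_def
      by (cases s) (simp_all only: if_True if_False sym_group_mult alt_group_mult sym_group_inv_equality alt_group_inv_equality)
  qed
  have X: "conjugates_by G g M = X"
    unfolding conjugates_by_def X_def using conj by (intro Collect_cong) (metis)
  have verts: "h \<in> gen_graph_verts G \<longleftrightarrow> h permutes U \<and> (s \<or> evenperm h) \<and> h \<noteq> id" for h
    unfolding gen_graph_verts_def by (simp add: car one)
  have gen: "generate G {x, y} = carrier G \<longleftrightarrow> (if s then generates_sym U {x, y} else generates_alt U {x, y})"
    if "x \<in> carrier G" "y \<in> carrier G" for x y
    using that generate_sym_group_iff[of x n y] generate_alt_group_iff[of x n y]
    unfolding G_def U_def by (cases s) auto
  have gen_alt: "generates_alt U {x, y}" if "generate G {x, y} = carrier G" "x \<in> carrier G" "y \<in> carrier G" for x y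
    using gen[OF that(2,3)] that(1) generates_sym_imp_alt by (metis (full_types))
  have mem_Ms: "ep \<in> set Ms \<longleftrightarrow> (\<exists>f\<in>M. ep = (evenperm f, perm_list n f))" for ep
  proof -
    have "ep \<in> set Ms \<longleftrightarrow> (\<exists>f. f permutes {1..n} \<and> ep = (evenperm f, perm_list n f) \<and>
        (s \<or> evenperm f) \<and> stab_list k (perm_list n f))"
      unfolding Ms[symmetric] stab_lists_def set_filter set_perm_lists by auto
    then show ?thesis using M stab_list_iff[of _ n k] k unfolding U_def by auto
  qed
  have XU: "h permutes U" "evenperm h" "h \<circ> h = id" if hX: "h \<in> X" for h
  proof -
    obtain m where m: "m \<in> M" "h = inv' m \<circ> g \<circ> m" using hX unfolding X_def by blast
    then have mU: "m permutes U" using M by blast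
    show "h permutes U" unfolding m(2) using mU gU by (intro permutes_compose permutes_inv)
    have "permutation m" "permutation g" using mU gU finU permutes_imp_permutation by blast+
    then show "evenperm h" unfolding m(2) using g(2)
      by (auto simp: evenperm_comp permutation_compose permutation_inverse evenperm_inv)
    have "g (g z) = z" for z using g(3) by (metis comp_apply id_apply)
    then show "h \<circ> h = id" unfolding m(2) by (auto simp: fun_eq_iff permutes_inverses[OF mU])
  qed
  have Mcar: "m \<in> carrier G" if "m \<in> M" for m using that M car by blast
  have Xcar: "h \<in> carrier G" if "h \<in> X" for h using XU[OF that] car by blast
  have MM: "generate G {x, y} \<noteq> carrier G" if "x \<in> M" "y \<in> M" for x y
  proof
    assume "generate G {x, y} = carrier G"
    then have "generates_alt U {x, y}" using gen_alt Mcar that by blast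
    moreover have "\<not> generates_alt U {x, y}"
    proof (rule not_generates_alt_if_invariant[of _ U "{1..k}" 1 n, rotated])
      show "h permutes U" "h ` {1..k} \<subseteq> {1..k}" if "h \<in> {x, y}" for h
        using that \<open>x \<in> M\<close> \<open>y \<in> M\<close> M by auto
    qed (use k cU in \<open>auto simp: U_def\<close>)
    ultimately show False by blast
  qed
  have XX: "generate G {x, y} \<noteq> carrier G" if "x \<in> X" "y \<in> X" "x \<noteq> y" for x y
    using gen_alt[OF _ Xcar[OF that(1)] Xcar[OF that(2)]]
      not_generates_alt_if_involutions[OF XU(1)[OF that(1)] XU(1)[OF that(2)] cU XU(3)[OF that(1)] XU(3)[OF that(2)] that(3)]
    by blast
  have MX: "generate G {h, q} \<noteq> carrier G" if q: "q \<in> M" and h: "h \<in> X" and ne: "h \<noteq> q" for q h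
  proof
    assume ge: "generate G {h, q} = carrier G"
    then have alt: "generates_alt U {h, q}" using gen_alt Mcar Xcar q h by blast
    obtain m where m: "m \<in> M" "h = inv' m \<circ> g \<circ> m" using h unfolding X_def by blast
    then have mU: "m permutes U" using M by blast
    have qU: "q permutes U" using q M by blast
    define q' where "q' = m \<circ> q \<circ> inv' m"
    have q'U: "q' permutes U" unfolding q'_def using mU qU by (intro permutes_compose permutes_inv)
    have "permutation m" "permutation q" using mU qU finU permutes_imp_permutation by blast+
    then have ev: "evenperm q' \<longleftrightarrow> evenperm q" unfolding q'_def
      by (auto simp: evenperm_comp permutation_compose permutation_inverse evenperm_inv)
    have mk: "m ` {1..k} = {1..k}" "q ` {1..k} = {1..k}" using m(1) q M by blast+
    then have "inv' m ` {1..k} = {1..k}" using permutes_inj[OF mU] by (metis inj_imp_inv_eq image_inv_f_f)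
    then have "q' ` {1..k} = {1..k}" unfolding q'_def image_comp[symmetric] using mk by simp
    then have "q' \<in> M" using q'U ev q M by blast
    then have "(evenperm q', perm_list n q') \<in> set Ms" using mem_Ms by blast
    then consider "list_comp (perm_list n q') (perm_list n q') = [0..<Suc n]" | "s" "evenperm q'" |
      c where "preserves_colour n c (perm_list n g)" "preserves_colour n c (perm_list n q')" "colour_ok n c"
      using nadj unfolding none_adjacent_def list_all_iff list_ex_iff by blast
    then show False
    proof cases
      case 1
      have "q' \<circ> q' permutes {1..n}" using q'U permutes_compose unfolding U_def by blast
      moreover have "perm_list n (q' \<circ> q') = perm_list n id"
        using 1 list_comp_perm_list[of q' n q'] q'U unfolding U_def perm_list_id by simp
      ultimately have "q' \<circ> q' = id" using perm_list_inject permutes_id by blast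
      then have "q' (q' (m z)) = m z" for z by (metis comp_apply id_apply)
      then have "m (q (q z)) = m z" for z unfolding q'_def by (simp add: permutes_inverses[OF mU])
      then have "q \<circ> q = id" using permutes_inj[OF mU] by (auto simp: inj_eq fun_eq_iff)
      then show False
        using not_generates_alt_if_involutions[OF XU(1)[OF h] qU cU XU(3)[OF h] _ ne] alt by blast
    next
      \<comment> \<open>Two even permutations stay inside the closed set of even permutations, which
        misses the transposition of 1 and n.\<close>
      case 2
      then have "generates_sym U {h, q}" using gen[OF Xcar[OF h] Mcar[OF q]] ge by simp
      moreover have "perm_closed {p. p permutes U \<and> evenperm p}"
      proof -
        have "permutation p" if "p permutes U" for p using that finU permutes_imp_permutation by blast
        then show ?thesis
          using permutes_id[of U] permutes_compose[of _ U] permutes_inv[of _ U]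
          unfolding perm_closed_def by (simp add: evenperm_comp evenperm_inv)
      qed
      moreover have "{h, q} \<subseteq> {p. p permutes U \<and> evenperm p}" using XU[OF h] qU ev 2 by simp
      moreover have "transpose 1 n permutes U" "\<not> evenperm (transpose 1 n)"
        unfolding U_def using n by (auto intro: permutes_swap_id simp: evenperm_swap)
      ultimately show False unfolding generates_sym_def by blast
    next
      case 3
      have "generates_alt U {g, q'}"
        using generates_alt_conj[OF mU finU gU qU] alt unfolding m(2) q'_def by blast
      then show False
        using not_generates_alt_if_preserves_colour[OF g(1) _ n 3] q'U unfolding U_def by blast
    qed
  qed
  show ?thesis
    unfolding X one
  proof (rule unique_maximal_cocliqueI)
    show "M \<union> X - {id} \<subseteq> gen_graph_verts G" using verts M XU by blast
    show "M - {\<one>\<^bsub>G\<^esub>} \<subseteq> M \<union> X - {id}" using one by auto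
    show "generate G {x, y} \<noteq> carrier G" if "x \<in> M \<union> X - {id}" "y \<in> M \<union> X - {id}" "x \<noteq> y" for x y
      using that MM[of x y] XX[of x y] MX[of y x] MX[of x y] by (metis DiffE UnE insert_commute)
    fix x assume x: "x \<in> gen_graph_verts G" "x \<notin> M \<union> X - {id}"
    then have xp: "x permutes U" "s \<or> evenperm x" "x \<notin> M" "x \<notin> X" using verts by blast+
    then have "(evenperm x, perm_list n x) \<in> set (perm_lists n)" unfolding set_perm_lists U_def by blast
    moreover have "\<not> stab_list k (perm_list n x)" using stab_list_iff[of x n k] xp k M unfolding U_def by auto
    moreover have "\<not> conj_list (perm_list n g) Ms (perm_list n x)"
    proof
      assume "conj_list (perm_list n g) Ms (perm_list n x)"
      then obtain e q where eq: "(e, q) \<in> set Ms" "list_comp (perm_list n g) q = list_comp q (perm_list n x)"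
        unfolding conj_list_def list_ex_iff by blast
      then obtain m where m: "m \<in> M" "q = perm_list n m" using mem_Ms by blast
      then have mU: "m permutes U" using M by blast
      have "perm_list n (g \<circ> m) = perm_list n (m \<circ> x)"
        using eq(2) list_comp_perm_list[of m n g] list_comp_perm_list[of x n m] mU xp m(2) unfolding U_def by simp
      moreover have "g \<circ> m permutes {1..n}" "m \<circ> x permutes {1..n}"
        using mU xp gU permutes_compose unfolding U_def by blast+
      ultimately have "g \<circ> m = m \<circ> x" using perm_list_inject by blast
      then have "g (m z) = m (x z)" for z by (metis comp_apply)
      then have "x = inv' m \<circ> g \<circ> m" by (auto simp: fun_eq_iff permutes_inverses[OF mU])
      then show False using m(1) xp unfolding X_def by blast
    qed
    ultimately obtain e' q w where w: "((e', q), w) \<in> set ws" "s \<longrightarrow> \<not> evenperm x \<or> \<not> e'"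
      "generating_word n (perm_list n x) q w"
      using adj(1) xp(2) unfolding all_adjacent_def list_all_iff list_ex_iff by blast
    then have "(e', q) \<in> set Ms" "q \<noteq> [0..<Suc n]"
      using adj(2) unfolding words_ok_def list_all_iff by auto
    then obtain m where m: "m \<in> M" "e' = evenperm m" "q = perm_list n m" "m \<noteq> id"
    proof -
      obtain m where m: "m \<in> M" "(e', q) = (evenperm m, perm_list n m)"
        using \<open>(e', q) \<in> set Ms\<close> mem_Ms by blast
      moreover have "m \<noteq> id" using m(2) \<open>q \<noteq> [0..<Suc n]\<close> perm_list_id[of n] by auto
      ultimately show ?thesis using that by blast
    qed
    have mU: "m permutes U" using m M by blast
    have alt: "generates_alt U {x, m}"
      using generates_alt_if_generating_word[of x n m w] w(3) m(3) mU xp unfolding U_def by blast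
    have "generates_sym U {x, m}" if s
    proof (cases "evenperm x")
      case True
      then show ?thesis using generates_sym_if_alt_odd[OF finU alt, of m] w(2) that m mU by blast
    next
      case False
      then show ?thesis using generates_sym_if_alt_odd[OF finU alt, of x] xp by blast
    qed
    then have "generate G {x, m} = carrier G" using gen[of x m] alt car xp Mcar[OF m(1)] by auto
    moreover have "m \<noteq> x" using xp m by blast
    moreover have "m \<in> gen_graph_verts G" using m verts M by blast
    ultimately show "\<exists>m\<in>M. m \<in> gen_graph_verts G \<and> m \<noteq> x \<and> generate G {x, m} = carrier G"
      using m(1) by blast
  qed
qed

section \<open>Data for the three small groups\<close>

definition stab_4_3 :: "(bool \<times> nat list) list"
  where "stab_4_3 = [
    (True, [0, 2, 3, 1, 4]), (False, [0, 3, 2, 1, 4]), (True, [0, 3, 1, 2, 4]),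
    (False, [0, 1, 3, 2, 4]), (False, [0, 2, 1, 3, 4]), (True, [0, 1, 2, 3, 4])]"

text \<open>The word \<open>[False]\<close> is used where the element of the stabiliser is itself a
  3-cycle, \<open>[True]\<close> where the outside vertex is one.\<close>

definition words_4_3 :: "((bool \<times> nat list) \<times> bool list) list"
  where "words_4_3 = [
    ((True, [0, 2, 3, 1, 4]), [False]), ((False, [0, 1, 3, 2, 4]), [True]),
    ((False, [0, 2, 1, 3, 4]), [True])]"

lemma stab_lists_4_3: "stab_lists True 4 3 = stab_4_3"
  by code_simp

lemma all_adjacent_4_3: "all_adjacent True 4 3 [0, 4, 3, 2, 1] stab_4_3 words_4_3"
  by code_simp

lemma words_ok_4_3: "words_ok 4 stab_4_3 words_4_3"
  by code_simp

text \<open>The list of colourings is empty: an element of the stabiliser, a copy of S_3, either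
  squares to the identity or is a 3-cycle and hence even, like g.\<close>

lemma none_adjacent_4_3: "none_adjacent True 4 [0, 4, 3, 2, 1] stab_4_3 []"
  by code_simp

lemma coclique_4_3:
  "unique_maximal_coclique_containing (sym_group 4) (set_stabilizer (sym_group 4) 3)
    ((set_stabilizer (sym_group 4) 3 \<union>
      conjugates_by (sym_group 4) (transpose 1 4 \<circ> transpose 2 3) (set_stabilizer (sym_group 4) 3)) -
      {\<one>\<^bsub>sym_group 4\<^esub>})"
proof -
  let ?g = "transpose 1 4 \<circ> transpose 2 3 :: nat \<Rightarrow> nat"
  have g: "?g permutes {1..4}" by (intro permutes_compose permutes_swap_id) auto
  have ev: "evenperm ?g" by (simp add: evenperm_comp permutation_swap_id evenperm_swap)
  have inv: "?g \<circ> ?g = id" by (auto simp: fun_eq_iff transpose_def)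
  have pl: "perm_list 4 ?g = [0, 4, 3, 2, 1]" by code_simp
  show ?thesis
    using small_coclique[OF _ _ _ g ev inv stab_lists_4_3, unfolded pl, OF _ _ _ all_adjacent_4_3 words_ok_4_3
        none_adjacent_4_3]
    by simp
qed

definition stab_5_3 :: "(bool \<times> nat list) list"
  where "stab_5_3 = [
    (True, [0, 3, 2, 1, 5, 4]), (True, [0, 1, 3, 2, 5, 4]), (True, [0, 2, 1, 3, 5, 4]),
    (True, [0, 2, 3, 1, 4, 5]), (True, [0, 3, 1, 2, 4, 5]), (True, [0, 1, 2, 3, 4, 5])]"

definition words_5_3 :: "((bool \<times> nat list) \<times> bool list) list"
  where "words_5_3 = [
    ((True, [0, 2, 3, 1, 4, 5]), [False]), ((True, [0, 1, 3, 2, 5, 4]), [True]),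
    ((True, [0, 2, 1, 3, 5, 4]), [True])]"

lemma stab_lists_5_3: "stab_lists False 5 3 = stab_5_3"
  by code_simp

lemma all_adjacent_5_3: "all_adjacent False 5 3 [0, 4, 3, 2, 1, 5] stab_5_3 words_5_3"
  by code_simp

lemma words_ok_5_3: "words_ok 5 stab_5_3 words_5_3"
  by code_simp

text \<open>The colouring singles out the point 5, fixed by g and by the two 3-cycles on
  \<open>{1, 2, 3}\<close>; all other stabiliser elements square to the identity.\<close>

lemma none_adjacent_5_3: "none_adjacent False 5 [0, 4, 3, 2, 1, 5] stab_5_3 [
    [0, 0, 0, 0, 0, 1]]"
  by code_simp

lemma coclique_5_3:
  "unique_maximal_coclique_containing (alt_group 5) (set_stabilizer (alt_group 5) 3)
    ((set_stabilizer (alt_group 5) 3 \<union>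
      conjugates_by (alt_group 5) (transpose 1 4 \<circ> transpose 2 3) (set_stabilizer (alt_group 5) 3)) -
      {\<one>\<^bsub>alt_group 5\<^esub>})"
proof -
  let ?g = "transpose 1 4 \<circ> transpose 2 3 :: nat \<Rightarrow> nat"
  have g: "?g permutes {1..5}" by (intro permutes_compose permutes_swap_id) auto
  have ev: "evenperm ?g" by (simp add: evenperm_comp permutation_swap_id evenperm_swap)
  have inv: "?g \<circ> ?g = id" by (auto simp: fun_eq_iff transpose_def)
  have pl: "perm_list 5 ?g = [0, 4, 3, 2, 1, 5]" by code_simp
  show ?thesis
    using small_coclique[OF _ _ _ g ev inv stab_lists_5_3, unfolded pl, OF _ _ _ all_adjacent_5_3 words_ok_5_3
        none_adjacent_5_3]
    by simp
qed

definition stab_6_4 :: "(bool \<times> nat list) list"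
  where "stab_6_4 = [
    (True, [0, 2, 3, 4, 1, 6, 5]), (True, [0, 3, 4, 2, 1, 6, 5]),
    (True, [0, 4, 2, 3, 1, 6, 5]), (True, [0, 4, 3, 1, 2, 6, 5]),
    (True, [0, 3, 1, 4, 2, 6, 5]), (True, [0, 1, 4, 3, 2, 6, 5]),
    (True, [0, 2, 4, 1, 3, 6, 5]), (True, [0, 4, 1, 2, 3, 6, 5]),
    (True, [0, 1, 2, 4, 3, 6, 5]), (True, [0, 3, 2, 1, 4, 6, 5]),
    (True, [0, 1, 3, 2, 4, 6, 5]), (True, [0, 2, 1, 3, 4, 6, 5]),
    (True, [0, 3, 2, 4, 1, 5, 6]), (True, [0, 4, 3, 2, 1, 5, 6]),
    (True, [0, 2, 4, 3, 1, 5, 6]), (True, [0, 3, 4, 1, 2, 5, 6]),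
    (True, [0, 1, 3, 4, 2, 5, 6]), (True, [0, 4, 1, 3, 2, 5, 6]),
    (True, [0, 4, 2, 1, 3, 5, 6]), (True, [0, 1, 4, 2, 3, 5, 6]),
    (True, [0, 2, 1, 4, 3, 5, 6]), (True, [0, 2, 3, 1, 4, 5, 6]),
    (True, [0, 3, 1, 2, 4, 5, 6]), (True, [0, 1, 2, 3, 4, 5, 6])]"

text \<open>The words of length 3 and 9 use a stabiliser element m that is a 4-cycle times the swap
  of 5 and 6. It has order 4, so the three leading letters of the long words amount to its
  inverse.\<close>

definition words_6_4 :: "((bool \<times> nat list) \<times> bool list) list"
  where "words_6_4 = [
    ((True, [0, 1, 3, 4, 2, 5, 6]), [False]), ((True, [0, 2, 3, 1, 4, 5, 6]), [False]),
    ((True, [0, 2, 4, 3, 1, 5, 6]), [False]), ((True, [0, 2, 3, 4, 1, 6, 5]), [True]),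
    ((True, [0, 2, 4, 1, 3, 6, 5]), [True]),
    ((True, [0, 2, 3, 4, 1, 6, 5]), [False, False, True]),
    ((True, [0, 2, 4, 1, 3, 6, 5]), [False, False, True]),
    ((True, [0, 3, 4, 2, 1, 6, 5]), [False, False, True]),
    ((True, [0, 2, 3, 4, 1, 6, 5]), [False, False, False, True, False, True, False, False, True]),
    ((True, [0, 2, 3, 4, 1, 6, 5]), [False, False, False, True, False, False, True, False, True]),
    ((True, [0, 2, 4, 1, 3, 6, 5]), [False, False, False, True, False, True, False, False, True]),
    ((True, [0, 2, 4, 1, 3, 6, 5]), [False, False, False, True, False, False, True, False, True])]"

lemma stab_lists_6_4: "stab_lists False 6 4 = stab_6_4"
  by code_simp

lemma all_adjacent_6_4: "all_adjacent False 6 4 [0, 5, 6, 3, 4, 1, 2] stab_6_4 words_6_4"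
  by code_simp

lemma words_ok_6_4: "words_ok 6 stab_6_4 words_6_4"
  by code_simp

text \<open>The first four colourings mark the sets \<open>{1, 5}\<close>, \<open>{2, 6}\<close>,
  \<open>{3}\<close>, \<open>{4}\<close>, which g preserves, for the 3-cycles fixing 1, 2, 3, 4
  respectively. The last three are block systems for the elements of order 4, one for each value of
  the square: \<open>{1, 2}, {3, 4}, {5, 6}\<close>, then \<open>{1, 3, 5}, {2, 4, 6}\<close>, then
  \<open>{1, 4, 5}, {2, 3, 6}\<close>.\<close>

lemma none_adjacent_6_4: "none_adjacent False 6 [0, 5, 6, 3, 4, 1, 2] stab_6_4 [
    [0, 1, 0, 0, 0, 1, 0], [0, 0, 1, 0, 0, 0, 1], [0, 0, 0, 1, 0, 0, 0], [0, 0, 0, 0, 1, 0, 0],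
    [0, 1, 1, 2, 2, 0, 0], [0, 1, 0, 1, 0, 1, 0], [0, 1, 0, 0, 1, 1, 0]]"
  by code_simp

lemma coclique_6_4:
  "unique_maximal_coclique_containing (alt_group 6) (set_stabilizer (alt_group 6) 4)
    ((set_stabilizer (alt_group 6) 4 \<union>
      conjugates_by (alt_group 6) (transpose 1 5 \<circ> transpose 2 6) (set_stabilizer (alt_group 6) 4)) -
      {\<one>\<^bsub>alt_group 6\<^esub>})"
proof -
  let ?g = "transpose 1 5 \<circ> transpose 2 6 :: nat \<Rightarrow> nat"
  have g: "?g permutes {1..6}" by (intro permutes_compose permutes_swap_id) auto
  have ev: "evenperm ?g" by (simp add: evenperm_comp permutation_swap_id evenperm_swap)
  have inv: "?g \<circ> ?g = id" by (auto simp: fun_eq_iff transpose_def)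
  have pl: "perm_list 6 ?g = [0, 5, 6, 3, 4, 1, 2]" by code_simp
  show ?thesis
    using small_coclique[OF _ _ _ g ev inv stab_lists_6_4, unfolded pl, OF _ _ _ all_adjacent_6_4 words_ok_6_4
        none_adjacent_6_4]
    by simp
qed

section \<open>The theorem\<close>

theorem theorem2:
  fixes n k :: nat
  shows
    "(n \<ge> 4 \<and> n > k \<and> 2 * k > n \<longrightarrow>
       (let G = sym_group n; M = set_stabilizer G k in
          (gcd n k > 1 \<longrightarrow>
             unique_maximal_coclique_containing G M
               ((M \<union> conjugates_by G (transpose 1 (k + 1)) M) - {\<one>\<^bsub>G\<^esub>})) \<and>
          ((n, k) = (4, 3) \<longrightarrow>
             unique_maximal_coclique_containing G M
               ((M \<union> conjugates_by G (transpose 1 4 \<circ> transpose 2 3) M) - {\<one>\<^bsub>G\<^esub>})))) \<and>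
     ((n, k) \<in> {(5, 3), (6, 4)} \<longrightarrow>
       (let G = alt_group n; M = set_stabilizer G k in
          ((n, k) = (5, 3) \<longrightarrow>
             unique_maximal_coclique_containing G M
               ((M \<union> conjugates_by G (transpose 1 4 \<circ> transpose 2 3) M) - {\<one>\<^bsub>G\<^esub>})) \<and>
          ((n, k) = (6, 4) \<longrightarrow>
             unique_maximal_coclique_containing G M
               ((M \<union> conjugates_by G (transpose 1 5 \<circ> transpose 2 6) M) - {\<one>\<^bsub>G\<^esub>}))))"
  by (auto simp only: Let_def sym_group_coclique coclique_4_3 coclique_5_3 coclique_6_4 prod.inject)

end
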